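(* Let $M$ be a two- or three-dimensional manifold and let $F$ be a $C^2$ geodesically reversible Finsler metric on $M$. If the geodesic flow of $F$ does not admit any non-trivial continuous integral of motion, then $F$ is the sum of a reversible Finsler metric and a closed $1$-form on $M$.
   Context: An asymmetric norm on a finite-dimensional real vector space is a nonnegative, positively homogeneous (of degree one), subadditive function vanishing only at the origin. It is a Minkowski norm if its square is $C^2$ with positive-definite Hessian outside the origin. A $C^2$ Finsler metric on $M$ is a continuous function $F:TM\to[0,\infty)$ that is $C^2$ outside the zero section and restricts to a Minkowski norm on each tangent space. It is reversible if $F(-v_x)=F(v_x)$ for all $v_x$. Geodesics are the extremals (with nowhere-zero velocity) of $\gamma\mapsto\int F(\gamma')\,dt$. A Finsler metric is geodesically reversible if any geodesic can be reparametrized in an orientation-reversing way so as to remain a geodesic. A $1$-form $\beta$ is regarded as the function $v_x\mapsto\beta_x(v_x)$ on $TM$. Let $STM:=(TM\setminus\mathbf{0})/\mathbb{R}^+$ be the space of tangent directions; the (local) geodesic flow induces a one-dimensional foliation of $STM$ by the lifts of geodesics. The geodesic flow admits no non-trivial continuous integral of motion if the only integrals are trivial, i.e. constant multiples of the Hamiltonian; in degree zero this says that every continuous function $STM\to\mathbb{R}$ that is constant along (the lift to $STM$ of) every geodesic is constant. *)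

theory Defs
  imports "HOL-Analysis.Analysis"
begin

section \<open>Functions of class \<open>C\<^sup>k\<close>\<close>

(* Only used for open S. In finite dimension, continuity of all iterated directional derivatives
   is continuity of the iterated Frechet derivatives in operator norm. *)
primrec Ck_on :: "nat \<Rightarrow> 'a::euclidean_space set \<Rightarrow> ('a \<Rightarrow> 'b::real_normed_vector) \<Rightarrow> bool" where
  "Ck_on 0 S f \<longleftrightarrow> continuous_on S f"
| "Ck_on (Suc k) S f \<longleftrightarrow> (\<forall>x\<in>S. f differentiable (at x)) \<and>
     (\<forall>v. Ck_on k S (\<lambda>x. frechet_derivative f (at x) v))"


section \<open>Smooth manifolds\<close>

(* A manifold modelled on 'e is a Hausdorff second countable type 'm with a smooth atlas.
   A chart is a pair (U, \<phi>); the values of \<phi> outside U are irrelevant. *)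
type_synonym ('m, 'e) chart = "'m set \<times> ('m \<Rightarrow> 'e)"

definition chart_inv :: "('m, 'e) chart \<Rightarrow> 'e \<Rightarrow> 'm" where
  "chart_inv c = inv_into (fst c) (snd c)"

definition chart_range :: "('m, 'e) chart \<Rightarrow> 'e set" where
  "chart_range c = snd c ` fst c"

definition smooth_atlas ::
  "('m::{t2_space,second_countable_topology}, 'e::euclidean_space) chart set \<Rightarrow> bool" where
  "smooth_atlas A \<longleftrightarrow>
     (\<Union>c\<in>A. fst c) = UNIV \<and>
     (\<forall>c\<in>A. open (fst c) \<and> open (chart_range c) \<and>
        homeomorphism (fst c) (chart_range c) (snd c) (chart_inv c)) \<and>
     (\<forall>c\<in>A. \<forall>d\<in>A. \<forall>k. Ck_on k (snd c ` (fst c \<inter> fst d)) (snd d \<circ> chart_inv c))"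

(* S is an open subset of a Euclidean space. *)
definition Ck_map ::
  "('m::topological_space, 'e::euclidean_space) chart set \<Rightarrow> nat \<Rightarrow> 'a::euclidean_space set \<Rightarrow>
   ('a \<Rightarrow> 'm) \<Rightarrow> bool" where
  "Ck_map A k S g \<longleftrightarrow> continuous_on S g \<and>
     (\<forall>c\<in>A. Ck_on k (S \<inter> g -` fst c) (snd c \<circ> g))"


section \<open>Tangent vectors\<close>

(* A tangent vector at x is the family of its components in all charts around x, transforming by
   the derivatives of the transition maps; it is extended by 0 to the remaining charts, so that
   the vector space operations are pointwise and the zero vector is \<lambda>_. 0. *)
type_synonym ('m, 'e) tvec = "('m, 'e) chart \<Rightarrow> 'e"

definition tangent_space ::
  "('m, 'e::euclidean_space) chart set \<Rightarrow> 'm \<Rightarrow> ('m, 'e) tvec set" where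
  "tangent_space A x = {v.
     (\<forall>c\<in>A. \<forall>d\<in>A. x \<in> fst c \<longrightarrow> x \<in> fst d \<longrightarrow>
        v d = frechet_derivative (snd d \<circ> chart_inv c) (at (snd c x)) (v c)) \<and>
     (\<forall>c. \<not> (c \<in> A \<and> x \<in> fst c) \<longrightarrow> v c = 0)}"

(* The tangent vector at the point with coordinates p in the chart c whose component in c is u. *)
definition tvec_of ::
  "('m, 'e::euclidean_space) chart set \<Rightarrow> ('m, 'e) chart \<Rightarrow> 'e \<Rightarrow> 'e \<Rightarrow> ('m, 'e) tvec" where
  "tvec_of A c p u = (\<lambda>d. if d \<in> A \<and> chart_inv c p \<in> fst d
     then frechet_derivative (snd d \<circ> chart_inv c) (at p) u else 0)"

(* Functions on TM are curried, F x v with v \<in> tangent_space A x. This is the coordinate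
   expression of F in the bundle chart of TM induced by c, for p \<in> chart_range c. *)
definition local_rep ::
  "('m, 'e::euclidean_space) chart set \<Rightarrow> ('m \<Rightarrow> ('m, 'e) tvec \<Rightarrow> real) \<Rightarrow> ('m, 'e) chart \<Rightarrow>
   'e \<Rightarrow> 'e \<Rightarrow> real" where
  "local_rep A F c p u = F (chart_inv c p) (tvec_of A c p u)"

definition velocity ::
  "('m, 'e::euclidean_space) chart set \<Rightarrow> (real \<Rightarrow> 'm) \<Rightarrow> real \<Rightarrow> ('m, 'e) tvec" where
  "velocity A \<gamma> t = (\<lambda>c. if c \<in> A \<and> \<gamma> t \<in> fst c
     then vector_derivative (snd c \<circ> \<gamma>) (at t) else 0)"


section \<open>Finsler metrics\<close>

definition asymmetric_norm :: "('e::real_vector \<Rightarrow> real) \<Rightarrow> bool" where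
  "asymmetric_norm f \<longleftrightarrow>
     (\<forall>u. 0 \<le> f u) \<and>
     (\<forall>k>0. \<forall>u. f (k *\<^sub>R u) = k * f u) \<and>
     (\<forall>u w. f (u + w) \<le> f u + f w) \<and>
     (\<forall>u. f u = 0 \<longleftrightarrow> u = 0)"

definition minkowski_norm :: "('e::euclidean_space \<Rightarrow> real) \<Rightarrow> bool" where
  "minkowski_norm f \<longleftrightarrow> asymmetric_norm f \<and>
     Ck_on 2 (- {0}) (\<lambda>u. (f u)\<^sup>2) \<and>
     (\<forall>u w. u \<noteq> 0 \<longrightarrow> w \<noteq> 0 \<longrightarrow>
        frechet_derivative (\<lambda>y. frechet_derivative (\<lambda>z. (f z)\<^sup>2) (at y) w) (at u) w > 0)"

(* Tangent spaces are identified with 'e by means of each chart; being a Minkowski norm does not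
   depend on the choice of linear coordinates. *)
definition finsler_metric ::
  "('m, 'e::euclidean_space) chart set \<Rightarrow> ('m \<Rightarrow> ('m, 'e) tvec \<Rightarrow> real) \<Rightarrow> bool" where
  "finsler_metric A F \<longleftrightarrow> (\<forall>c\<in>A.
     continuous_on (chart_range c \<times> UNIV) (\<lambda>(p, u). local_rep A F c p u) \<and>
     Ck_on 2 (chart_range c \<times> (- {0})) (\<lambda>(p, u). local_rep A F c p u) \<and>
     (\<forall>p\<in>chart_range c. minkowski_norm (local_rep A F c p)))"

definition reversible ::
  "('m, 'e::euclidean_space) chart set \<Rightarrow> ('m \<Rightarrow> ('m, 'e) tvec \<Rightarrow> real) \<Rightarrow> bool" where
  "reversible A F \<longleftrightarrow> (\<forall>x. \<forall>v\<in>tangent_space A x. F x (\<lambda>c. - v c) = F x v)"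


section \<open>Geodesics\<close>

(* Variations of \<gamma> on [a, b] with fixed endpoints; \<Gamma> is C\<^sup>2 on a neighbourhood of
   {0} \<times> [a, b], with 0 < e. *)
definition proper_variation ::
  "('m::topological_space, 'e::euclidean_space) chart set \<Rightarrow> real set \<Rightarrow> (real \<Rightarrow> 'm) \<Rightarrow>
   real \<Rightarrow> real \<Rightarrow> real \<Rightarrow> (real \<times> real \<Rightarrow> 'm) \<Rightarrow> bool" where
  "proper_variation A I \<gamma> a b e \<Gamma> \<longleftrightarrow>
     0 < e \<and> Ck_map A 2 ({-e<..<e} \<times> I) \<Gamma> \<and>
     (\<forall>t\<in>I. \<Gamma> (0, t) = \<gamma> t) \<and>
     (\<forall>s\<in>{-e<..<e}. \<Gamma> (s, a) = \<gamma> a \<and> \<Gamma> (s, b) = \<gamma> b)"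

definition finsler_length ::
  "('m, 'e::euclidean_space) chart set \<Rightarrow> ('m \<Rightarrow> ('m, 'e) tvec \<Rightarrow> real) \<Rightarrow> real \<Rightarrow> real \<Rightarrow>
   (real \<Rightarrow> 'm) \<Rightarrow> real" where
  "finsler_length A F a b \<gamma> = integral {a..b} (\<lambda>t. F (\<gamma> t) (velocity A \<gamma> t))"

(* The parametrization is arbitrary: the functional is invariant under orientation-preserving
   reparametrizations. *)
definition geodesic ::
  "('m::topological_space, 'e::euclidean_space) chart set \<Rightarrow> ('m \<Rightarrow> ('m, 'e) tvec \<Rightarrow> real) \<Rightarrow>
   real set \<Rightarrow> (real \<Rightarrow> 'm) \<Rightarrow> bool" where
  "geodesic A F I \<gamma> \<longleftrightarrow>
     open I \<and> is_interval I \<and> I \<noteq> {} \<and>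
     Ck_map A 2 I \<gamma> \<and>
     (\<forall>t\<in>I. velocity A \<gamma> t \<noteq> (\<lambda>_. 0)) \<and>
     (\<forall>a b e \<Gamma>. a < b \<longrightarrow> {a..b} \<subseteq> I \<longrightarrow> proper_variation A I \<gamma> a b e \<Gamma> \<longrightarrow>
        ((\<lambda>s. finsler_length A F a b (\<lambda>t. \<Gamma> (s, t))) has_real_derivative 0) (at 0))"

definition geodesically_reversible ::
  "('m::topological_space, 'e::euclidean_space) chart set \<Rightarrow>
   ('m \<Rightarrow> ('m, 'e) tvec \<Rightarrow> real) \<Rightarrow> bool" where
  "geodesically_reversible A F \<longleftrightarrow> (\<forall>I \<gamma>. geodesic A F I \<gamma> \<longrightarrow>
     (\<exists>J \<sigma>. bij_betw \<sigma> J I \<and> Ck_on 2 J \<sigma> \<and> (\<forall>t\<in>J. deriv \<sigma> t < 0) \<and>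
        geodesic A F J (\<gamma> \<circ> \<sigma>)))"


section \<open>Integrals of motion\<close>

definition direction :: "('m, 'e::real_vector) tvec \<Rightarrow> ('m, 'e) tvec set" where
  "direction v = {(\<lambda>c. k *\<^sub>R v c) | k. k > 0}"

definition STM :: "('m, 'e::euclidean_space) chart set \<Rightarrow> ('m \<times> ('m, 'e) tvec set) set" where
  "STM A = {(x, direction v) | x v. v \<in> tangent_space A x \<and> v \<noteq> (\<lambda>_. 0)}"

(* Continuity for the quotient topology: the pullback of h to the nonzero tangent vectors is
   continuous. *)
definition continuous_on_STM ::
  "('m, 'e::euclidean_space) chart set \<Rightarrow> ('m \<times> ('m, 'e) tvec set \<Rightarrow> real) \<Rightarrow> bool" where
  "continuous_on_STM A h \<longleftrightarrow> (\<forall>c\<in>A. continuous_on (chart_range c \<times> (- {0}))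
     (\<lambda>(p, u). local_rep A (\<lambda>x v. h (x, direction v)) c p u))"

definition integral_of_motion ::
  "('m::topological_space, 'e::euclidean_space) chart set \<Rightarrow> ('m \<Rightarrow> ('m, 'e) tvec \<Rightarrow> real) \<Rightarrow>
   ('m \<times> ('m, 'e) tvec set \<Rightarrow> real) \<Rightarrow> bool" where
  "integral_of_motion A F h \<longleftrightarrow> (\<forall>I \<gamma>. geodesic A F I \<gamma> \<longrightarrow>
     (\<lambda>t. h (\<gamma> t, direction (velocity A \<gamma> t))) constant_on I)"


section \<open>Closed 1-forms\<close>

(* The last clause is d\<beta> = 0: d\<beta>(w, u) is the derivative of \<beta>(u) in direction w minus
   the derivative of \<beta>(w) in direction u, for u and w constant in the chart. *)
definition closed_one_form ::
  "('m, 'e::euclidean_space) chart set \<Rightarrow> ('m \<Rightarrow> ('m, 'e) tvec \<Rightarrow> real) \<Rightarrow> bool" where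
  "closed_one_form A \<beta> \<longleftrightarrow> (\<forall>c\<in>A.
     (\<forall>p\<in>chart_range c. linear (local_rep A \<beta> c p)) \<and>
     (\<forall>u. Ck_on 1 (chart_range c) (\<lambda>p. local_rep A \<beta> c p u)) \<and>
     (\<forall>p\<in>chart_range c. \<forall>u w.
        frechet_derivative (\<lambda>q. local_rep A \<beta> c q u) (at p) w =
        frechet_derivative (\<lambda>q. local_rep A \<beta> c q w) (at p) u))"

end

theory Submission
  imports Defs
begin

text \<open>Write \<open>F\<^sup>-(v) = F(-v)\<close>, and let \<open>Fe = (F + F\<^sup>-)/2\<close> and \<open>Fo = (F - F\<^sup>-)/2\<close> be the even and the odd part
of \<open>F\<close>. It has to be shown that \<open>Fo\<close> is a closed 1-form; the even part is a reversible Finsler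
metric in any case.

Geodesic reversibility says that the extremals of \<open>F\<close> are extremals of \<open>F\<^sup>-\<close>
(\<open>reverse_extremal_lrep\<close>), hence of every Lagrangian \<open>k = Fo - \<lambda> Fe\<close> with \<open>\<lambda>\<close> constant. For a
Lagrangian \<open>k(x, u)\<close> that is homogeneous of degree one in \<open>u\<close>, the 2-form \<open>d(k\<^sub>u dx)\<close> is
invariant along the extremals (\<open>symplectic_form_conserved\<close>). Its kernel always contains the
direction of the flow and the radial direction; it is larger exactly if the fibre Hessian
\<open>k\<^sub>u\<^sub>u\<close> annihilates a vector that is not parallel to \<open>u\<close>. So this kind of degeneracy is
transported along geodesics (\<open>degeneracy_transported\<close>). Applied to \<open>k = Fo - \<lambda> Fe\<close> for all \<open>\<lambda>\<close>,
this says that the eigenvalues of \<open>Fo\<^sub>u\<^sub>u\<close> relative to \<open>Fe\<^sub>u\<^sub>u\<close>, on the quotient of the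
tangent space by the line of \<open>u\<close>, are constant along geodesics. The largest of them or zero,
whichever is larger, is a continuous function \<open>\<Lambda>\<close> on the space of directions
(\<open>direction_invariant_continuous\<close>) and an integral of motion
(\<open>direction_invariant_integral\<close>), hence a constant \<open>c\<close>.

As \<open>Fo\<close> is odd and \<open>Fe\<close> is even, the eigenvalues at \<open>-u\<close> are the negatives of those at \<open>u\<close>.
If \<open>c > 0\<close>, both \<open>c\<close> and \<open>-c\<close> are therefore eigenvalues at every \<open>u\<close>. The quotient has dimension at
most two, so that there are no others, and \<open>Fo\<^sub>u\<^sub>u\<close> is nondegenerate on all these quotients. But it must
be degenerate on one of them (\<open>odd_imp_degenerate\<close>): for fixed \<open>\<xi>\<close> the derivative of \<open>Fo\<close> in the direction \<open>\<xi>\<close> is an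
even function of the direction \<open>u\<close>, and if the Hessian is nondegenerate modulo \<open>u\<close> then its critical points
lie on the line of \<open>\<xi>\<close>; so maximum and minimum agree, the function is constant, and the Hessian
annihilates \<open>\<xi>\<close> everywhere. Hence \<open>c = 0\<close>. Then \<open>Fo\<^sub>u\<^sub>u\<close> is negative semidefinite at \<open>u\<close> and at \<open>-u\<close>,
so it vanishes, \<open>Fo\<close> is linear in \<open>u\<close>, and its Euler-Lagrange equation along the geodesics in all
directions says that it is closed (\<open>odd_part_closed\<close>).

A metric of class \<open>C\<^sup>2\<close> has a geodesic spray that is only continuous, so geodesics cannot be varied
in the variables \<open>(x, u)\<close>. In the variables \<open>(x, p)\<close>, where \<open>p\<close> is the fibre derivative of \<open>F\<^sup>2\<close>, they
are the solutions of an equation with \<open>C\<^sup>1\<close> right hand side. Its solutions can be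
differentiated with respect to the initial values (\<open>flow_linearisation\<close>), and the derivatives
are the Jacobi fields. The Euler-Lagrange equation of \<open>k\<close> holds for every curve of such a family;
differentiating it with respect to the parameter gives the linearised equation without a third
derivative of \<open>k\<close>.\<close>

abbreviation \<D> :: "('a::real_normed_vector \<Rightarrow> 'b::real_normed_vector) \<Rightarrow> 'a \<Rightarrow> 'a \<Rightarrow> 'b" where
  "\<D> f x \<equiv> frechet_derivative f (at x)"

text \<open>The direction \<open>w\<close> of the inner derivative is the last argument.\<close>

abbreviation \<D>2 :: "('a::real_normed_vector \<Rightarrow> 'b::real_normed_vector) \<Rightarrow> 'a \<Rightarrow> 'a \<Rightarrow> 'a \<Rightarrow> 'b" where
  "\<D>2 f x v w \<equiv> \<D> (\<lambda>y. \<D> f y w) x v"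

section \<open>Functions of class \<open>C\<^sup>k\<close>\<close>

lemma has_derivative_D: "f differentiable (at x) \<Longrightarrow> (f has_derivative \<D> f x) (at x)"
  by (simp add: frechet_derivative_works)

lemma D_eqI: "(f has_derivative f') (at x) \<Longrightarrow> \<D> f x = f'"
  using frechet_derivative_at by metis

lemma D_cong:
  assumes "open S" "x \<in> S" "\<And>y. y \<in> S \<Longrightarrow> f y = g y"
  shows "\<D> f x = \<D> g x"
proof -
  have "(f has_derivative d) (at x) \<longleftrightarrow> (g has_derivative d) (at x)" for d
    using assms has_derivative_transform_within_open by (metis (no_types, lifting))
  then show ?thesis by (simp add: frechet_derivative_def)
qed

lemma differentiable_cong:
  assumes "open S" "x \<in> S" "\<And>y. y \<in> S \<Longrightarrow> f y = g y"
  shows "f differentiable (at x) \<longleftrightarrow> g differentiable (at x)"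
  using assms has_derivative_transform_within_open unfolding differentiable_def by (metis (no_types, lifting))

lemma Ck_on_cong:
  assumes "open S" "\<And>x. x \<in> S \<Longrightarrow> f x = g x"
  shows "Ck_on k S f \<longleftrightarrow> Ck_on k S g"
  using assms(2)
proof (induction k arbitrary: f g)
  case 0 then show ?case by (auto intro!: continuous_on_cong)
next
  case (Suc k)
  have "Ck_on k S (\<lambda>x. \<D> f x v) \<longleftrightarrow> Ck_on k S (\<lambda>x. \<D> g x v)" for v
    by (rule Suc.IH) (metis D_cong[OF assms(1)] Suc.prems)
  moreover have "f differentiable (at x) \<longleftrightarrow> g differentiable (at x)" if "x \<in> S" for x
    using differentiable_cong[OF assms(1) that] Suc.prems by blast
  ultimately show ?case by auto
qed

lemma Ck_on_subset: "Ck_on k S f \<Longrightarrow> T \<subseteq> S \<Longrightarrow> Ck_on k T f"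
  by (induction k arbitrary: f) (auto intro: continuous_on_subset)

lemma Ck_on_SucD: "Ck_on (Suc k) S f \<Longrightarrow> Ck_on k S f"
proof (induction k arbitrary: f)
  case 0 then show ?case
    by (auto intro!: continuous_at_imp_continuous_on differentiable_imp_continuous_within)
next
  case (Suc k) then show ?case by (metis Ck_on.simps(2))
qed

lemma Ck_on_continuous: "Ck_on k S f \<Longrightarrow> continuous_on S f"
  by (induction k) (auto dest: Ck_on_SucD simp del: Ck_on.simps(2))

lemma Ck_on_local:
  assumes "\<And>x. x \<in> S \<Longrightarrow> \<exists>T. open T \<and> x \<in> T \<and> Ck_on k T f"
  shows "Ck_on k S f"
  using assms
proof (induction k arbitrary: f)
  case 0 then show ?case
    by (metis Ck_on.simps(1) continuous_at_imp_continuous_on continuous_on_eq_continuous_at)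
next
  case (Suc k)
  have "Ck_on k S (\<lambda>x. \<D> f x v)" for v
    by (rule Suc.IH) (metis Suc.prems Ck_on.simps(2))
  moreover have "f differentiable (at x)" if "x \<in> S" for x
    using Suc.prems[OF that] by auto
  ultimately show ?case by simp
qed

lemma Ck_on_const: "Ck_on k S (\<lambda>x. c)"
  by (induction k arbitrary: c) auto

lemma Ck_on_linear:
  assumes "bounded_linear f" shows "Ck_on k S f"
proof -
  have d: "\<D> f x = f" for x using assms by (intro D_eqI bounded_linear_imp_has_derivative)
  have "f differentiable (at x)" for x using assms bounded_linear_imp_differentiable by blast
  then show ?thesis using assms
    by (cases k) (auto simp: d Ck_on_const linear_continuous_on)
qed

lemma Ck_on_add:
  assumes "Ck_on k S f" "Ck_on k S g" "open S" shows "Ck_on k S (\<lambda>x. f x + g x)"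
  using assms(1,2)
proof (induction k arbitrary: f g)
  case 0 then show ?case by (auto intro: continuous_intros)
next
  case (Suc k)
  have h: "((\<lambda>x. f x + g x) has_derivative (\<lambda>v. \<D> f x v + \<D> g x v)) (at x)" if "x \<in> S" for x
    using Suc.prems that by (intro has_derivative_add has_derivative_D) auto
  have "Ck_on k S (\<lambda>x. \<D> (\<lambda>x. f x + g x) x v)" for v
    using Suc by (subst Ck_on_cong[OF assms(3), where g = "\<lambda>x. \<D> f x v + \<D> g x v"]) (simp_all add: D_eqI[OF h])
  then show ?case using h by (auto simp: differentiable_def)
qed

lemma Ck_on_compose_linear:
  assumes "bounded_linear L" "Ck_on k S f" "open S" shows "Ck_on k S (\<lambda>x. L (f x))"
  using assms(2)
proof (induction k arbitrary: f)
  case 0 then show ?case using assms(1) by (auto intro: bounded_linear.continuous_on)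
next
  case (Suc k)
  have h: "((\<lambda>x. L (f x)) has_derivative (\<lambda>v. L (\<D> f x v))) (at x)" if "x \<in> S" for x
    using Suc.prems that by (auto intro!: bounded_linear.has_derivative[OF assms(1)] has_derivative_D)
  have "Ck_on k S (\<lambda>x. \<D> (\<lambda>x. L (f x)) x v)" for v
    using Suc by (subst Ck_on_cong[OF assms(3), where g = "\<lambda>x. L (\<D> f x v)"]) (auto simp: D_eqI[OF h])
  then show ?case using h by (auto simp: differentiable_def)
qed

lemma Ck_on_minus: "Ck_on k S f \<Longrightarrow> open S \<Longrightarrow> Ck_on k S (\<lambda>x. - f x)"
  by (rule Ck_on_compose_linear[OF bounded_linear_minus[OF bounded_linear_ident]])

lemma Ck_on_diff: "Ck_on k S f \<Longrightarrow> Ck_on k S g \<Longrightarrow> open S \<Longrightarrow> Ck_on k S (\<lambda>x. f x - g x)"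
  using Ck_on_add[of k S f "\<lambda>x. - g x"] Ck_on_minus[of k S g] by simp

lemma Ck_on_sum:
  assumes "\<And>i. i \<in> I \<Longrightarrow> Ck_on k S (f i)" "open S" shows "Ck_on k S (\<lambda>x. \<Sum>i\<in>I. f i x)"
  using assms by (induction I rule: infinite_finite_induct) (auto intro: Ck_on_const Ck_on_add)

lemma Ck_on_scaleR:
  fixes g :: "'a::euclidean_space \<Rightarrow> real"
  assumes "Ck_on k S g" "Ck_on k S f" "open S" shows "Ck_on k S (\<lambda>x. g x *\<^sub>R f x)"
  using assms(1,2)
proof (induction k arbitrary: f g)
  case 0 then show ?case by (auto intro: continuous_intros)
next
  case (Suc k)
  have h: "((\<lambda>x. g x *\<^sub>R f x) has_derivative (\<lambda>v. g x *\<^sub>R \<D> f x v + \<D> g x v *\<^sub>R f x)) (at x)" if "x \<in> S" for x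
    using Suc.prems that by (intro has_derivative_scaleR has_derivative_D) auto
  have "Ck_on k S (\<lambda>x. g x *\<^sub>R \<D> f x v + \<D> g x v *\<^sub>R f x)" for v
    using Suc.prems Ck_on_SucD[OF Suc.prems(1)] Ck_on_SucD[OF Suc.prems(2)]
    by (intro Ck_on_add Suc.IH assms(3)) simp_all
  then have "Ck_on k S (\<lambda>x. \<D> (\<lambda>x. g x *\<^sub>R f x) x v)" for v
    by (subst Ck_on_cong[OF assms(3), where g = "\<lambda>x. g x *\<^sub>R \<D> f x v + \<D> g x v *\<^sub>R f x"]) (simp_all add: D_eqI[OF h])
  then show ?case using h by (auto simp: differentiable_def)
qed

lemma Ck_on_mult:
  fixes f g :: "'a::euclidean_space \<Rightarrow> real"
  assumes "Ck_on k S g" "Ck_on k S f" "open S" shows "Ck_on k S (\<lambda>x. g x * f x)"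
  using Ck_on_scaleR[OF assms] by simp

lemma Ck_on_power:
  fixes f :: "'a::euclidean_space \<Rightarrow> real"
  assumes "Ck_on k S f" "open S" shows "Ck_on k S (\<lambda>x. f x ^ n)"
  by (induction n) (auto intro: Ck_on_const Ck_on_mult assms)

lemma D_compose:
  assumes "f differentiable (at x)" "g differentiable (at (f x))"
  shows "\<D> (\<lambda>x. g (f x)) x v = \<D> g (f x) (\<D> f x v)"
  using frechet_derivative_compose[OF assms] by (simp add: o_def fun_eq_iff)

lemma linear_D: "f differentiable (at x) \<Longrightarrow> linear (\<D> f x)"
  by (rule linear_frechet_derivative)

lemma D_basis_expansion:
  fixes f :: "'a::euclidean_space \<Rightarrow> 'b::real_normed_vector"
  assumes "f differentiable (at x)"
  shows "\<D> f x v = (\<Sum>b\<in>Basis. (v \<bullet> b) *\<^sub>R \<D> f x b)"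
proof -
  have "\<D> f x v = \<D> f x (\<Sum>b\<in>Basis. (v \<bullet> b) *\<^sub>R b)" by (simp add: euclidean_representation)
  then show ?thesis by (simp add: linear_sum[OF linear_D[OF assms]] linear_scale[OF linear_D[OF assms]])
qed

text \<open>By the chain rule a directional derivative of the composition is a finite sum of products of
directional derivatives of \<open>f\<close> with directional derivatives of \<open>g\<close> at \<open>f x\<close>, one for each basis vector;
so the induction only needs sums and products.\<close>

lemma Ck_on_compose:
  fixes f :: "'a::euclidean_space \<Rightarrow> 'b::euclidean_space"
  assumes "Ck_on k S f" "Ck_on k T g" "f ` S \<subseteq> T" "open S"
  shows "Ck_on k S (\<lambda>x. g (f x))"
  using assms(1,2)
proof (induction k arbitrary: g)
  case 0 then show ?case using assms(3) by (auto intro: continuous_on_compose2)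
next
  case (Suc k)
  have df: "f differentiable (at x)" and dg: "g differentiable (at (f x))" if "x \<in> S" for x
    using Suc.prems that assms(3) by auto
  have e: "\<D> (\<lambda>x. g (f x)) x v = (\<Sum>b\<in>Basis. (\<D> f x v \<bullet> b) *\<^sub>R \<D> g (f x) b)" if "x \<in> S" for x v
    using D_compose[OF df dg] D_basis_expansion[OF dg] that by simp
  have "Ck_on k S (\<lambda>x. \<Sum>b\<in>Basis. (\<D> f x v \<bullet> b) *\<^sub>R \<D> g (f x) b)" for v
  proof (intro Ck_on_sum Ck_on_scaleR assms(4))
    fix b :: 'b
    show "Ck_on k S (\<lambda>x. \<D> f x v \<bullet> b)"
      using Suc.prems by (intro Ck_on_compose_linear[OF bounded_linear_inner_left _ assms(4)]) auto
    show "Ck_on k S (\<lambda>x. \<D> g (f x) b)"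
      using Suc.prems Ck_on_SucD[OF Suc.prems(1)] by (intro Suc.IH) simp_all
  qed
  then have "Ck_on k S (\<lambda>x. \<D> (\<lambda>x. g (f x)) x v)" for v
    by (subst Ck_on_cong[OF assms(4), where g = "\<lambda>x. \<Sum>b\<in>Basis. (\<D> f x v \<bullet> b) *\<^sub>R \<D> g (f x) b"]) (simp_all add: e)
  moreover have "(\<lambda>x. g (f x)) differentiable (at x)" if "x \<in> S" for x
    using differentiable_chain_at[OF df dg] that by (simp add: o_def)
  ultimately show ?case by simp
qed

lemma Ck_on_Pair:
  assumes "Ck_on k S f" "Ck_on k S g" "open S" shows "Ck_on k S (\<lambda>x. (f x, g x))"
proof -
  have "Ck_on k S (\<lambda>x. (f x, 0) + (0, g x))"
    using assms by (intro Ck_on_add Ck_on_compose_linear[where L="\<lambda>y. (y, 0)"] Ck_on_compose_linear[where L="\<lambda>y. (0, y)"])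
      (auto intro!: bounded_linear_intros)
  then show ?thesis by simp
qed

lemma Ck_on_real_SucI:
  fixes x :: "real \<Rightarrow> 'a::real_normed_vector"
  assumes "open I" "\<And>t. t \<in> I \<Longrightarrow> (x has_vector_derivative v t) (at t)" "Ck_on k I v"
  shows "Ck_on (Suc k) I x"
proof -
  have d: "(x has_derivative (\<lambda>r. r *\<^sub>R v t)) (at t)" if "t \<in> I" for t
    using assms(2)[OF that] by (simp add: has_vector_derivative_def)
  have "Ck_on k I (\<lambda>t. \<D> x t r)" for r
    using assms(1,3) by (subst Ck_on_cong[where g = "\<lambda>t. r *\<^sub>R v t"])
      (auto simp: D_eqI[OF d] intro: Ck_on_compose_linear bounded_linear_scaleR_right)
  then show ?thesis using d by (auto simp: differentiable_def)
qed

lemma Ck_on_real_SucD: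
  fixes x :: "real \<Rightarrow> 'a::real_normed_vector"
  assumes "open I" "Ck_on (Suc k) I x"
  shows "\<And>t. t \<in> I \<Longrightarrow> (x has_vector_derivative vector_derivative x (at t)) (at t)"
    and "Ck_on k I (\<lambda>t. vector_derivative x (at t))"
proof -
  show "(x has_vector_derivative vector_derivative x (at t)) (at t)" if "t \<in> I" for t
    using assms that by (auto simp: vector_derivative_works[symmetric])
  have "Ck_on k I (\<lambda>t. \<D> x t 1)" using assms by auto
  then show "Ck_on k I (\<lambda>t. vector_derivative x (at t))"
    using assms by (subst (asm) Ck_on_cong[where g="\<lambda>t. vector_derivative x (at t)"])
      (auto simp: frechet_derivative_eq_vector_derivative)
qed

section \<open>First and second derivatives\<close>

lemma C1_has_derivative: "Ck_on (Suc k) S f \<Longrightarrow> x \<in> S \<Longrightarrow> (f has_derivative \<D> f x) (at x)"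
  by (auto intro: has_derivative_D)

lemma C1_has_vector_derivative_compose:
  assumes "Ck_on (Suc k) S f" "x t \<in> S" "(x has_vector_derivative v) (at t)"
  shows "((\<lambda>s. f (x s)) has_vector_derivative \<D> f (x t) v) (at t)"
proof -
  have "f differentiable (at (x t))" using assms by auto
  then have l: "linear (\<D> f (x t))" by (rule linear_D)
  have "((\<lambda>s. f (x s)) has_derivative (\<lambda>r. \<D> f (x t) (r *\<^sub>R v))) (at t)"
    using assms(3) C1_has_derivative[OF assms(1,2)] unfolding has_vector_derivative_def
    by (rule has_derivative_compose)
  then show ?thesis by (simp add: has_vector_derivative_def linear_scale[OF l])
qed

lemma C1_continuous_blinfun:
  fixes f :: "'a::euclidean_space \<Rightarrow> 'b::real_normed_vector"
  assumes "Ck_on (Suc k) S f"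
  shows "continuous_on S (\<lambda>x. Blinfun (\<D> f x))"
proof (rule continuous_on_blinfun_componentwise)
  fix i :: 'a
  have c: "continuous_on S (\<lambda>x. \<D> f x i)" using assms by (intro Ck_on_continuous[of k]) auto
  have "blinfun_apply (Blinfun (\<D> f x)) i = \<D> f x i" if "x \<in> S" for x
    using C1_has_derivative[OF assms that] by (simp add: bounded_linear_Blinfun_apply has_derivative_bounded_linear)
  then show "continuous_on S (\<lambda>x. blinfun_apply (Blinfun (\<D> f x)) i)"
    using continuous_on_cong c by (metis (no_types, lifting))
qed

lemma C1_Blinfun_apply:
  assumes "Ck_on (Suc k) S f" "x \<in> S" shows "blinfun_apply (Blinfun (\<D> f x)) = \<D> f x"
  using C1_has_derivative[OF assms] by (simp add: bounded_linear_Blinfun_apply has_derivative_bounded_linear)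

lemma C1_continuous_D:
  fixes f :: "'a::euclidean_space \<Rightarrow> 'b::real_normed_vector"
  assumes "Ck_on (Suc k) S f" "continuous_on T g" "continuous_on T h" "g ` T \<subseteq> S"
  shows "continuous_on T (\<lambda>x. \<D> f (g x) (h x))"
proof -
  have "continuous_on T (\<lambda>x. blinfun_apply (Blinfun (\<D> f (g x))) (h x))"
    using assms by (intro continuous_intros continuous_on_compose2[OF C1_continuous_blinfun[OF assms(1)]])
  then show ?thesis
    by (rule continuous_on_eq) (use C1_Blinfun_apply[OF assms(1)] assms(4) in auto)
qed

lemma C2_linear1:
  assumes "Ck_on (Suc (Suc k)) S f" "x \<in> S" shows "linear (\<lambda>v. \<D>2 f x v w)"
  using assms by (intro linear_D) auto

text \<open>The increment of the derivative in the direction \<open>v\<close> along the direction \<open>w\<close> is the integral of one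
of the two second derivatives, by differentiation under the integral sign. Differentiating this
integral with respect to its upper limit gives the other one.\<close>

lemma D2_symmetric:
  fixes f :: "'a::euclidean_space \<Rightarrow> real"
  assumes "Ck_on (Suc (Suc k)) S f" "open S" "z \<in> S"
  shows "\<D>2 f z v w = \<D>2 f z w v"
proof -
  obtain r where r: "r > 0" "cball z r \<subseteq> S" using assms open_contains_cball by metis
  define e where "e = r / (norm v + norm w + 1)"
  have e: "e > 0" using r by (simp add: e_def add_nonneg_pos)
  have inS: "z + s *\<^sub>R v + t *\<^sub>R w \<in> S" if "\<bar>s\<bar> \<le> e" "\<bar>t\<bar> \<le> e" for s t
  proof -
    have "norm (s *\<^sub>R v + t *\<^sub>R w) \<le> e * norm v + e * norm w"
      by (rule order_trans[OF norm_triangle_ineq]) (auto intro!: add_mono mult_right_mono that)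
    also have "\<dots> \<le> e * (norm v + norm w + 1)" using e by (simp add: algebra_simps)
    also have "\<dots> = r"
    proof -
      have "norm v + norm w + 1 > 0" by (simp add: add_nonneg_pos)
      then show ?thesis by (simp add: e_def)
    qed
    finally have "z + (s *\<^sub>R v + t *\<^sub>R w) \<in> cball z r"
      unfolding mem_cball by (metis add_diff_cancel_left' dist_commute dist_norm)
    then show ?thesis using r(2) by (simp add: add.assoc subset_iff)
  qed
  let ?g = "\<lambda>s t. z + s *\<^sub>R v + t *\<^sub>R w"
  have C1: "Ck_on (Suc k) S (\<lambda>y. \<D> f y a)" for a using assms(1) by auto
  have gt: "((\<lambda>t. ?g s t) has_vector_derivative w) (at t within T)" for s t T
    by (auto intro!: derivative_eq_intros)
  have gs: "((\<lambda>s. ?g s t) has_vector_derivative v) (at s within T)" for s t T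
    by (auto intro!: derivative_eq_intros)
  have fs: "((\<lambda>s. f (?g s t)) has_vector_derivative \<D> f (?g s t) v) (at s)" if "\<bar>s\<bar> \<le> e" "\<bar>t\<bar> \<le> e" for s t
    by (rule C1_has_vector_derivative_compose[OF assms(1) _ gs]) (use inS that in auto)
  have ft: "((\<lambda>t. f (?g s t)) has_vector_derivative \<D> f (?g s t) w) (at t)" if "\<bar>s\<bar> \<le> e" "\<bar>t\<bar> \<le> e" for s t
    by (rule C1_has_vector_derivative_compose[OF assms(1) _ gt]) (use inS that in auto)
  have fst: "((\<lambda>s. \<D> f (?g s t) w) has_vector_derivative \<D>2 f (?g s t) v w) (at s)" if "\<bar>s\<bar> \<le> e" "\<bar>t\<bar> \<le> e" for s t
    by (rule C1_has_vector_derivative_compose[OF C1 _ gs]) (use inS that in auto)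
  have fts: "((\<lambda>t. \<D> f (?g s t) v) has_vector_derivative \<D>2 f (?g s t) w v) (at t)" if "\<bar>s\<bar> \<le> e" "\<bar>t\<bar> \<le> e" for s t
    by (rule C1_has_vector_derivative_compose[OF C1 _ gt]) (use inS that in auto)
  have cc: "continuous_on ({-e..e} \<times> {-e..e}) (\<lambda>(s, t). \<D>2 f (?g s t) v w)"
    unfolding case_prod_beta
    by (rule C1_continuous_D[OF C1]) (auto intro!: continuous_intros inS)
  define H where "H = (\<lambda>t. integral {0..t} (\<lambda>\<tau>. \<D>2 f (?g 0 \<tau>) v w))"
  have key: "\<D> f (?g 0 t) v = \<D> f (?g 0 0) v + H t" if t: "t \<in> {0..e}" for t
  proof -
    have int: "((\<lambda>\<tau>. \<D> f (?g s \<tau>) w) has_integral f (?g s t) - f (?g s 0)) {0..t}" if "\<bar>s\<bar> \<le> e" for s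
      using t that by (intro fundamental_theorem_of_calculus)
        (auto intro!: has_vector_derivative_at_within[OF ft])
    have "((\<lambda>s. integral (cbox 0 t) (\<lambda>\<tau>. \<D> f (?g s \<tau>) w)) has_vector_derivative
        integral (cbox 0 t) (\<lambda>\<tau>. \<D>2 f (?g 0 \<tau>) v w)) (at 0 within {-e..e})"
    proof (rule leibniz_rule_vector_derivative)
      show "((\<lambda>s. \<D> f (?g s \<tau>) w) has_vector_derivative \<D>2 f (?g s \<tau>) v w) (at s within {-e..e})"
        if "s \<in> {-e..e}" "\<tau> \<in> cbox 0 t" for s \<tau>
        by (rule has_vector_derivative_at_within[OF fst]) (use that t in auto)
      show "(\<lambda>\<tau>. \<D> f (?g s \<tau>) w) integrable_on cbox 0 t" if "s \<in> {-e..e}" for s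
        unfolding cbox_interval by (rule has_integral_integrable[OF int]) (use that in auto)
      show "continuous_on ({-e..e} \<times> cbox 0 t) (\<lambda>(s, t). \<D>2 f (?g s t) v w)"
        by (rule continuous_on_subset[OF cc]) (use t in auto)
    qed (use e in auto)
    then have "((\<lambda>s. f (?g s t) - f (?g s 0)) has_vector_derivative H t) (at 0 within {-e..e})"
      unfolding H_def cbox_interval
      by (rule has_vector_derivative_transform[rotated 2]) (use e in \<open>auto simp: integral_unique[OF int]\<close>)
    moreover have "at 0 within {-e..e} = at (0::real)" by (rule at_within_interior) (use e in auto)
    ultimately have 1: "((\<lambda>s. f (?g s t) - f (?g s 0)) has_vector_derivative H t) (at 0)" by (simp only:)
    have 2: "((\<lambda>s. f (?g s t) - f (?g s 0)) has_vector_derivative \<D> f (?g 0 t) v - \<D> f (?g 0 0) v) (at 0)"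
      by (rule has_vector_derivative_diff[OF fs fs]) (use t e in auto)
    show ?thesis using vector_derivative_unique_at[OF 1 2] by (simp only: algebra_simps)
  qed
  have c0: "continuous_on {0..e} (\<lambda>\<tau>. \<D>2 f (?g 0 \<tau>) v w)"
    by (rule C1_continuous_D[OF C1]) (auto intro!: continuous_intros inS[of 0, simplified])
  have "(H has_vector_derivative \<D>2 f (?g 0 0) v w) (at 0 within {0..e})"
    unfolding H_def by (rule integral_has_vector_derivative[OF c0]) (use e in auto)
  then have "((\<lambda>t. \<D> f (?g 0 0) v + H t) has_vector_derivative \<D>2 f (?g 0 0) v w) (at 0 within {0..e})"
    by (auto intro!: derivative_eq_intros)
  then have "((\<lambda>t. \<D> f (?g 0 t) v) has_vector_derivative \<D>2 f (?g 0 0) v w) (at 0 within {0..e})"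
    by (rule has_vector_derivative_transform[rotated 2]) (use e key in auto)
  moreover have "((\<lambda>t. \<D> f (?g 0 t) v) has_vector_derivative \<D>2 f (?g 0 0) w v) (at 0 within {0..e})"
    using fts[of 0 0] e by (auto intro: has_vector_derivative_at_within)
  moreover have "at 0 within {0..e} \<noteq> bot"
    using e by (simp add: at_within_Icc_at_right)
  ultimately have "\<D>2 f (?g 0 0) v w = \<D>2 f (?g 0 0) w v"
    by (rule vector_derivative_unique_within[rotated])
  then show ?thesis by simp
qed

lemma C2_linear2:
  fixes f :: "'a::euclidean_space \<Rightarrow> real"
  assumes "Ck_on (Suc (Suc k)) S f" "open S" "x \<in> S" shows "linear (\<D>2 f x v)"
proof -
  have "(\<lambda>w. \<D>2 f x w v) = \<D>2 f x v" by (intro ext D2_symmetric[OF assms])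
  with C2_linear1[OF assms(1,3), of v] show ?thesis by (rule back_subst[of linear])
qed

lemma C2_continuous_D2:
  fixes f :: "'a::euclidean_space \<Rightarrow> real"
  assumes "Ck_on (Suc (Suc k)) S f" "open S" "continuous_on T g" "continuous_on T h1" "continuous_on T h2" "g ` T \<subseteq> S"
  shows "continuous_on T (\<lambda>x. \<D>2 f (g x) (h1 x) (h2 x))"
proof -
  have "continuous_on T (\<lambda>x. \<Sum>b\<in>Basis. (h2 x \<bullet> b) *\<^sub>R \<D>2 f (g x) (h1 x) b)"
    using assms by (intro continuous_intros C1_continuous_D[where S=S and k=k]) auto
  moreover have "\<D>2 f (g x) (h1 x) (h2 x) = (\<Sum>b\<in>Basis. (h2 x \<bullet> b) *\<^sub>R \<D>2 f (g x) (h1 x) b)" if "x \<in> T" for x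
  proof -
    have l: "linear (\<D>2 f (g x) (h1 x))" using C2_linear2[OF assms(1,2)] assms(6) that by blast
    have "\<D>2 f (g x) (h1 x) (h2 x) = \<D>2 f (g x) (h1 x) (\<Sum>b\<in>Basis. (h2 x \<bullet> b) *\<^sub>R b)"
      by (simp add: euclidean_representation)
    then show ?thesis by (simp add: linear_sum[OF l] linear_scale[OF l])
  qed
  ultimately show ?thesis by (metis (no_types, lifting) continuous_on_cong)
qed

section \<open>Ordinary differential equations and their linearisation\<close>

lemma norm_diff_le_of_vector_derivative:
  fixes f :: "real \<Rightarrow> 'a::real_normed_vector"
  assumes "\<And>t. t \<in> {a..b} \<Longrightarrow> (f has_vector_derivative f' t) (at t within {a..b})"
    and "\<And>t. t \<in> {a..b} \<Longrightarrow> norm (f' t) \<le> B" and "s \<in> {a..b}" "t \<in> {a..b}"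
  shows "norm (f s - f t) \<le> B * (b - a)"
proof -
  have "norm (f s - f t) \<le> B * norm (s - t)"
  proof (rule differentiable_bound[where S="{a..b}" and f'="\<lambda>t h. h *\<^sub>R f' t"])
    show "onorm (\<lambda>h. h *\<^sub>R f' x) \<le> B" if "x \<in> {a..b}" for x
      using assms(2)[OF that] by (intro onorm_le) (simp add: mult.commute[of B] mult_left_mono)
  qed (use assms in \<open>auto simp: has_vector_derivative_def\<close>)
  also have "\<dots> \<le> B * (b - a)"
    using assms(3,4) order_trans[OF norm_ge_zero assms(2)[OF assms(3)]] by (intro mult_left_mono) auto
  finally show ?thesis .
qed

lemma compact_image_norm_bound:
  fixes f :: "'a::topological_space \<Rightarrow> 'b::real_normed_vector"
  assumes "continuous_on T f" "compact T"
  obtains M where "M > 0" "\<And>t. t \<in> T \<Longrightarrow> norm (f t) \<le> M"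
proof -
  have "bounded (f ` T)" using assms compact_continuous_image compact_imp_bounded by blast
  then obtain M where "M > 0" "\<forall>y\<in>f ` T. norm y \<le> M" unfolding bounded_pos by blast
  then show ?thesis using that by blast
qed

text \<open>On an interval this short the integral operator is a contraction with factor \<open>1/2\<close> on the bounded
continuous functions on the line. Functions on the interval are extended to the line by \<open>clamp\<close>.\<close>

lemma picard_lindeloef:
  fixes Y :: "real \<Rightarrow> 'a::euclidean_space \<Rightarrow> 'a"
  assumes t1: "t1 \<in> {a..b}" and cont: "continuous_on ({a..b} \<times> UNIV) (\<lambda>(t, z). Y t z)"
    and lip: "\<And>t z z'. t \<in> {a..b} \<Longrightarrow> norm (Y t z - Y t z') \<le> L * norm (z - z')"
    and L: "0 \<le> L" "L * (b - a) \<le> 1/2"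
  obtains Z where "Z t1 = \<zeta>" "\<And>t. t \<in> {a..b} \<Longrightarrow> (Z has_vector_derivative Y t (Z t)) (at t within {a..b})"
proof -
  define g where "g = (\<lambda>(v::real \<Rightarrow>\<^sub>C 'a) s. Y s (apply_bcontfun v s))"
  define I where "I = (\<lambda>v t. integral {a..t} (g v))"
  have cg: "continuous_on {a..b} (g v)" for v
  proof -
    have "continuous_on {a..b} (\<lambda>s. case (s, apply_bcontfun v s) of (t, z) \<Rightarrow> Y t z)"
      by (rule continuous_on_compose2[OF cont]) (auto intro!: continuous_intros)
    then show ?thesis by (simp add: g_def)
  qed
  have dI: "(I v has_vector_derivative g v t) (at t within {a..b})" if "t \<in> {a..b}" for v t
    unfolding I_def by (rule integral_has_vector_derivative[OF cg that])
  have cI: "continuous_on {a..b} (I v)" for v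
    unfolding I_def by (intro indefinite_integral_continuous_1 integrable_continuous_real cg)
  have "\<exists>T. \<forall>v t. apply_bcontfun (T v) t = \<zeta> + (I v (clamp a b t) - I v t1)"
  proof -
    have "\<exists>h. \<forall>t. apply_bcontfun h t = \<zeta> + (I v (clamp a b t) - I v t1)" for v
    proof -
      have "continuous_on (cbox a b) (\<lambda>t. \<zeta> + (I v t - I v t1))" by (auto intro!: continuous_intros cI)
      then show ?thesis by (rule continuous_on_cbox_bcontfunE) metis
    qed
    then show ?thesis by metis
  qed
  then obtain T where T: "\<And>v t. apply_bcontfun (T v) t = \<zeta> + (I v (clamp a b t) - I v t1)" by blast
  have cl: "clamp a b t \<in> {a..b}" for t using clamp_in_interval[of a b t] t1 by auto
  have "dist (T v) (T w) \<le> 1/2 * dist v w" for v w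
  proof (rule dist_bound)
    fix t
    have "norm ((\<lambda>s. I v s - I w s) (clamp a b t) - (\<lambda>s. I v s - I w s) t1) \<le> (L * dist v w) * (b - a)"
    proof (rule norm_diff_le_of_vector_derivative[where f'="\<lambda>t. g v t - g w t"])
      show "norm (g v s - g w s) \<le> L * dist v w" if "s \<in> {a..b}" for s
      proof -
        have "norm (g v s - g w s) \<le> L * dist (apply_bcontfun v s) (apply_bcontfun w s)"
          unfolding g_def dist_norm by (rule lip[OF that])
        also have "\<dots> \<le> L * dist v w" by (intro mult_left_mono dist_bounded L)
        finally show ?thesis .
      qed
    qed (use cl t1 in \<open>auto intro!: derivative_intros dI\<close>)
    also have "\<dots> = (L * (b - a)) * dist v w" by (simp add: algebra_simps)
    also have "\<dots> \<le> 1/2 * dist v w" by (rule mult_right_mono[OF L(2)]) simp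
    finally show "dist (T v t) (T w t) \<le> 1/2 * dist v w" by (simp add: T dist_norm algebra_simps)
  qed
  then obtain v where v: "T v = v" using banach_fix_type[of "1/2" T] by auto
  have vI: "apply_bcontfun v t = \<zeta> + (I v t - I v t1)" if "t \<in> {a..b}" for t
    using T[of v t] v that by (simp add: clamp_cancel_cbox)
  show ?thesis
  proof
    show "apply_bcontfun v t1 = \<zeta>" using vI[OF t1] by simp
    show "(apply_bcontfun v has_vector_derivative Y t (apply_bcontfun v t)) (at t within {a..b})" if "t \<in> {a..b}" for t
    proof -
      have "((\<lambda>t. \<zeta> + (I v t - I v t1)) has_vector_derivative g v t) (at t within {a..b})"
        by (auto intro!: derivative_eq_intros dI that)
      then show ?thesis unfolding g_def
        by (rule has_vector_derivative_transform[rotated 2]) (use that vI in auto)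
    qed
  qed
qed

text \<open>A form of Gronwall's inequality without exponentials: at a maximum of \<open>norm (d t)\<close> the mean value
estimate bounds the maximum by half of itself plus the initial value and the error.\<close>

lemma ode_stability:
  fixes d :: "real \<Rightarrow> 'a::real_normed_vector"
  assumes d: "\<And>t. t \<in> {a..b} \<Longrightarrow> (d has_vector_derivative d' t) (at t within {a..b})"
    and le: "\<And>t. t \<in> {a..b} \<Longrightarrow> norm (d' t) \<le> L * norm (d t) + e"
    and L: "0 \<le> L" "L * (b - a) \<le> 1/2" and t: "t1 \<in> {a..b}" "t \<in> {a..b}"
  shows "norm (d t) \<le> 2 * (norm (d t1) + e * (b - a))"
proof -
  have "continuous_on {a..b} (\<lambda>t. norm (d t))"
    using d by (intro continuous_intros) (metis continuous_on_vector_derivative)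
  then obtain m where m: "m \<in> {a..b}" "\<And>t. t \<in> {a..b} \<Longrightarrow> norm (d t) \<le> norm (d m)"
    using continuous_attains_sup[of "{a..b}"] t by force
  define P where "P = e * (b - a)"
  have "norm (d m - d t1) \<le> (L * norm (d m) + e) * (b - a)"
  proof (rule norm_diff_le_of_vector_derivative[OF d _ m(1) t(1)])
    show "norm (d' s) \<le> L * norm (d m) + e" if "s \<in> {a..b}" for s
      by (rule order_trans[OF le[OF that]]) (use m(2)[OF that] L in \<open>simp add: mult_left_mono\<close>)
  qed
  also have "\<dots> = (L * (b - a)) * norm (d m) + P" by (simp add: P_def algebra_simps)
  also have "\<dots> \<le> 1/2 * norm (d m) + P" using mult_right_mono[OF L(2) norm_ge_zero] by simp
  finally have le: "norm (d m - d t1) \<le> 1/2 * norm (d m) + P" .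
  have "norm (d m) \<le> 2 * (norm (d t1) + P)"
    using order_trans[OF norm_triangle_sub add_left_mono[OF le]] by simp
  then show ?thesis using m(2)[OF t(2)] by (simp add: P_def)
qed

text \<open>The derivative is uniformly continuous on a compact neighbourhood of \<open>K\<close>, which also contains the
points \<open>z'\<close>.\<close>

lemma uniformly_differentiable_on_compact:
  fixes f :: "'a::euclidean_space \<Rightarrow> 'b::real_normed_vector"
  assumes "open S" "Ck_on (Suc k) S f" "compact K" "K \<subseteq> S" "e > 0"
  obtains \<eta> where "\<eta> > 0"
    "\<And>z z'. z \<in> K \<Longrightarrow> norm (z' - z) < \<eta> \<Longrightarrow> z' \<in> S \<and> norm (f z' - f z - \<D> f z (z' - z)) \<le> e * norm (z' - z)"
proof -
  obtain r where r: "r > 0" "(\<Union>x\<in>K. cball x r) \<subseteq> S"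
    using compact_subset_open_imp_cball_epsilon_subset[OF assms(3,1,4)] by metis
  let ?B = "\<lambda>x. Blinfun (\<D> f x)"
  define K' where "K' = {x + y | x y. x \<in> K \<and> y \<in> cball 0 r}"
  have K': "compact K'" unfolding K'_def by (rule compact_sums[OF assms(3) compact_cball])
  have K'S: "K' \<subseteq> S"
  proof
    fix q assume "q \<in> K'"
    then obtain x y where "q = x + y" "x \<in> K" "norm y \<le> r" by (auto simp: K'_def)
    then have "q \<in> cball x r" "x \<in> K" by (simp_all add: dist_norm)
    then show "q \<in> S" using r(2) by blast
  qed
  have "uniformly_continuous_on K' ?B"
    using C1_continuous_blinfun[OF assms(2)] K' K'S by (intro compact_uniformly_continuous) (auto intro: continuous_on_subset)
  then obtain d where d: "d > 0" "\<And>x y. x \<in> K' \<Longrightarrow> y \<in> K' \<Longrightarrow> dist y x < d \<Longrightarrow> dist (?B y) (?B x) < e"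
    using assms(5) unfolding uniformly_continuous_on_def by metis
  show ?thesis
  proof (rule that[of "min d r"])
    show "min d r > 0" using d r by simp
    fix z z' assume z: "z \<in> K" "norm (z' - z) < min d r"
    have inK: "y \<in> K'" if "norm (y - z) < min d r" for y
      using that z(1) unfolding K'_def by (intro CollectI exI[of _ z] exI[of _ "y - z"]) auto
    have "norm (f z' - f z - \<D> f z (z' - z)) \<le> norm (z' - z) * e"
    proof (rule differentiable_bound_linearization[where S = "ball z (min d r)"])
      fix t :: real assume "t \<in> {0..1}"
      then have "norm (t *\<^sub>R (z' - z)) \<le> norm (z' - z)" by (simp add: mult_left_le_one_le)
      then have "norm (t *\<^sub>R (z' - z)) < min d r" using z(2) by (rule le_less_trans)
      then show "z + t *\<^sub>R (z' - z) \<in> ball z (min d r)"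
        by (metis add_diff_cancel_left' dist_commute dist_norm mem_ball)
    next
      fix x assume "x \<in> ball z (min d r)"
      then have x: "norm (x - z) < min d r" by (simp add: dist_norm norm_minus_commute)
      show "(f has_derivative \<D> f x) (at x within ball z (min d r))"
        using C1_has_derivative[OF assms(2)] inK[OF x] K'S by (auto intro: has_derivative_at_withinI)
      have xS: "x \<in> S" "z \<in> S" using inK[OF x] K'S z assms(4) by auto
      have "\<D> f x - \<D> f z = blinfun_apply (?B x - ?B z)"
        using C1_Blinfun_apply[OF assms(2)] xS by (auto simp: blinfun.diff_left)
      moreover have "norm (?B x - ?B z) \<le> e"
        using d(2)[of z x] inK[OF x] inK[of z] x d r by (force simp: dist_norm)
      ultimately show "onorm (\<D> f x - \<D> f z) \<le> e" by (simp add: norm_blinfun.rep_eq)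
    next
      show "z \<in> ball z (min d r)" using d r by simp
    qed
    then show "z' \<in> S \<and> norm (f z' - f z - \<D> f z (z' - z)) \<le> e * norm (z' - z)"
      using inK[OF z(2)] K'S by (auto simp: mult.commute)
  qed
qed

lemma C1_bounded_on_compact:
  fixes f :: "'a::euclidean_space \<Rightarrow> 'b::real_normed_vector"
  assumes "Ck_on (Suc k) S f" "compact K" "K \<subseteq> S"
  obtains C where "C > 0" "\<And>z v. z \<in> K \<Longrightarrow> norm (\<D> f z v) \<le> C * norm v"
proof -
  obtain C where C: "C > 0" "\<And>z. z \<in> K \<Longrightarrow> norm (Blinfun (\<D> f z)) \<le> C"
    using compact_image_norm_bound[OF continuous_on_subset[OF C1_continuous_blinfun[OF assms(1)] assms(3)] assms(2)] by blast
  have "norm (\<D> f z v) \<le> C * norm v" if "z \<in> K" for z v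
  proof -
    have "norm (\<D> f z v) \<le> norm (Blinfun (\<D> f z)) * norm v"
      using norm_blinfun[of "Blinfun (\<D> f z)" v] C1_Blinfun_apply[OF assms(1)] that assms(3) by auto
    also have "\<dots> \<le> C * norm v" by (rule mult_right_mono[OF C(2)[OF that]]) simp
    finally show ?thesis .
  qed
  then show ?thesis using that C(1) by blast
qed

text \<open>\<open>W\<close> is the derivative at \<open>Z\<close> of a family of curves with respect to a real parameter. Only a
sequence \<open>Zs\<close> of members of the family is recorded; \<open>r n\<close> is the inverse of the parameter value
of \<open>Zs n\<close>.\<close>

definition variation_field ::
  "real set \<Rightarrow> (nat \<Rightarrow> real \<Rightarrow> 'a::real_normed_vector) \<Rightarrow> (real \<Rightarrow> 'a) \<Rightarrow> (nat \<Rightarrow> real) \<Rightarrow> (real \<Rightarrow> 'a) \<Rightarrow> bool" where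
  "variation_field T Zs Z r W \<longleftrightarrow> continuous_on T W \<and> uniform_limit T Zs Z sequentially \<and>
     uniform_limit T (\<lambda>n t. r n *\<^sub>R (Zs n t - Z t)) W sequentially"

text \<open>The chain rule for families of curves. Uniformity in \<open>t\<close> comes from uniform differentiability of
\<open>f\<close> near the compact curve.\<close>

lemma variation_field_compose:
  fixes f :: "'a::euclidean_space \<Rightarrow> 'b::real_normed_vector"
  assumes "open S" "Ck_on (Suc k) S f" "compact T" "continuous_on T Z" "Z ` T \<subseteq> S" "variation_field T Zs Z r W"
  shows "variation_field T (\<lambda>n t. f (Zs n t)) (\<lambda>t. f (Z t)) r (\<lambda>t. \<D> f (Z t) (W t))"
proof -
  have cW: "continuous_on T W" and Zs: "uniform_limit T Zs Z sequentially"
    and W: "uniform_limit T (\<lambda>n t. r n *\<^sub>R (Zs n t - Z t)) W sequentially"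
    using assms(6) by (auto simp: variation_field_def)
  have K: "compact (Z ` T)" by (rule compact_continuous_image[OF assms(4,3)])
  obtain C where C: "C > 0" "\<And>z v. z \<in> Z ` T \<Longrightarrow> norm (\<D> f z v) \<le> C * norm v"
    using C1_bounded_on_compact[OF assms(2) K assms(5)] by blast
  obtain M where M: "M > 0" "\<And>t. t \<in> T \<Longrightarrow> norm (W t) \<le> M"
    using compact_image_norm_bound[OF cW assms(3)] by blast
  have lin: "linear (\<D> f (Z t))" if "t \<in> T" for t
    using assms(2,5) that by (intro linear_D) auto
  have 1: "uniform_limit T (\<lambda>n t. f (Zs n t)) (\<lambda>t. f (Z t)) sequentially"
    unfolding uniform_limit_iff
  proof safe
    fix e :: real assume e: "e > 0"
    obtain \<eta> where \<eta>: "\<eta> > 0" "\<And>z z'. z \<in> Z ` T \<Longrightarrow> norm (z' - z) < \<eta> \<Longrightarrow> z' \<in> S \<and> norm (f z' - f z - \<D> f z (z' - z)) \<le> 1 * norm (z' - z)"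
      using uniformly_differentiable_on_compact[OF assms(1,2) K assms(5), of 1] by (metis zero_less_one)
    have "min \<eta> (e / (C + 1)) > 0" using e \<eta> C by simp
    with Zs have "\<forall>\<^sub>F n in sequentially. \<forall>t\<in>T. dist (Zs n t) (Z t) < min \<eta> (e / (C + 1))"
      unfolding uniform_limit_iff by blast
    then show "\<forall>\<^sub>F n in sequentially. \<forall>t\<in>T. dist (f (Zs n t)) (f (Z t)) < e"
    proof (rule eventually_mono, intro ballI)
      fix n t assume "\<forall>t\<in>T. dist (Zs n t) (Z t) < min \<eta> (e / (C + 1))" "t \<in> T"
      then have h: "norm (Zs n t - Z t) < \<eta>" "norm (Zs n t - Z t) < e / (C + 1)" by (auto simp: dist_norm)
      have "norm (f (Zs n t) - f (Z t)) \<le> norm (f (Zs n t) - f (Z t) - \<D> f (Z t) (Zs n t - Z t)) + norm (\<D> f (Z t) (Zs n t - Z t))"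
        using norm_triangle_ineq[of "f (Zs n t) - f (Z t) - \<D> f (Z t) (Zs n t - Z t)" "\<D> f (Z t) (Zs n t - Z t)"] by simp
      also have "\<dots> \<le> norm (Zs n t - Z t) + C * norm (Zs n t - Z t)"
        using \<eta>(2)[of "Z t" "Zs n t"] C(2)[of "Z t"] h(1) \<open>t \<in> T\<close> by (intro add_mono) auto
      also have "\<dots> = (C + 1) * norm (Zs n t - Z t)" by (simp add: algebra_simps)
      also have "\<dots> < e" using h(2) C(1) by (simp add: field_simps)
      finally show "dist (f (Zs n t)) (f (Z t)) < e" by (simp add: dist_norm)
    qed
  qed
  have 2: "uniform_limit T (\<lambda>n t. r n *\<^sub>R (f (Zs n t) - f (Z t))) (\<lambda>t. \<D> f (Z t) (W t)) sequentially"
    unfolding uniform_limit_iff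
  proof safe
    fix e :: real assume e: "e > 0"
    define e1 where "e1 = e / (2 * (M + 1))"
    define e2 where "e2 = min 1 (e / (2 * C))"
    have e12: "e1 > 0" "e2 > 0" using e M C by (auto simp: e1_def e2_def)
    obtain \<eta> where \<eta>: "\<eta> > 0" "\<And>z z'. z \<in> Z ` T \<Longrightarrow> norm (z' - z) < \<eta> \<Longrightarrow> z' \<in> S \<and> norm (f z' - f z - \<D> f z (z' - z)) \<le> e1 * norm (z' - z)"
      using uniformly_differentiable_on_compact[OF assms(1,2) K assms(5) e12(1)] by metis
    have a: "\<forall>\<^sub>F n in sequentially. \<forall>t\<in>T. dist (Zs n t) (Z t) < \<eta>"
      using Zs \<eta>(1) unfolding uniform_limit_iff by blast
    have b: "\<forall>\<^sub>F n in sequentially. \<forall>t\<in>T. dist (r n *\<^sub>R (Zs n t - Z t)) (W t) < e2"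
      using W e12(2) unfolding uniform_limit_iff by blast
    show "\<forall>\<^sub>F n in sequentially. \<forall>t\<in>T. dist (r n *\<^sub>R (f (Zs n t) - f (Z t))) (\<D> f (Z t) (W t)) < e"
      using a b
    proof (rule eventually_elim2, intro ballI)
      fix n t assume h: "\<forall>t\<in>T. dist (Zs n t) (Z t) < \<eta>" "\<forall>t\<in>T. dist (r n *\<^sub>R (Zs n t - Z t)) (W t) < e2" and t: "t \<in> T"
      let ?d = "Zs n t - Z t"
      let ?V = "r n *\<^sub>R ?d"
      have V: "norm (?V - W t) < e2" using h(2) t by (simp add: dist_norm)
      have V': "norm ?V < M + 1" using V M(2)[OF t] norm_triangle_sub[of ?V "W t"] by (simp add: e2_def)
      have rem: "norm (f (Zs n t) - f (Z t) - \<D> f (Z t) ?d) \<le> e1 * norm ?d"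
        using \<eta>(2)[of "Z t" "Zs n t"] h(1) t by (auto simp: dist_norm)
      have "r n *\<^sub>R (f (Zs n t) - f (Z t)) - \<D> f (Z t) (W t)
          = r n *\<^sub>R (f (Zs n t) - f (Z t) - \<D> f (Z t) ?d) + \<D> f (Z t) (?V - W t)"
        by (simp add: linear_diff[OF lin[OF t]] linear_scale[OF lin[OF t]] scaleR_diff_right)
      then have "norm (r n *\<^sub>R (f (Zs n t) - f (Z t)) - \<D> f (Z t) (W t))
          \<le> norm (r n *\<^sub>R (f (Zs n t) - f (Z t) - \<D> f (Z t) ?d)) + norm (\<D> f (Z t) (?V - W t))"
        by (metis norm_triangle_ineq)
      also have "\<dots> \<le> \<bar>r n\<bar> * (e1 * norm ?d) + C * norm (?V - W t)"
        using rem C(2)[of "Z t" "?V - W t"] t by (intro add_mono) (auto intro!: mult_left_mono)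
      also have "\<bar>r n\<bar> * (e1 * norm ?d) = e1 * norm ?V" by simp
      also have "e1 * norm ?V + C * norm (?V - W t) < e1 * (M + 1) + C * e2"
        using V V' e12 C by (intro add_strict_mono mult_strict_left_mono) auto
      also have "e1 * (M + 1) = e / 2" using M(1) by (simp add: e1_def field_simps)
      also have "C * e2 \<le> e / 2" using C e by (simp add: e2_def min_def field_simps)
      finally show "dist (r n *\<^sub>R (f (Zs n t) - f (Z t))) (\<D> f (Z t) (W t)) < e"
        by (simp add: dist_norm)
    qed
  qed
  have 3: "continuous_on T (\<lambda>t. \<D> f (Z t) (W t))"
    by (rule C1_continuous_D[OF assms(2,4) cW assms(5)])
  show ?thesis using 1 2 3 by (simp add: variation_field_def)
qed

text \<open>An equation that holds for all curves of a family may be differentiated with respect to the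
parameter: the time derivatives of the difference quotients converge uniformly. This is how the
linearised equations of motion arise later, without differentiability of the time derivatives.\<close>

lemma variation_field_derivative:
  fixes w :: "real \<Rightarrow> 'a::banach"
  assumes "variation_field T fs f r w" "variation_field T gs g r v" "compact T" "continuous_on T c"
    and "open J" "is_interval J" "J \<subseteq> T"
    and fs: "\<And>n t. t \<in> J \<Longrightarrow> (fs n has_vector_derivative c t *\<^sub>R gs n t) (at t)"
    and f: "\<And>t. t \<in> J \<Longrightarrow> (f has_vector_derivative c t *\<^sub>R g t) (at t)"
    and t: "t \<in> J"
  shows "(w has_vector_derivative c t *\<^sub>R v t) (at t)"
proof -
  obtain M where M: "M > 0" "\<And>t. t \<in> T \<Longrightarrow> \<bar>c t\<bar> \<le> M"
    using compact_image_norm_bound[OF assms(4,3)] by (metis real_norm_def)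
  have w: "uniform_limit T (\<lambda>n t. r n *\<^sub>R (fs n t - f t)) w sequentially"
    and v: "uniform_limit T (\<lambda>n t. r n *\<^sub>R (gs n t - g t)) v sequentially"
    using assms by (auto simp: variation_field_def)
  have lim: "(\<lambda>n. r n *\<^sub>R (fs n s - f s)) \<longlonglongrightarrow> w s" if "s \<in> J" for s
    using tendsto_uniform_limitI[OF w] that assms(7) by blast
  have "\<exists>h. \<forall>s\<in>J. (\<lambda>n. r n *\<^sub>R (fs n s - f s)) \<longlonglongrightarrow> h s \<and> (h has_derivative (\<lambda>x. x *\<^sub>R (c s *\<^sub>R v s))) (at s within J)"
  proof (rule has_derivative_sequence[where f'="\<lambda>n s x. x *\<^sub>R (r n *\<^sub>R (c s *\<^sub>R gs n s - c s *\<^sub>R g s))"])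
    show "convex J" using assms(6) by (rule is_interval_convex)
    show "t \<in> J" by fact
    show "(\<lambda>n. r n *\<^sub>R (fs n t - f t)) \<longlonglongrightarrow> w t" by (rule lim[OF t])
    fix n s assume s: "s \<in> J"
    have "((\<lambda>s. r n *\<^sub>R (fs n s - f s)) has_vector_derivative r n *\<^sub>R (c s *\<^sub>R gs n s - c s *\<^sub>R g s)) (at s)"
      using has_vector_derivative_scaleR[OF DERIV_const[of "r n"] has_vector_derivative_diff[OF fs[OF s, of n] f[OF s]]] by simp
    then show "((\<lambda>s. r n *\<^sub>R (fs n s - f s)) has_derivative (\<lambda>x. x *\<^sub>R (r n *\<^sub>R (c s *\<^sub>R gs n s - c s *\<^sub>R g s)))) (at s within J)"
      unfolding has_vector_derivative_def by (rule has_derivative_at_withinI)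
  next
    fix e :: real assume "e > 0"
    then have "e / M > 0" using M by simp
    with v have "\<forall>\<^sub>F n in sequentially. \<forall>s\<in>T. dist (r n *\<^sub>R (gs n s - g s)) (v s) < e / M"
      unfolding uniform_limit_iff by blast
    then show "\<forall>\<^sub>F n in sequentially. \<forall>s\<in>J. \<forall>h. norm (h *\<^sub>R (r n *\<^sub>R (c s *\<^sub>R gs n s - c s *\<^sub>R g s)) - h *\<^sub>R (c s *\<^sub>R v s)) \<le> e * norm h"
    proof (rule eventually_mono, intro ballI allI)
      fix n s and h :: real
      assume a: "\<forall>s\<in>T. dist (r n *\<^sub>R (gs n s - g s)) (v s) < e / M" and s: "s \<in> J"
      have "h *\<^sub>R (r n *\<^sub>R (c s *\<^sub>R gs n s - c s *\<^sub>R g s)) - h *\<^sub>R (c s *\<^sub>R v s) = h *\<^sub>R c s *\<^sub>R (r n *\<^sub>R (gs n s - g s) - v s)"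
        by (simp add: algebra_simps)
      then have "norm (h *\<^sub>R (r n *\<^sub>R (c s *\<^sub>R gs n s - c s *\<^sub>R g s)) - h *\<^sub>R (c s *\<^sub>R v s))
          = \<bar>h\<bar> * (\<bar>c s\<bar> * norm (r n *\<^sub>R (gs n s - g s) - v s))"
        by (simp only: norm_scaleR real_norm_def)
      also have "\<dots> \<le> \<bar>h\<bar> * (M * (e / M))"
        using a s assms(7) M by (intro mult_left_mono mult_mono) (auto simp: dist_norm less_imp_le subsetD)
      finally show "norm (h *\<^sub>R (r n *\<^sub>R (c s *\<^sub>R gs n s - c s *\<^sub>R g s)) - h *\<^sub>R (c s *\<^sub>R v s)) \<le> e * norm h"
        using M by (simp add: mult.commute)
    qed
  qed
  then obtain h where h: "\<And>s. s \<in> J \<Longrightarrow> (\<lambda>n. r n *\<^sub>R (fs n s - f s)) \<longlonglongrightarrow> h s"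
      "\<And>s. s \<in> J \<Longrightarrow> (h has_derivative (\<lambda>x. x *\<^sub>R (c s *\<^sub>R v s))) (at s within J)" by blast
  have "h s = w s" if "s \<in> J" for s using LIMSEQ_unique[OF h(1) lim] that by blast
  then have "(w has_derivative (\<lambda>x. x *\<^sub>R (c t *\<^sub>R v t))) (at t within J)"
    using has_derivative_transform[OF t _ h(2)[OF t], of w] by auto
  then show ?thesis using at_within_open[OF t assms(5)] by (simp add: has_vector_derivative_def)
qed

text \<open>Solutions depend differentiably on their initial values. The field \<open>W\<close> solves the linearised
equation; the difference quotients solve it up to an error that tends to zero uniformly, and
\<open>ode_stability\<close> compares the two. The initial time \<open>t1\<close> is arbitrary in the interval, so that the
solutions of the linearised equation take every value at every time.\<close>

lemma flow_linearisation:
  fixes X :: "'a::euclidean_space \<Rightarrow> 'a"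
  assumes "open S" "Ck_on (Suc 0) S X" "open I" "t0 \<in> I" "continuous_on I \<rho>"
    and Z: "\<And>t. t \<in> I \<Longrightarrow> (Z has_vector_derivative \<rho> t *\<^sub>R X (Z t)) (at t)" "\<And>t. t \<in> I \<Longrightarrow> Z t \<in> S"
  obtains \<delta> where "\<delta> > 0" "{t0-\<delta>..t0+\<delta>} \<subseteq> I"
    "\<And>t1 \<zeta>. t1 \<in> {t0-\<delta>..t0+\<delta>} \<Longrightarrow> \<exists>W Zs r. W t1 = \<zeta> \<and> variation_field {t0-\<delta>..t0+\<delta>} Zs Z r W \<and>
       (\<forall>n. \<forall>t\<in>{t0-\<delta><..<t0+\<delta>}. Zs n t \<in> S \<and> (Zs n has_vector_derivative \<rho> t *\<^sub>R X (Zs n t)) (at t))"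
proof -
  obtain r where r: "r > 0" "cball (Z t0) r \<subseteq> S" using assms(1,4) Z(2) open_contains_cball by metis
  define B where "B = cball (Z t0) r"
  have B: "compact B" "convex B" "closed B" "B \<noteq> {}" "B \<subseteq> S" using r by (auto simp: B_def)
  obtain L0 where L0: "L0 > 0" "\<And>z v. z \<in> B \<Longrightarrow> norm (\<D> X z v) \<le> L0 * norm v"
    using C1_bounded_on_compact[OF assms(2) B(1,5)] by blast
  have lipX: "norm (X z - X z') \<le> L0 * norm (z - z')" if "z \<in> B" "z' \<in> B" for z z'
  proof (rule differentiable_bound[OF B(2) _ _ that(1,2)])
    fix x assume "x \<in> B"
    then show "(X has_derivative \<D> X x) (at x within B)" "onorm (\<D> X x) \<le> L0"
      using B C1_has_derivative[OF assms(2), of x] L0 by (auto intro: has_derivative_at_withinI onorm_le)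
  qed
  have cZ: "continuous_on I Z"
    using Z(1) by (intro continuous_at_imp_continuous_on) (blast dest: has_vector_derivative_continuous)
  obtain d1 where d1: "d1 > 0" "cball t0 d1 \<subseteq> I" using assms(3,4) open_contains_cball by metis
  have "isCont Z t0" using cZ assms(3,4) by (simp add: continuous_on_eq_continuous_at)
  then obtain d2 where d2: "d2 > 0" "\<And>t. dist t t0 < d2 \<Longrightarrow> dist (Z t) (Z t0) < r / 2"
    using r(1) unfolding continuous_at_eps_delta by (metis half_gt_zero)
  obtain R where R: "R > 0" "\<And>t. t \<in> cball t0 d1 \<Longrightarrow> \<bar>\<rho> t\<bar> \<le> R"
    using compact_image_norm_bound[OF continuous_on_subset[OF assms(5) d1(2)] compact_cball] by (metis real_norm_def)
  \<comment> \<open>\<open>R L0\<close> is a Lipschitz constant of the right hand side, so an interval of length \<open>2 \<delta>\<close> satisfies the condition of \<open>picard_lindeloef\<close>.\<close>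
  define \<delta> where "\<delta> = min (min d1 (d2/2)) (1 / (4 * (R * L0)))"
  define a b where "a = t0 - \<delta>" and "b = t0 + \<delta>"
  have RL: "R * L0 > 0" using R L0 by simp
  have \<delta>: "\<delta> > 0" using d1 d2 RL by (simp add: \<delta>_def)
  have ab2: "{a..b} \<subseteq> cball t0 d1"
    by (auto simp: a_def b_def \<delta>_def dist_real_def)
  note ab = subset_trans[OF this d1(2)] this
  have ZB: "dist (Z t) (Z t0) < r/2" if "t \<in> {a..b}" for t
    using that d2 \<delta> by (auto intro!: d2(2) simp: a_def b_def \<delta>_def dist_real_def)
  have ZB': "Z t \<in> B" if "t \<in> {a..b}" for t using ZB[OF that] r by (simp add: B_def dist_commute)
  have "(R * L0) * \<delta> \<le> (R * L0) * (1 / (4 * (R * L0)))" unfolding \<delta>_def using RL by (intro mult_left_mono) auto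
  also have "\<dots> = 1/4" using R L0 by simp
  finally have small: "(R * L0) * (b - a) \<le> 1/2" by (simp add: a_def b_def)
  define P where "P = closest_point B"
  have P: "P z \<in> B" "norm (P z - P z') \<le> norm (z - z')" "z \<in> B \<Longrightarrow> P z = z" for z z'
    using B closest_point_lipschitz[of B z z'] unfolding P_def
    by (auto simp: closest_point_in_set closest_point_self dist_norm)
  \<comment> \<open>The projection to the ball makes the right hand side globally Lipschitz; all solutions considered below stay in the ball, where nothing is changed.\<close>
  define Y where "Y = (\<lambda>t z. \<rho> t *\<^sub>R X (P z))"
  have cP: "continuous_on UNIV P" unfolding P_def using B by (intro continuous_on_closest_point) auto
  have cX: "continuous_on B X" using assms(2) B Ck_on_continuous continuous_on_subset by blast
  have cY: "continuous_on ({a..b} \<times> UNIV) (\<lambda>(t, z). Y t z)"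
    unfolding Y_def case_prod_beta using assms(5) ab P
    by (intro continuous_intros continuous_on_compose2[OF cX] continuous_on_compose2[OF cP])
       (auto intro!: continuous_on_compose2[OF assms(5)] continuous_intros)
  have lipY: "norm (Y t z - Y t z') \<le> (R * L0) * norm (z - z')" if "t \<in> {a..b}" for t z z'
  proof -
    have "norm (Y t z - Y t z') = \<bar>\<rho> t\<bar> * norm (X (P z) - X (P z'))"
      unfolding Y_def by (simp add: scaleR_diff_right[symmetric])
    also have "\<dots> \<le> R * (L0 * norm (z - z'))"
      using R that ab L0 lipX[OF P(1) P(1)] P(2)
      by (intro mult_mono) (auto intro: order_trans[OF lipX] mult_left_mono P)
    finally show ?thesis by (simp add: mult.assoc)
  qed
  have ZY: "(Z has_vector_derivative Y t (Z t)) (at t within {a..b})" if "t \<in> {a..b}" for t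
    using has_vector_derivative_at_within[OF Z(1)[OF subsetD[OF ab(1) that]]] P(3)[OF ZB'[OF that]] by (simp add: Y_def)
  define A where "A = (\<lambda>t w. \<rho> t *\<^sub>R \<D> X (Z t) w)"
  have linX: "linear (\<D> X (Z t))" if "t \<in> {a..b}" for t
    using assms(2) ab Z(2) that by (intro linear_D) auto
  have cA: "continuous_on ({a..b} \<times> UNIV) (\<lambda>(t, z). A t z)"
    unfolding A_def case_prod_beta using ab
    by (intro continuous_intros C1_continuous_D[OF assms(2)])
       (auto intro!: continuous_on_compose2[OF assms(5)] continuous_on_compose2[OF cZ] continuous_intros Z)
  have bA: "norm (A t w) \<le> (R * L0) * norm w" if "t \<in> {a..b}" for t w
  proof -
    have "norm (A t w) \<le> R * (L0 * norm w)" unfolding A_def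
      using R that ab L0(2)[OF ZB'[OF that]] by (auto intro!: mult_mono)
    then show ?thesis by (simp add: mult.assoc)
  qed
  have lipA: "norm (A t z - A t z') \<le> (R * L0) * norm (z - z')" if "t \<in> {a..b}" for t z z'
    using bA[OF that, of "z - z'"] by (simp add: A_def linear_diff[OF linX[OF that]] scaleR_diff_right)
  show ?thesis
  proof (rule that[of \<delta>])
    show "\<delta> > 0" by fact
    show "{t0-\<delta>..t0+\<delta>} \<subseteq> I" using ab by (simp add: a_def b_def)
    fix t1 \<zeta> assume "t1 \<in> {t0-\<delta>..t0+\<delta>}"
    then have t1: "t1 \<in> {a..b}" by (simp add: a_def b_def)
    obtain W where W: "W t1 = \<zeta>" "\<And>t. t \<in> {a..b} \<Longrightarrow> (W has_vector_derivative A t (W t)) (at t within {a..b})"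
      using picard_lindeloef[OF t1 cA lipA _ small, of \<zeta>] RL by (metis less_imp_le)
    \<comment> \<open>The perturbations \<open>\<zeta> / q n\<close> have to be so small that the solutions stay in the ball of radius \<open>r\<close>.\<close>
    define N where "N = 4 * norm \<zeta> / r + 1"
    have N: "N > 0" using r by (simp add: N_def add_nonneg_pos)
    define q where "q = (\<lambda>n. real n + N)"
    have q: "q n > 0" for n using N by (simp add: q_def add_nonneg_pos)
    have "\<exists>Z'. Z' t1 = Z t1 + (1 / q n) *\<^sub>R \<zeta> \<and> (\<forall>t\<in>{a..b}. (Z' has_vector_derivative Y t (Z' t)) (at t within {a..b}))" for n
      using picard_lindeloef[OF t1 cY lipY _ small, of "Z t1 + (1 / q n) *\<^sub>R \<zeta>"] RL by (metis less_imp_le)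
    then obtain Zs where Zs: "\<And>n. Zs n t1 = Z t1 + (1 / q n) *\<^sub>R \<zeta>"
      "\<And>n t. t \<in> {a..b} \<Longrightarrow> (Zs n has_vector_derivative Y t (Zs n t)) (at t within {a..b})" by metis
    have close: "norm (Zs n t - Z t) \<le> 2 * norm \<zeta> / q n" if "t \<in> {a..b}" for n t
    proof -
      have "norm (Zs n t - Z t) \<le> 2 * (norm (Zs n t1 - Z t1) + 0 * (b - a))"
        by (rule ode_stability[where d="\<lambda>t. Zs n t - Z t", OF has_vector_derivative_diff[OF Zs(2) ZY] _ _ small t1 that])
           (use lipY RL in auto)
      then show ?thesis using q[of n] by (simp add: Zs)
    qed
    have half: "2 * norm \<zeta> / q n < r / 2" for n
    proof -
      have "4 * norm \<zeta> < r * N" using r by (simp add: N_def field_simps)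
      also have "\<dots> \<le> r * q n" using r by (simp add: q_def)
      finally show ?thesis using q[of n] by (simp add: field_simps)
    qed
    have ZsB: "Zs n t \<in> B" if "t \<in> {a..b}" for n t
      using close[OF that, of n] half[of n] ZB[OF that] dist_triangle[of "Zs n t" "Z t0" "Z t"]
      by (simp add: B_def dist_norm norm_minus_commute)
    have qlim: "filterlim q at_top sequentially" unfolding q_def
      by (rule filterlim_at_top_mono[OF filterlim_real_sequentially]) (use N in auto)
    have inv0: "(\<lambda>n. inverse (q n)) \<longlonglongrightarrow> 0" by (rule tendsto_inverse_0_at_top[OF qlim])
    have u1: "uniform_limit {a..b} Zs Z sequentially"
      unfolding uniform_limit_iff
    proof safe
      fix e :: real assume e: "e > 0"
      have "(\<lambda>n. 2 * norm \<zeta> / q n) \<longlonglongrightarrow> 0" using tendsto_mult_right_zero[OF inv0, of "2 * norm \<zeta>"] by (simp add: divide_inverse)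
      from order_tendstoD(2)[OF this e] show "\<forall>\<^sub>F n in sequentially. \<forall>t\<in>{a..b}. dist (Zs n t) (Z t) < e"
        by (rule eventually_mono) (use close in \<open>fastforce simp: dist_norm intro: le_less_trans\<close>)
    qed
    have u2: "uniform_limit {a..b} (\<lambda>n t. q n *\<^sub>R (Zs n t - Z t)) W sequentially"
      unfolding uniform_limit_iff
    proof safe
      fix e :: real assume e: "e > 0"
      define K where "K = 2 * (R * (2 * norm \<zeta>) * (b - a)) + 1"
      have K: "K > 0" using R \<delta> by (simp add: K_def a_def b_def add_nonneg_pos)
      define e' where "e' = e / (2 * K)"
      have e': "e' > 0" using e K by (simp add: e'_def)
      obtain \<eta> where \<eta>: "\<eta> > 0" "\<And>z z'. z \<in> B \<Longrightarrow> norm (z' - z) < \<eta> \<Longrightarrow> z' \<in> S \<and> norm (X z' - X z - \<D> X z (z' - z)) \<le> e' * norm (z' - z)"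
        using uniformly_differentiable_on_compact[OF assms(1,2) B(1,5) e'] by metis
      have "\<forall>\<^sub>F n in sequentially. \<forall>t\<in>{a..b}. dist (Zs n t) (Z t) < \<eta>"
        using u1 \<eta>(1) unfolding uniform_limit_iff by blast
      then show "\<forall>\<^sub>F n in sequentially. \<forall>t\<in>{a..b}. dist (q n *\<^sub>R (Zs n t - Z t)) (W t) < e"
      proof (rule eventually_mono, intro ballI)
        fix n t assume near: "\<forall>t\<in>{a..b}. dist (Zs n t) (Z t) < \<eta>" and t: "t \<in> {a..b}"
        define d where "d = (\<lambda>t. q n *\<^sub>R (Zs n t - Z t) - W t)"
        define d' where "d' = (\<lambda>t. q n *\<^sub>R (Y t (Zs n t) - Y t (Z t)) - A t (W t))"
        have dd: "(d has_vector_derivative d' t) (at t within {a..b})" if "t \<in> {a..b}" for t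
          unfolding d_def d'_def
          using has_vector_derivative_diff[OF has_vector_derivative_scaleR[OF DERIV_const[of "q n"] has_vector_derivative_diff[OF Zs(2)[OF that, of n] ZY[OF that]]] W(2)[OF that]]
          by simp
        have dle: "norm (d' t) \<le> (R * L0) * norm (d t) + R * (e' * (2 * norm \<zeta>))" if "t \<in> {a..b}" for t
        proof -
          let ?x = "Zs n t - Z t"
          let ?rem = "X (Zs n t) - X (Z t) - \<D> X (Z t) ?x"
          have Yx: "Y t (Zs n t) = \<rho> t *\<^sub>R X (Zs n t)" "Y t (Z t) = \<rho> t *\<^sub>R X (Z t)"
            using P(3) ZsB[OF that] ZB'[OF that] by (auto simp: Y_def)
          have "d' t = A t (d t) + (q n * \<rho> t) *\<^sub>R ?rem"
            unfolding d'_def d_def A_def Yx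
            by (simp only: linear_diff[OF linX[OF that]] linear_scale[OF linX[OF that]])
               (simp add: scaleR_diff_right algebra_simps)
          then have "norm (d' t) \<le> norm (A t (d t)) + norm ((q n * \<rho> t) *\<^sub>R ?rem)"
            by (simp only: norm_triangle_ineq)
          also have "norm ((q n * \<rho> t) *\<^sub>R ?rem) = \<bar>\<rho> t\<bar> * (q n * norm ?rem)" using q[of n] by (simp add: abs_mult)
          also have "\<dots> \<le> R * (q n * (e' * (2 * norm \<zeta> / q n)))"
          proof (intro mult_mono mult_left_mono)
            have "norm ?rem \<le> e' * norm ?x"
              using \<eta>(2)[OF ZB'[OF that], of "Zs n t"] near that by (auto simp: dist_norm)
            also have "\<dots> \<le> e' * (2 * norm \<zeta> / q n)" using e' close[OF that] by (intro mult_left_mono) auto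
            finally show "norm ?rem \<le> e' * (2 * norm \<zeta> / q n)" .
          qed (use R q[of n] that ab in \<open>auto intro: less_imp_le\<close>)
          also have "q n * (e' * (2 * norm \<zeta> / q n)) = e' * (2 * norm \<zeta>)" using q[of n] by simp
          finally show ?thesis using bA[OF that, of "d t"] by simp
        qed
        have "norm (d t) \<le> 2 * (norm (d t1) + R * (e' * (2 * norm \<zeta>)) * (b - a))"
          by (rule ode_stability[OF dd dle _ small t1 t]) (use RL in auto)
        also have "d t1 = 0" using q[of n] by (simp add: d_def Zs W)
        also have "2 * (norm (0::'a) + R * (e' * (2 * norm \<zeta>)) * (b - a)) = e' * (K - 1)" by (simp add: K_def)
        also have "\<dots> < e' * (2 * K)" using e' K by (intro mult_strict_left_mono) auto
        also have "\<dots> = e" using K by (simp add: e'_def)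
        finally show "dist (q n *\<^sub>R (Zs n t - Z t)) (W t) < e" by (simp add: d_def dist_norm)
      qed
    qed
    have cW: "continuous_on {a..b} W" using W(2) by (rule continuous_on_vector_derivative)
    have sol: "Zs n t \<in> S \<and> (Zs n has_vector_derivative \<rho> t *\<^sub>R X (Zs n t)) (at t)" if "t \<in> {a<..<b}" for n t
    proof -
      have "at t within {a..b} = at t" by (rule at_within_interior) (use that in auto)
      then show ?thesis using Zs(2)[of t n] that P(3) ZsB[of t n] B by (auto simp: Y_def)
    qed
    show "\<exists>W Zs r. W t1 = \<zeta> \<and> variation_field {t0-\<delta>..t0+\<delta>} Zs Z r W \<and>
       (\<forall>n. \<forall>t\<in>{t0-\<delta><..<t0+\<delta>}. Zs n t \<in> S \<and> (Zs n has_vector_derivative \<rho> t *\<^sub>R X (Zs n t)) (at t))"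
      using W(1) u1 u2 cW sol unfolding variation_field_def a_def b_def by blast
  qed
qed

lemma ode_solution:
  fixes X :: "'a::euclidean_space \<Rightarrow> 'a"
  assumes "open S" "Ck_on (Suc 0) S X" "z \<in> S"
  obtains \<delta> Z where "\<delta> > 0" "Z 0 = z"
    "\<And>t. t \<in> {-\<delta><..<\<delta>} \<Longrightarrow> Z t \<in> S \<and> (Z has_vector_derivative X (Z t)) (at t)"
proof -
  obtain r where r: "r > 0" "cball z r \<subseteq> S" using assms(1,3) open_contains_cball by metis
  define B where "B = cball z r"
  have B: "compact B" "convex B" "closed B" "B \<noteq> {}" "B \<subseteq> S" using r by (auto simp: B_def)
  obtain L where L: "L > 0" "\<And>z v. z \<in> B \<Longrightarrow> norm (\<D> X z v) \<le> L * norm v"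
    using C1_bounded_on_compact[OF assms(2) B(1,5)] by blast
  have cX: "continuous_on B X" using assms(2) B Ck_on_continuous continuous_on_subset by blast
  obtain M where M: "M > 0" "\<And>z. z \<in> B \<Longrightarrow> norm (X z) \<le> M"
    using compact_image_norm_bound[OF cX B(1)] by blast
  have lipX: "norm (X z - X z') \<le> L * norm (z - z')" if "z \<in> B" "z' \<in> B" for z z'
  proof (rule differentiable_bound[OF B(2) _ _ that(1,2)])
    fix x assume "x \<in> B"
    then show "(X has_derivative \<D> X x) (at x within B)" "onorm (\<D> X x) \<le> L"
      using B C1_has_derivative[OF assms(2), of x] L by (auto intro: has_derivative_at_withinI onorm_le)
  qed
  define P where "P = closest_point B"
  have P: "P z \<in> B" "norm (P z - P z') \<le> norm (z - z')" "z \<in> B \<Longrightarrow> P z = z" for z z'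
    using B closest_point_lipschitz[of B z z'] unfolding P_def
    by (auto simp: closest_point_in_set closest_point_self dist_norm)
  have cP: "continuous_on UNIV P" unfolding P_def using B by (intro continuous_on_closest_point) auto
  define \<delta> where "\<delta> = min (1 / (4 * L)) (r / (2 * M))"
  have \<delta>: "\<delta> > 0" "L * (\<delta> - (- \<delta>)) \<le> 1/2" "M * (\<delta> - (-\<delta>)) \<le> r"
    using L M r by (auto simp: \<delta>_def min_def field_simps)
  obtain Z where Z: "Z 0 = z" "\<And>t. t \<in> {-\<delta>..\<delta>} \<Longrightarrow> (Z has_vector_derivative X (P (Z t))) (at t within {-\<delta>..\<delta>})"
  proof (rule picard_lindeloef[of 0 "-\<delta>" \<delta> "\<lambda>t z. X (P z)" L z])
    show "continuous_on ({- \<delta>..\<delta>} \<times> UNIV) (\<lambda>(t, z). X (P z))"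
      unfolding case_prod_beta using P
      by (intro continuous_on_compose2[OF cX] continuous_on_compose2[OF cP]) (auto intro!: continuous_intros)
    show "norm (X (P z) - X (P z')) \<le> L * norm (z - z')" for z z'
      using L P by (intro order_trans[OF lipX]) (auto intro: mult_left_mono)
  qed (use \<delta> L in auto)
  have "Z t \<in> B" if "t \<in> {-\<delta>..\<delta>}" for t
  proof -
    have "norm (Z t - Z 0) \<le> M * (\<delta> - (-\<delta>))"
      by (rule norm_diff_le_of_vector_derivative[OF Z(2)]) (use that \<delta> P M in auto)
    then show ?thesis using \<delta>(3) Z(1) by (simp add: B_def dist_norm norm_minus_commute)
  qed
  then have "Z t \<in> S \<and> (Z has_vector_derivative X (Z t)) (at t)" if "t \<in> {-\<delta><..<\<delta>}" for t
  proof -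
    have "at t within {-\<delta>..\<delta>} = at t" by (rule at_within_interior) (use that in auto)
    then show ?thesis using Z(2)[of t] P(3) \<open>\<And>t. t \<in> {-\<delta>..\<delta>} \<Longrightarrow> Z t \<in> B\<close>[of t] that B by auto
  qed
  then show ?thesis using that \<delta>(1) Z(1) by blast
qed

section \<open>Local inverses of \<open>C\<^sup>1\<close> maps\<close>

text \<open>With \<open>w = A\<^sup>-\<^sup>1 v - A\<^sub>0\<^sup>-\<^sup>1 v\<close> one has \<open>A w = (A\<^sub>0 - A) A\<^sub>0\<^sup>-\<^sup>1 v\<close>, and a lower bound \<open>norm w \<le> 2 C norm (A w)\<close>
persists for \<open>A\<close> near \<open>A\<^sub>0\<close>.\<close>

lemma continuous_on_inverse_blinfun:
  fixes B :: "'y::topological_space \<Rightarrow> 'a::euclidean_space \<Rightarrow>\<^sub>L 'a"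
  assumes "continuous_on V B" "\<And>y. y \<in> V \<Longrightarrow> bij (blinfun_apply (B y))"
  shows "continuous_on V (\<lambda>y. inv (blinfun_apply (B y)) v)"
  unfolding continuous_on_def
proof
  fix y0 assume y0: "y0 \<in> V"
  let ?i = "\<lambda>y. inv (blinfun_apply (B y))"
  have inv: "blinfun_apply (B y) (?i y w) = w" if "y \<in> V" for y w
    using assms(2)[OF that] by (simp add: bij_is_surj surj_f_inv_f)
  have "linear (?i y0)"
    using linear_bounded_pos[of "blinfun_apply (B y0)"] assms(2)[OF y0]
    by (metis bij_is_inj bij_is_surj blinfun.bounded_linear_right bounded_linear.linear inj_linear_imp_inv_linear)
  then obtain C where C: "C > 0" "\<And>w. norm (?i y0 w) \<le> C * norm w"
    using linear_bounded_pos by (metis mult.commute)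
  have key: "norm (?i y v - ?i y0 v) \<le> 2 * C * norm (B y - B y0) * norm (?i y0 v)"
    if y: "y \<in> V" "norm (B y - B y0) < 1 / (2 * C)" for y
  proof -
    let ?w = "?i y v - ?i y0 v"
    have "norm ?w = norm (?i y0 (blinfun_apply (B y0) ?w))"
      using assms(2)[OF y0] by (simp add: bij_is_inj)
    also have "\<dots> \<le> C * norm (blinfun_apply (B y0) ?w)" by (rule C)
    also have "blinfun_apply (B y0) ?w = blinfun_apply (B y) ?w - blinfun_apply (B y - B y0) ?w"
      by (simp add: blinfun.diff_left)
    also have "norm \<dots> \<le> norm (blinfun_apply (B y) ?w) + norm (B y - B y0) * norm ?w"
      by (rule order_trans[OF norm_triangle_ineq4 add_left_mono[OF norm_blinfun]])
    also have "norm (B y - B y0) * norm ?w \<le> 1 / (2 * C) * norm ?w"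
      using y by (intro mult_right_mono) auto
    finally have "norm ?w \<le> C * (norm (blinfun_apply (B y) ?w) + 1 / (2 * C) * norm ?w)" using C by simp
    then have "norm ?w \<le> 2 * C * norm (blinfun_apply (B y) ?w)" using C by (simp add: distrib_left)
    also have "blinfun_apply (B y) ?w = - blinfun_apply (B y - B y0) (?i y0 v)"
      using inv[OF y(1)] inv[OF y0] by (simp add: blinfun.diff_right blinfun.diff_left)
    also have "2 * C * norm \<dots> \<le> 2 * C * (norm (B y - B y0) * norm (?i y0 v))"
      using C norm_blinfun by (intro mult_left_mono) auto
    finally show ?thesis by (simp add: mult.assoc)
  qed
  have B0: "((\<lambda>y. norm (B y - B y0)) \<longlongrightarrow> 0) (at y0 within V)"
    using assms(1) y0 by (auto simp: continuous_on_def tendsto_norm_zero_iff intro: LIM_zero)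
  have "((\<lambda>y. 2 * C * norm (B y - B y0) * norm (?i y0 v)) \<longlongrightarrow> 0) (at y0 within V)"
    using tendsto_mult[OF tendsto_mult[OF tendsto_const[of "2 * C"] B0] tendsto_const[of "norm (?i y0 v)"]] by simp
  then have "((\<lambda>y. ?i y v - ?i y0 v) \<longlongrightarrow> 0) (at y0 within V)"
  proof (rule Lim_null_comparison[rotated])
    have "\<forall>\<^sub>F y in at y0 within V. norm (B y - B y0) < 1 / (2 * C)"
      using order_tendstoD(2)[OF B0] C by simp
    moreover have "\<forall>\<^sub>F y in at y0 within V. y \<in> V" by (simp add: eventually_at_filter)
    ultimately show "\<forall>\<^sub>F y in at y0 within V. norm (?i y v - ?i y0 v) \<le> 2 * C * norm (B y - B y0) * norm (?i y0 v)"
      by eventually_elim (rule key)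
  qed
  then show "((\<lambda>y. ?i y v) \<longlongrightarrow> ?i y0 v) (at y0 within V)" by (rule LIM_zero_cancel)
qed

text \<open>The inverse function theorem with the information that the local inverse is again of class \<open>C\<^sup>1\<close>.\<close>

lemma C1_local_inverse:
  fixes f :: "'a::euclidean_space \<Rightarrow> 'a"
  assumes "open S" "Ck_on (Suc 0) S f" "z \<in> S" "\<And>v. \<D> f z v = 0 \<Longrightarrow> v = 0"
  obtains S' V g where "open S'" "S' \<subseteq> S" "z \<in> S'" "open V" "\<And>x. x \<in> S' \<Longrightarrow> f x \<in> V \<and> g (f x) = x"
    "\<And>y. y \<in> V \<Longrightarrow> g y \<in> S' \<and> f (g y) = y" "Ck_on (Suc 0) V g"
    "\<And>x v. x \<in> S' \<Longrightarrow> \<D> g (f x) (\<D> f x v) = v"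
proof -
  let ?f' = "\<lambda>x. Blinfun (\<D> f x)"
  have lin: "linear (\<D> f x)" if "x \<in> S" for x using assms(2) that by (intro linear_D) auto
  have "inj (\<D> f z)" using assms(4) lin[OF assms(3)] by (metis linear_injective_0)
  then obtain h where h: "linear h" "h \<circ> \<D> f z = id" using linear_injective_left_inverse[OF lin[OF assms(3)]] by blast
  have inv: "Blinfun h o\<^sub>L ?f' z = id_blinfun"
    using h C1_Blinfun_apply[OF assms(2,3)]
    by (intro blinfun_eqI) (simp add: bounded_linear_Blinfun_apply linear_conv_bounded_linear o_def fun_eq_iff id_def)
  have der: "(f has_derivative blinfun_apply (?f' x)) (at x)" if "x \<in> S" for x
    using C1_has_derivative[OF assms(2) that] C1_Blinfun_apply[OF assms(2) that] by simp
  obtain S' V g g' where S': "open S'" "S' \<subseteq> S" "z \<in> S'" "open V" "f z \<in> V" "homeomorphism S' V f g"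
    and g: "\<And>y. y \<in> V \<Longrightarrow> (g has_derivative (g' y)) (at y)"
      "\<And>y. y \<in> V \<Longrightarrow> g' y = Hilbert_Choice.inv (blinfun_apply (?f' (g y)))"
      "\<And>y. y \<in> V \<Longrightarrow> bij (blinfun_apply (?f' (g y)))"
    using inverse_function_theorem[OF assms(1) der C1_continuous_blinfun[OF assms(2)] assms(3) inv] by blast
  have gV: "g y \<in> S'" if "y \<in> V" for y using S'(6) that by (auto simp: homeomorphism_def)
  have cg: "continuous_on V g" using S'(6) by (simp add: homeomorphism_def)
  have "continuous_on V (\<lambda>y. g' y v)" for v
  proof -
    have "continuous_on V (\<lambda>y. Hilbert_Choice.inv (blinfun_apply (?f' (g y))) v)"
      by (rule continuous_on_inverse_blinfun[OF continuous_on_compose2[OF C1_continuous_blinfun[OF assms(2)] cg]])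
         (use gV S' g in auto)
    then show ?thesis using g(2) by (simp cong: continuous_on_cong)
  qed
  then have Cg: "Ck_on (Suc 0) V g"
    using g(1) by (auto simp: differentiable_def D_eqI[OF g(1)] cong: continuous_on_cong)
  show ?thesis
  proof (rule that[OF S'(1-4) _ _ Cg])
    show fV: "f x \<in> V \<and> g (f x) = x" if "x \<in> S'" for x using S'(6) that by (auto simp: homeomorphism_def)
    show "g y \<in> S' \<and> f (g y) = y" if "y \<in> V" for y using S'(6) that by (auto simp: homeomorphism_def)
    show "\<D> g (f x) (\<D> f x v) = v" if x: "x \<in> S'" for x v
    proof -
      have "\<D> (\<lambda>x. g (f x)) x v = \<D> g (f x) (\<D> f x v)"
        using assms(2) Cg S'(2) x fV[OF x] by (intro D_compose) auto
      moreover have "\<D> (\<lambda>x. g (f x)) x = \<D> (\<lambda>x. x) x" by (rule D_cong[OF S'(1) x]) (use fV in blast)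
      ultimately show ?thesis by simp
    qed
  qed
qed

section \<open>Homogeneous Lagrangians\<close>

lemma sum_inner_basis: "(\<Sum>b\<in>Basis. f b *\<^sub>R b) \<bullet> (y::'a::euclidean_space) = (\<Sum>b\<in>Basis. (y \<bullet> b) * f b)"
  unfolding inner_sum_left inner_scaleR_left by (intro sum.cong) (simp_all add: inner_commute[of y] mult.commute)

lemma linear_functional_representation:
  fixes l :: "'a::euclidean_space \<Rightarrow> real"
  assumes "linear l" shows "(\<Sum>b\<in>Basis. l b *\<^sub>R b) \<bullet> y = l y"
proof -
  have "l y = l (\<Sum>b\<in>Basis. (y \<bullet> b) *\<^sub>R b)" by (simp add: euclidean_representation)
  then show ?thesis by (simp add: sum_inner_basis linear_sum[OF assms] linear_scale[OF assms])
qed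

lemma linear_fibre: "linear l \<Longrightarrow> linear (\<lambda>y. l (0, y))"
  by (auto intro!: linearI simp: linear_iff) (metis add.right_neutral add_Pair scaleR_Pair scaleR_zero_right)+

lemma linear_base: "linear l \<Longrightarrow> linear (\<lambda>y. l (y, 0))"
  by (auto intro!: linearI simp: linear_iff) (metis add.right_neutral add_Pair scaleR_Pair scaleR_zero_right)+

text \<open>The coordinate expression, over the range \<open>U\<close> of a chart, of a function on the tangent bundle that is
homogeneous of degree one; a point of the bundle is a pair \<open>(p, u)\<close> of position and velocity.
The odd part of a Finsler metric, which is neither positive nor convex, is the main example.\<close>

locale homogeneous_lagrangian =
  fixes U :: "'e::euclidean_space set" and k :: "'e \<times> 'e \<Rightarrow> real"
  assumes open_U: "open U"
    and C2: "Ck_on (Suc (Suc 0)) (U \<times> (- {0})) k"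
    and hom: "\<And>p u a. p \<in> U \<Longrightarrow> u \<noteq> 0 \<Longrightarrow> a > 0 \<Longrightarrow> k (p, a *\<^sub>R u) = a * k (p, u)"
begin

lemma open_TU: "open (U \<times> (- {0::'e}))"
  by (rule open_Times[OF open_U open_Compl[OF closed_singleton]])

lemma C1: "Ck_on (Suc 0) (U \<times> (- {0})) (\<lambda>z. \<D> k z v)"
  using C2 by (metis Ck_on.simps(2))

lemma linear_Dk: "z \<in> U \<times> (- {0}) \<Longrightarrow> linear (\<D> k z)"
  using C2 by (intro linear_D) auto

lemma linear_D2_left: "z \<in> U \<times> (- {0}) \<Longrightarrow> linear (\<lambda>v. \<D>2 k z v w)"
  by (rule C2_linear1[OF C2])

lemma linear_D2_right: "z \<in> U \<times> (- {0}) \<Longrightarrow> linear (\<D>2 k z v)"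
  by (rule C2_linear2[OF C2 open_TU])

lemma D2_sym: "z \<in> U \<times> (- {0}) \<Longrightarrow> \<D>2 k z v w = \<D>2 k z w v"
  by (rule D2_symmetric[OF C2 open_TU])

lemma D2_split_left: "z \<in> U \<times> (- {0}) \<Longrightarrow> \<D>2 k z (x, y) w = \<D>2 k z (x, 0) w + \<D>2 k z (0, y) w"
  using linear_add[OF linear_D2_left[of z w], of "(x, 0)" "(0, y)"] by simp

lemma D2_split_right: "z \<in> U \<times> (- {0}) \<Longrightarrow> \<D>2 k z w (x, y) = \<D>2 k z w (x, 0) + \<D>2 k z w (0, y)"
  using linear_add[OF linear_D2_right[of z w], of "(x, 0)" "(0, y)"] by simp

text \<open>The substitution \<open>(p, u) \<mapsto> (p, a u)\<close> multiplies \<open>k\<close> by \<open>a\<close>.\<close>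

lemma D_scale:
  assumes "p \<in> U" "u \<noteq> 0" "a > 0"
  shows "\<D> k (p, a *\<^sub>R u) (x, a *\<^sub>R y) = a * \<D> k (p, u) (x, y)"
proof -
  let ?m = "\<lambda>z::'e \<times> 'e. (fst z, a *\<^sub>R snd z)"
  have z: "(p, u) \<in> U \<times> (- {0})" "(p, a *\<^sub>R u) \<in> U \<times> (- {0})" using assms by auto
  have m: "(?m has_derivative ?m) (at z)" for z by (auto intro!: derivative_eq_intros)
  have dk: "k differentiable (at z)" if "z \<in> U \<times> (- {0})" for z using C2 that by auto
  have "\<D> (\<lambda>z. k (?m z)) (p, u) (x, y) = \<D> k (p, a *\<^sub>R u) (x, a *\<^sub>R y)"
    using D_compose[of ?m "(p, u)" k "(x, y)"] m dk[OF z(2)] by (simp add: differentiable_def D_eqI[OF m]) blast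
  moreover have "\<D> (\<lambda>z. k (?m z)) (p, u) = \<D> (\<lambda>z. a * k z) (p, u)"
  proof (rule D_cong[OF open_TU z(1)])
    show "k (?m z) = a * k z" if "z \<in> U \<times> (- {0})" for z
      using hom[of "fst z" "snd z" a] that assms(3) by (simp add: mem_Times_iff)
  qed
  moreover have "\<D> (\<lambda>z. a * k z) (p, u) = (\<lambda>v. a * \<D> k (p, u) v)"
    by (rule D_eqI) (auto intro!: derivative_eq_intros has_derivative_D dk z)
  ultimately show ?thesis by simp
qed

lemma D_scale_fibre: "p \<in> U \<Longrightarrow> u \<noteq> 0 \<Longrightarrow> a > 0 \<Longrightarrow> \<D> k (p, a *\<^sub>R u) (0, y) = \<D> k (p, u) (0, y)"
  using D_scale[of p u a 0 "(1/a) *\<^sub>R y"] linear_scale[OF linear_Dk, of "(p, u)" "1/a" "(0, y)"] by auto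

lemma D_scale_base: "p \<in> U \<Longrightarrow> u \<noteq> 0 \<Longrightarrow> a > 0 \<Longrightarrow> \<D> k (p, a *\<^sub>R u) (x, 0) = a * \<D> k (p, u) (x, 0)"
  using D_scale[of p u a x 0] by simp

lemma D2_scale:
  assumes "p \<in> U" "u \<noteq> 0" "a > 0"
  shows "\<D>2 k (p, a *\<^sub>R u) (0, w) (0, y) = \<D>2 k (p, u) (0, w) (0, y) / a"
proof -
  let ?m = "\<lambda>z::'e \<times> 'e. (fst z, a *\<^sub>R snd z)"
  have z: "(p, u) \<in> U \<times> (- {0})" "(p, a *\<^sub>R u) \<in> U \<times> (- {0})" using assms by auto
  have m: "(?m has_derivative ?m) (at z)" for z by (auto intro!: derivative_eq_intros)
  have dk: "(\<lambda>z. \<D> k z (0, y)) differentiable (at z)" if "z \<in> U \<times> (- {0})" for z using C1 that by auto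
  have "\<D> (\<lambda>z. \<D> k (?m z) (0, y)) (p, u) (0, w) = \<D>2 k (p, a *\<^sub>R u) (0, a *\<^sub>R w) (0, y)"
    using D_compose[of ?m "(p, u)" "\<lambda>z. \<D> k z (0, y)" "(0, w)"] m dk[OF z(2)] by (simp add: differentiable_def D_eqI[OF m]) blast
  moreover have "\<D> (\<lambda>z. \<D> k (?m z) (0, y)) (p, u) = \<D> (\<lambda>z. \<D> k z (0, y)) (p, u)"
  proof (rule D_cong[OF open_TU z(1)])
    show "\<D> k (?m z) (0, y) = \<D> k z (0, y)" if "z \<in> U \<times> (- {0})" for z
      using D_scale_fibre[of "fst z" "snd z"] that assms(3) by (simp add: mem_Times_iff)
  qed
  ultimately have "\<D>2 k (p, a *\<^sub>R u) (0, a *\<^sub>R w) (0, y) = \<D>2 k (p, u) (0, w) (0, y)" by simp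
  then show ?thesis
    using linear_scale[OF linear_D2_left[OF z(2), of "(0, y)"], of a "(0, w)"] assms(3) by (simp add: field_simps)
qed

lemma euler: assumes "p \<in> U" "u \<noteq> 0" shows "\<D> k (p, u) (0, u) = k (p, u)"
proof -
  have "((\<lambda>a. k (p, a *\<^sub>R u)) has_vector_derivative \<D> k (p, 1 *\<^sub>R u) (0, u)) (at (1::real))"
    by (rule C1_has_vector_derivative_compose[OF C2]) (use assms in \<open>auto intro!: derivative_eq_intros has_vector_derivative_Pair\<close>)
  moreover have "((\<lambda>a. k (p, a *\<^sub>R u)) has_vector_derivative k (p, u)) (at (1::real))"
    by (rule has_vector_derivative_transform_within_open[where S="{0<..}" and f="\<lambda>a. a * k (p, u)"])
       (use assms hom in \<open>auto intro!: derivative_eq_intros\<close>)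
  ultimately show ?thesis using vector_derivative_unique_at by fastforce
qed

text \<open>The fibre derivative is homogeneous of degree zero, hence constant on the ray of \<open>u\<close>.\<close>

lemma D2_fibre_radial: assumes "p \<in> U" "u \<noteq> 0" shows "\<D>2 k (p, u) (0, u) (0, y) = 0"
proof -
  have "((\<lambda>a. \<D> k (p, a *\<^sub>R u) (0, y)) has_vector_derivative \<D>2 k (p, 1 *\<^sub>R u) (0, u) (0, y)) (at (1::real))"
    by (rule C1_has_vector_derivative_compose[OF C1]) (use assms in \<open>auto intro!: derivative_eq_intros has_vector_derivative_Pair\<close>)
  moreover have "((\<lambda>a. \<D> k (p, a *\<^sub>R u) (0, y)) has_vector_derivative 0) (at (1::real))"
    by (rule has_vector_derivative_transform_within_open[where S="{0<..}" and f="\<lambda>a. \<D> k (p, u) (0, y)"])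
       (use assms D_scale_fibre in \<open>auto intro!: derivative_eq_intros\<close>)
  ultimately show ?thesis using vector_derivative_unique_at by fastforce
qed

text \<open>Euler's identity, differentiated with respect to the position.\<close>

lemma D2_base_radial: assumes "p \<in> U" "u \<noteq> 0" shows "\<D>2 k (p, u) (y, 0) (0, u) = \<D> k (p, u) (y, 0)"
proof -
  have z: "(p, u) \<in> U \<times> (- {0})" using assms by auto
  have m: "((\<lambda>p. (p, u)) has_derivative (\<lambda>h. (h, 0))) (at p)" by (auto intro!: derivative_eq_intros)
  have "\<D> (\<lambda>p. \<D> k (p, u) (0, u)) p y = \<D>2 k (p, u) (y, 0) (0, u)"
    using D_compose[of "\<lambda>p. (p, u)" p "\<lambda>z. \<D> k z (0, u)" y] C1 z
    by (simp add: D_eqI[OF m] differentiableI[OF m])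
  moreover have "\<D> (\<lambda>p. k (p, u)) p y = \<D> k (p, u) (y, 0)"
    using D_compose[of "\<lambda>p. (p, u)" p k y] C2 z
    by (simp add: D_eqI[OF m] differentiableI[OF m])
  moreover have "\<D> (\<lambda>p. \<D> k (p, u) (0, u)) p = \<D> (\<lambda>p. k (p, u)) p"
    by (rule D_cong[OF open_U assms(1)]) (use assms euler in auto)
  ultimately show ?thesis by simp
qed

end

abbreviation vel :: "(real \<Rightarrow> 'e::real_normed_vector) \<Rightarrow> real \<Rightarrow> 'e" where
  "vel x t \<equiv> vector_derivative x (at t)"

text \<open>The Euler-Lagrange equation \<open>d/dt k\<^sub>u = k\<^sub>x\<close>. It is stated with the derivative of the momentum, not with
second derivatives of \<open>k\<close>, because in this form it can be differentiated once more along
families of extremals.\<close>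

definition extremal :: "'e::euclidean_space set \<Rightarrow> ('e \<times> 'e \<Rightarrow> real) \<Rightarrow> real set \<Rightarrow> (real \<Rightarrow> 'e) \<Rightarrow> bool" where
  "extremal U k I x \<longleftrightarrow> open I \<and> is_interval I \<and> Ck_on (Suc (Suc 0)) I x \<and> (\<forall>t\<in>I. x t \<in> U \<and> vel x t \<noteq> 0) \<and>
     (\<forall>t\<in>I. \<forall>y. ((\<lambda>s. \<D> k (x s, vel x s) (0, y)) has_vector_derivative \<D> k (x t, vel x t) (y, 0)) (at t))"

text \<open>The line of \<open>u\<close> always lies in the kernel of the fibre Hessian, by homogeneity; degeneracy means
that the kernel is larger.\<close>

definition degenerate :: "('e::euclidean_space \<times> 'e \<Rightarrow> real) \<Rightarrow> 'e \<times> 'e \<Rightarrow> bool" where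
  "degenerate k z \<longleftrightarrow> (\<exists>w. (\<forall>a. w \<noteq> a *\<^sub>R snd z) \<and> (\<forall>y. \<D>2 k z (0, w) (0, y) = 0))"

text \<open>The set of these \<open>k\<close> is a vector space (\<open>shares_extremals_lincomb\<close>), which for a geodesically
reversible \<open>F\<close> contains the even and the odd part of \<open>F\<close>.\<close>

definition shares_extremals :: "'e::euclidean_space set \<Rightarrow> ('e \<times> 'e \<Rightarrow> real) \<Rightarrow> ('e \<times> 'e \<Rightarrow> real) \<Rightarrow> bool" where
  "shares_extremals U F k \<longleftrightarrow> homogeneous_lagrangian U k \<and> (\<forall>I x. extremal U F I x \<longrightarrow> extremal U k I x)"

lemma (in homogeneous_lagrangian) degenerate_scale:
  assumes "p \<in> U" "u \<noteq> 0" "a > 0" shows "degenerate k (p, a *\<^sub>R u) \<longleftrightarrow> degenerate k (p, u)"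
proof -
  have "(\<forall>b. w \<noteq> b *\<^sub>R (a *\<^sub>R u)) \<longleftrightarrow> (\<forall>b. w \<noteq> b *\<^sub>R u)" for w :: 'e
  proof
    assume h: "\<forall>b. w \<noteq> b *\<^sub>R (a *\<^sub>R u)"
    show "\<forall>b. w \<noteq> b *\<^sub>R u" using h[rule_format, of "b / a" for b] assms(3) by auto
  qed auto
  then show ?thesis unfolding degenerate_def using assms by (simp add: D2_scale)
qed

locale finsler_domain = homogeneous_lagrangian U F for U :: "'e::euclidean_space set" and F +
  assumes pos: "\<And>p u. p \<in> U \<Longrightarrow> u \<noteq> 0 \<Longrightarrow> F (p, u) > 0"
    and posdef: "\<And>p u w. p \<in> U \<Longrightarrow> u \<noteq> 0 \<Longrightarrow> w \<noteq> 0 \<Longrightarrow> \<D>2 (\<lambda>z. (F z)\<^sup>2) (p, u) (0, w) (0, w) > 0"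
begin

abbreviation L :: "'e \<times> 'e \<Rightarrow> real" where "L \<equiv> \<lambda>z. (F z)\<^sup>2"

lemma C2_L: "Ck_on (Suc (Suc 0)) (U \<times> (- {0})) L"
  by (rule Ck_on_power[OF C2 open_TU])

lemma C1_L: "Ck_on (Suc 0) (U \<times> (- {0})) (\<lambda>z. \<D> L z v)"
  using C2_L by (metis Ck_on.simps(2))

lemma linear_DL: "z \<in> U \<times> (- {0}) \<Longrightarrow> linear (\<D> L z)"
  using C2_L by (intro linear_D) auto

lemma linear_D2L: "z \<in> U \<times> (- {0}) \<Longrightarrow> linear (\<D>2 L z v)"
  by (rule C2_linear2[OF C2_L open_TU])

lemma D_square: "z \<in> U \<times> (- {0}) \<Longrightarrow> \<D> L z v = 2 * F z * \<D> F z v"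
proof -
  assume "z \<in> U \<times> (- {0})"
  then have "(F has_derivative \<D> F z) (at z)" by (rule C1_has_derivative[OF C2])
  from has_derivative_power[OF this, of 2]
  have "\<D> L z = (\<lambda>v. of_nat 2 * \<D> F z v * F z ^ (2 - 1))" by (rule D_eqI)
  then show ?thesis by simp
qed

lemma D2_square: "z \<in> U \<times> (- {0}) \<Longrightarrow> \<D>2 L z v w = 2 * \<D> F z v * \<D> F z w + 2 * F z * \<D>2 F z v w"
proof -
  assume z: "z \<in> U \<times> (- {0})"
  have "\<D>2 L z v w = \<D> (\<lambda>z. 2 * F z * \<D> F z w) z v"
    by (rule fun_cong[OF D_cong[OF open_TU z]]) (rule D_square)
  also have "((\<lambda>z. (2 * F z) * \<D> F z w) has_derivative (\<lambda>v. (2 * F z) * \<D>2 F z v w + (2 * \<D> F z v) * \<D> F z w)) (at z)"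
    by (rule has_derivative_mult[OF has_derivative_mult_right[OF C1_has_derivative[OF C2 z]] C1_has_derivative[OF C1 z]])
  from D_eqI[OF this] have "\<D> (\<lambda>z. 2 * F z * \<D> F z w) z v = (2 * F z) * \<D>2 F z v w + (2 * \<D> F z v) * \<D> F z w" by simp
  finally show ?thesis by simp
qed

text \<open>Subtracting from \<open>w\<close> a multiple of \<open>u\<close> does not change the fibre Hessian of \<open>F\<close> and makes the derivative
of \<open>F\<close> vanish; then the Hessian of \<open>F\<^sup>2\<close> is the positive multiple \<open>2 F\<close> of the Hessian of \<open>F\<close>.\<close>

lemma D2_fibre_pos:
  assumes "p \<in> U" "u \<noteq> 0" "\<And>a. w \<noteq> a *\<^sub>R u" shows "\<D>2 F (p, u) (0, w) (0, w) > 0"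
proof -
  have z: "(p, u) \<in> U \<times> (- {0})" using assms by auto
  let ?z = "(p, u)"
  define a where "a = \<D> F ?z (0, w) / F ?z"
  define w' where "w' = w - a *\<^sub>R u"
  have F: "F ?z > 0" using pos assms by auto
  have w': "w' \<noteq> 0" using assms(3)[of a] by (simp add: w'_def)
  have e: "(0, w') = (0, w) - a *\<^sub>R (0, u)" by (simp add: w'_def)
  have "\<D> F ?z (0, w') = 0"
    unfolding e linear_diff[OF linear_Dk[OF z]] linear_scale[OF linear_Dk[OF z]]
    using F euler assms by (simp add: a_def)
  moreover have "\<D>2 F ?z (0, w') (0, w') = \<D>2 F ?z (0, w) (0, w')"
  proof -
    have "\<D>2 F ?z ((0, w) - a *\<^sub>R (0, u)) (0, w') = \<D>2 F ?z (0, w) (0, w')"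
      unfolding linear_diff[OF linear_D2_left[OF z]] linear_scale[OF linear_D2_left[OF z]] D2_fibre_radial[OF assms(1,2)]
      by simp
    then show ?thesis by (simp only: e[symmetric])
  qed
  moreover have "\<D>2 F ?z (0, w) (0, w') = \<D>2 F ?z (0, w) (0, w)"
    unfolding e linear_diff[OF linear_D2_right[OF z]] linear_scale[OF linear_D2_right[OF z]]
    using D2_sym[OF z, of "(0, w)" "(0, u)"] D2_fibre_radial[OF assms(1,2)] by simp
  ultimately show ?thesis using posdef[OF assms(1,2) w'] D2_square[OF z, of "(0, w')" "(0, w')"] F
    by (simp add: zero_less_mult_iff)
qed

section \<open>Geodesics as solutions of the Hamiltonian equations\<close>

text \<open>The Legendre transformation \<open>(x, u) \<mapsto> (x, p)\<close> of \<open>F\<^sup>2\<close>. It is locally invertible since the fibre Hessian of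
\<open>F\<^sup>2\<close> is definite, whereas that of \<open>F\<close> is not.\<close>

definition legendre :: "'e \<times> 'e \<Rightarrow> 'e \<times> 'e" where
  "legendre z = (fst z, \<Sum>b\<in>Basis. \<D> L z (0, b) *\<^sub>R b)"

lemma fst_legendre: "fst (legendre z) = fst z" by (simp add: legendre_def)

lemma snd_legendre: "z \<in> U \<times> (- {0}) \<Longrightarrow> snd (legendre z) \<bullet> y = \<D> L z (0, y)"
  unfolding legendre_def snd_conv by (rule linear_functional_representation[OF linear_fibre[OF linear_DL]])

lemma C1_legendre: "Ck_on (Suc 0) (U \<times> (- {0})) legendre"
  unfolding legendre_def
  by (intro Ck_on_Pair Ck_on_sum Ck_on_compose_linear[OF bounded_linear_scaleR_left C1_L] open_TU Ck_on_linear bounded_linear_fst)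

lemma D_legendre_injective:
  assumes z: "z \<in> U \<times> (- {0})" and 0: "\<D> legendre z v = 0" shows "v = 0"
proof -
  have "(legendre has_derivative (\<lambda>v. (fst v, \<Sum>b\<in>Basis. \<D>2 L z v (0, b) *\<^sub>R b))) (at z)"
    unfolding legendre_def
    by (intro has_derivative_Pair has_derivative_sum has_derivative_scaleR_left C1_has_derivative[OF C1_L z] has_derivative_fst has_derivative_ident)
  then have "fst v = 0" and s: "(\<Sum>b\<in>Basis. \<D>2 L z v (0, b) *\<^sub>R b) = 0"
    using 0 by (auto simp: D_eqI zero_prod_def)
  then have v: "v = (0, snd v)" by (metis prod.collapse)
  have "\<D>2 L z v (0, snd v) = 0"
    using linear_functional_representation[OF linear_fibre[OF linear_D2L[OF z, of v]], of "snd v"] s by simp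
  then have 0: "\<D>2 L z (0, snd v) (0, snd v) = 0" using v by metis
  have "snd v = 0"
  proof (rule ccontr)
    assume "snd v \<noteq> 0"
    with posdef[of "fst z" "snd z" "snd v"] z 0 show False by (simp add: mem_Times_iff)
  qed
  with v show ?thesis by (simp add: zero_prod_def)
qed

lemma local_inverse_legendre:
  assumes "z \<in> U \<times> (- {0})"
  obtains S V \<Psi> where "open S" "S \<subseteq> U \<times> (- {0})" "z \<in> S" "open V" "\<And>x. x \<in> S \<Longrightarrow> legendre x \<in> V \<and> \<Psi> (legendre x) = x"
    "\<And>y. y \<in> V \<Longrightarrow> \<Psi> y \<in> S \<and> legendre (\<Psi> y) = y" "Ck_on (Suc 0) V \<Psi>"
    "\<And>x v. x \<in> S \<Longrightarrow> \<D> \<Psi> (legendre x) (\<D> legendre x v) = v"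
  by (rule C1_local_inverse[OF open_TU C1_legendre assms D_legendre_injective[OF assms]]) blast+

text \<open>The Hamiltonian vector field \<open>x' = u\<close>, \<open>p' = L\<^sub>x\<close>, where \<open>(x, u) = \<Psi> (x, p)\<close>. It is of class \<open>C\<^sup>1\<close>, while in the
variables \<open>(x, u)\<close> the equations of motion have a right hand side that is only continuous.\<close>

definition ham_field :: "('e \<times> 'e \<Rightarrow> 'e \<times> 'e) \<Rightarrow> 'e \<times> 'e \<Rightarrow> 'e \<times> 'e" where
  "ham_field \<Psi> Z = (snd (\<Psi> Z), \<Sum>b\<in>Basis. \<D> L (\<Psi> Z) (b, 0) *\<^sub>R b)"

lemma C1_ham_field:
  assumes "open V" "Ck_on (Suc 0) V \<Psi>" "\<Psi> ` V \<subseteq> U \<times> (- {0})"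
  shows "Ck_on (Suc 0) V (ham_field \<Psi>)"
  unfolding ham_field_def
  by (intro assms Ck_on_Pair Ck_on_sum Ck_on_compose_linear[OF bounded_linear_scaleR_left] Ck_on_compose_linear[OF bounded_linear_snd]
      Ck_on_compose[OF _ C1_L])

lemma snd_ham_field: "\<Psi> Z \<in> U \<times> (- {0}) \<Longrightarrow> snd (ham_field \<Psi> Z) \<bullet> y = \<D> L (\<Psi> Z) (y, 0)"
  unfolding ham_field_def snd_conv by (rule linear_functional_representation[OF linear_base[OF linear_DL]])

text \<open>Along a solution \<open>F\<close> is constant: by homogeneity \<open>p \<bullet> u = 2 L\<close>, and differentiating this with the
equations of motion gives \<open>2 L' = L'\<close>. The momentum of \<open>F\<close> is therefore a constant multiple of \<open>p\<close>, and
the Euler-Lagrange equation of \<open>F\<^sup>2\<close> becomes that of \<open>F\<close>. The factor \<open>\<rho>\<close> only changes the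
parametrization.\<close>

lemma ham_solution_extremal:
  assumes V: "open V" "Ck_on (Suc 0) V \<Psi>" "\<And>y. y \<in> V \<Longrightarrow> \<Psi> y \<in> U \<times> (- {0}) \<and> legendre (\<Psi> y) = y"
    and J: "open J" "is_interval J" and \<rho>: "Ck_on (Suc 0) J \<rho>" "\<And>t. t \<in> J \<Longrightarrow> \<rho> t > 0"
    and Z: "\<And>t. t \<in> J \<Longrightarrow> Z t \<in> V \<and> (Z has_vector_derivative \<rho> t *\<^sub>R ham_field \<Psi> (Z t)) (at t)"
  shows "extremal U F J (\<lambda>t. fst (Z t))"
    and "\<And>t. t \<in> J \<Longrightarrow> vel (\<lambda>t. fst (Z t)) t = \<rho> t *\<^sub>R snd (\<Psi> (Z t))"
    and "\<And>t. t \<in> J \<Longrightarrow> fst (\<Psi> (Z t)) = fst (Z t)"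
proof -
  let ?\<zeta> = "\<lambda>t. \<Psi> (Z t)" and ?x = "\<lambda>t. fst (Z t)" and ?u = "\<lambda>t. snd (\<Psi> (Z t))"
  have \<zeta>: "?\<zeta> t \<in> U \<times> (- {0})" if "t \<in> J" for t using V Z that by blast
  show fst\<zeta>: "fst (?\<zeta> t) = fst (Z t)" if "t \<in> J" for t using V Z that fst_legendre by metis
  have \<zeta>eq: "(?x t, ?u t) = ?\<zeta> t" if "t \<in> J" for t using fst\<zeta>[OF that] by (metis prod.collapse)
  have xU: "?x t \<in> U" "?u t \<noteq> 0" if "t \<in> J" for t using \<zeta>[OF that] fst\<zeta>[OF that] by (auto simp: mem_Times_iff)
  have dx: "(?x has_vector_derivative \<rho> t *\<^sub>R ?u t) (at t)" if "t \<in> J" for t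
    using bounded_linear.has_vector_derivative[OF bounded_linear_fst] Z[OF that] by (fastforce simp: ham_field_def)
  show vx: "vel ?x t = \<rho> t *\<^sub>R ?u t" if "t \<in> J" for t by (rule vector_derivative_at[OF dx[OF that]])
  have ch: "Ck_on (Suc 0) V (ham_field \<Psi>)" by (rule C1_ham_field[OF V(1,2)]) (use V(3) in blast)
  have cZ: "continuous_on J Z" using Z by (intro continuous_at_imp_continuous_on) (blast dest: has_vector_derivative_continuous)
  have CZ: "Ck_on (Suc 0) J Z"
  proof (rule Ck_on_real_SucI[OF J(1)])
    show "Ck_on 0 J (\<lambda>t. \<rho> t *\<^sub>R ham_field \<Psi> (Z t))"
      using Ck_on_continuous[OF \<rho>(1)] continuous_on_compose2[OF Ck_on_continuous[OF ch] cZ] Z by (auto intro!: continuous_intros)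
  qed (use Z in auto)
  have Cu: "Ck_on (Suc 0) J (\<lambda>t. \<rho> t *\<^sub>R ?u t)"
    using Z by (intro Ck_on_scaleR \<rho> J Ck_on_compose_linear[OF bounded_linear_snd] Ck_on_compose[OF CZ V(2)]) auto
  have Cx: "Ck_on (Suc (Suc 0)) J ?x" by (rule Ck_on_real_SucI[OF J(1) dx Cu])
  have energy: "((\<lambda>t. L (?\<zeta> t)) has_vector_derivative 0) (at t)" if t: "t \<in> J" for t
  proof -
    let ?d = "\<D> \<Psi> (Z t) (\<rho> t *\<^sub>R ham_field \<Psi> (Z t))"
    have d\<zeta>: "(?\<zeta> has_vector_derivative ?d) (at t)"
      by (rule C1_has_vector_derivative_compose[OF V(2)]) (use Z t in auto)
    have "((\<lambda>t. fst (?\<zeta> t)) has_vector_derivative fst ?d) (at t)"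
      by (rule bounded_linear.has_vector_derivative[OF bounded_linear_fst d\<zeta>])
    then have "(?x has_vector_derivative fst ?d) (at t)"
      by (rule has_vector_derivative_transform_within_open[OF _ J(1) t]) (rule fst\<zeta>)
    then have fd: "fst ?d = \<rho> t *\<^sub>R ?u t" using vector_derivative_unique_at[OF _ dx[OF t]] by blast
    have du: "(?u has_vector_derivative snd ?d) (at t)"
      by (rule bounded_linear.has_vector_derivative[OF bounded_linear_snd d\<zeta>])
    have dp: "((\<lambda>t. snd (Z t)) has_vector_derivative \<rho> t *\<^sub>R snd (ham_field \<Psi> (Z t))) (at t)"
      using bounded_linear.has_vector_derivative[OF bounded_linear_snd] Z[OF t] by fastforce
    have dL: "((\<lambda>t. L (?\<zeta> t)) has_vector_derivative \<D> L (?\<zeta> t) ?d) (at t)"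
      by (rule C1_has_vector_derivative_compose[OF C2_L \<zeta>[OF t] d\<zeta>])
    have p: "snd (Z s) \<bullet> y = \<D> L (?\<zeta> s) (0, y)" if "s \<in> J" for s y
      using snd_legendre[OF \<zeta>[OF that], of y] V(3) Z that by auto
    have pu: "snd (Z s) \<bullet> ?u s = 2 * L (?\<zeta> s)" if "s \<in> J" for s
      using p[OF that] D_square[OF \<zeta>[OF that]] euler[OF xU[OF that]] by (simp add: \<zeta>eq[OF that] power2_eq_square)
    have dpu: "((\<lambda>t. snd (Z t) \<bullet> ?u t) has_vector_derivative
        snd (Z t) \<bullet> snd ?d + (\<rho> t *\<^sub>R snd (ham_field \<Psi> (Z t))) \<bullet> ?u t) (at t)"
      by (rule bounded_bilinear.has_vector_derivative[OF bounded_bilinear_inner dp du])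
    have "snd (Z t) \<bullet> snd ?d + (\<rho> t *\<^sub>R snd (ham_field \<Psi> (Z t))) \<bullet> ?u t
        = \<D> L (?\<zeta> t) (0, snd ?d) + \<rho> t * \<D> L (?\<zeta> t) (?u t, 0)"
      using p[OF t] snd_ham_field[of \<Psi> "Z t", OF \<zeta>[OF t]] by simp
    also have "\<dots> = \<D> L (?\<zeta> t) ((0, snd ?d) + \<rho> t *\<^sub>R (?u t, 0))"
      by (simp only: linear_add[OF linear_DL[OF \<zeta>[OF t]]] linear_scale[OF linear_DL[OF \<zeta>[OF t]]] real_scaleR_def)
    also have "(0, snd ?d) + \<rho> t *\<^sub>R (?u t, 0) = ?d" using fd by (simp add: prod_eq_iff)
    finally have "((\<lambda>t. snd (Z t) \<bullet> ?u t) has_vector_derivative \<D> L (?\<zeta> t) ?d) (at t)"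
      by (rule has_vector_derivative_eq_rhs[OF dpu])
    then have "((\<lambda>t. 2 * L (?\<zeta> t)) has_vector_derivative \<D> L (?\<zeta> t) ?d) (at t)"
      by (rule has_vector_derivative_transform_within_open[OF _ J(1) t]) (rule pu)
    moreover have "((\<lambda>t. 2 * L (?\<zeta> t)) has_vector_derivative 2 * \<D> L (?\<zeta> t) ?d) (at t)"
      by (rule has_vector_derivative_mult_right[OF dL])
    ultimately have "\<D> L (?\<zeta> t) ?d = 2 * \<D> L (?\<zeta> t) ?d" by (rule vector_derivative_unique_at)
    then show ?thesis using dL by simp
  qed
  have EL: "((\<lambda>s. \<D> F (?x s, vel ?x s) (0, y)) has_vector_derivative \<D> F (?x t, vel ?x t) (y, 0)) (at t)" if t: "t \<in> J" for t y
  proof -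
    define c where "c = F (?\<zeta> t)"
    have Fpos: "F (?\<zeta> s) > 0" if "s \<in> J" for s using pos[OF xU[OF that]] \<zeta>eq[OF that] by simp
    have Lc: "L (?\<zeta> s) = L (?\<zeta> t)" if "s \<in> J" for s
    proof -
      define l where "l = (\<lambda>t. L (?\<zeta> t))"
      have "(l has_vector_derivative 0) (at s within J)" if "s \<in> J" for s
        unfolding l_def by (rule has_vector_derivative_at_within[OF energy[OF that]])
      then obtain c where "\<And>s. s \<in> J \<Longrightarrow> l s = c"
        using has_vector_derivative_zero_constant[OF is_interval_convex[OF J(2)]] by metis
      then have "l s = l t" using that t by simp
      then show ?thesis by (simp add: l_def)
    qed
    have Fc: "F (?\<zeta> s) = c" if "s \<in> J" for s
      using Lc[OF that] Fpos[OF that] Fpos[OF t] unfolding c_def by (simp add: power2_eq_iff_nonneg)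
    have c: "c > 0" using Fpos[OF t] by (simp add: c_def)
    have DLF: "\<D> L (?\<zeta> s) v = 2 * c * \<D> F (?\<zeta> s) v" if "s \<in> J" for s v
      using D_square[OF \<zeta>[OF that]] Fc[OF that] by simp
    have e1: "(snd (Z s) \<bullet> y) / (2 * c) = \<D> F (?x s, vel ?x s) (0, y)" if "s \<in> J" for s
    proof -
      have "\<D> F (?x s, vel ?x s) (0, y) = \<D> F (?\<zeta> s) (0, y)"
        using D_scale_fibre[OF xU[OF that] \<rho>(2)[OF that], of y] by (simp only: vx[OF that] \<zeta>eq[OF that])
      also have "\<dots> = \<D> L (?\<zeta> s) (0, y) / (2 * c)" using DLF[OF that] c by simp
      finally show ?thesis using snd_legendre[OF \<zeta>[OF that], of y] V(3) Z that by auto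
    qed
    have "((\<lambda>s. snd (Z s)) has_vector_derivative \<rho> t *\<^sub>R snd (ham_field \<Psi> (Z t))) (at t)"
      using bounded_linear.has_vector_derivative[OF bounded_linear_snd] Z[OF t] by fastforce
    then have d: "((\<lambda>s. (snd (Z s) \<bullet> y) / (2 * c)) has_vector_derivative (\<rho> t *\<^sub>R snd (ham_field \<Psi> (Z t)) \<bullet> y) / (2 * c)) (at t)"
      by (intro has_vector_derivative_divide bounded_linear.has_vector_derivative[OF bounded_linear_inner_left])
    have "(\<rho> t *\<^sub>R snd (ham_field \<Psi> (Z t)) \<bullet> y) / (2 * c) = \<rho> t * \<D> F (?\<zeta> t) (y, 0)"
      using snd_ham_field[of \<Psi> "Z t", OF \<zeta>[OF t]] DLF[OF t] c by simp
    also have "\<dots> = \<D> F (?x t, vel ?x t) (y, 0)"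
      using D_scale_base[OF xU[OF t] \<rho>(2)[OF t], of y] \<zeta>eq[OF t] vx[OF t] by simp
    finally have "((\<lambda>s. (snd (Z s) \<bullet> y) / (2 * c)) has_vector_derivative \<D> F (?x t, vel ?x t) (y, 0)) (at t)"
      by (rule has_vector_derivative_eq_rhs[OF d])
    then show ?thesis by (rule has_vector_derivative_transform_within_open[OF _ J(1) t]) (rule e1)
  qed
  have "vel ?x t \<noteq> 0" if "t \<in> J" for t
    using vx[OF that] xU(2)[OF that] \<rho>(2)[OF that] by simp
  then show "extremal U F J ?x"
    unfolding extremal_def using J Cx xU(1) EL by blast
qed

lemma extremal_exists:
  assumes "p \<in> U" "u \<noteq> 0"
  obtains \<delta> x where "\<delta> > 0" "extremal U F {-\<delta><..<\<delta>} x" "x 0 = p" "vel x 0 = u"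
proof -
  have z: "(p, u) \<in> U \<times> (- {0})" using assms by auto
  obtain S V \<Psi> where S: "open S" "S \<subseteq> U \<times> (- {0})" "(p, u) \<in> S" "open V"
    "\<And>x. x \<in> S \<Longrightarrow> legendre x \<in> V \<and> \<Psi> (legendre x) = x"
    "\<And>y. y \<in> V \<Longrightarrow> \<Psi> y \<in> S \<and> legendre (\<Psi> y) = y" "Ck_on (Suc 0) V \<Psi>"
    "\<And>x v. x \<in> S \<Longrightarrow> \<D> \<Psi> (legendre x) (\<D> legendre x v) = v"
    using local_inverse_legendre[OF z] by blast
  have "Ck_on (Suc 0) V (ham_field \<Psi>)" by (rule C1_ham_field[OF S(4,7)]) (use S(2,6) in blast)
  moreover have "legendre (p, u) \<in> V" using S by blast
  ultimately obtain \<delta> Z where Z: "\<delta> > 0" "Z 0 = legendre (p, u)"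
    "\<And>t. t \<in> {-\<delta><..<\<delta>} \<Longrightarrow> Z t \<in> V \<and> (Z has_vector_derivative ham_field \<Psi> (Z t)) (at t)"
    using ode_solution[OF S(4)] by metis
  have V: "\<Psi> y \<in> U \<times> (- {0}) \<and> legendre (\<Psi> y) = y" if "y \<in> V" for y using S(2,6) that by blast
  have J: "open {-\<delta><..<\<delta>}" "is_interval {-\<delta><..<\<delta>}" by (auto intro: is_interval_oo)
  have Z': "Z t \<in> V \<and> (Z has_vector_derivative 1 *\<^sub>R ham_field \<Psi> (Z t)) (at t)" if "t \<in> {-\<delta><..<\<delta>}" for t
    using Z(3)[OF that] by simp
  have sol: "extremal U F {-\<delta><..<\<delta>} (\<lambda>t. fst (Z t))"
    "\<And>t. t \<in> {-\<delta><..<\<delta>} \<Longrightarrow> vel (\<lambda>t. fst (Z t)) t = 1 *\<^sub>R snd (\<Psi> (Z t))"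
    using ham_solution_extremal[OF S(4,7) V J Ck_on_const zero_less_one Z'] by blast+
  have 0: "0 \<in> {-\<delta><..<\<delta>}" using Z(1) by simp
  have "\<Psi> (Z 0) = (p, u)" using S(5)[OF S(3)] Z(2) by simp
  then show ?thesis
    using that[OF Z(1) sol(1)] sol(2)[OF 0] Z(2) by (simp add: fst_legendre)
qed

end

section \<open>Jacobi fields and the conservation of the symplectic form\<close>

lemma Ck_on_inverse:
  fixes f :: "'a::euclidean_space \<Rightarrow> real"
  assumes "Ck_on k S f" "open S" "\<And>x. x \<in> S \<Longrightarrow> f x \<noteq> 0"
  shows "Ck_on k S (\<lambda>x. inverse (f x))"
  using assms(1)
proof (induction k)
  case 0 then show ?case using assms(3) by (auto intro!: continuous_intros)
next
  case (Suc k)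
  have h: "((\<lambda>x. inverse (f x)) has_derivative (\<lambda>v. - (inverse (f x) * \<D> f x v * inverse (f x)))) (at x)" if "x \<in> S" for x
    using Suc.prems that assms(3) by (intro Deriv.has_derivative_inverse has_derivative_D) auto
  have "Ck_on k S (\<lambda>x. - (inverse (f x) * \<D> f x v * inverse (f x)))" for v
    using Suc.prems Ck_on_SucD[OF Suc.prems] by (intro Ck_on_minus Ck_on_mult Suc.IH assms(2)) simp_all
  then have "Ck_on k S (\<lambda>x. \<D> (\<lambda>x. inverse (f x)) x v)" for v
    by (subst Ck_on_cong[OF assms(2), where g = "\<lambda>x. - (inverse (f x) * \<D> f x v * inverse (f x))"]) (simp_all add: D_eqI[OF h])
  then show ?case using h by (auto simp: differentiable_def)
qed

lemma variation_field_cong: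
  assumes "variation_field T Zs Z r W" "\<And>t. t \<in> T \<Longrightarrow> Z t = Z' t"
  shows "variation_field T Zs Z' r W"
  using assms unfolding variation_field_def uniform_limit_iff by simp

text \<open>By homogeneity the Euler-Lagrange equation may be evaluated on any positive multiple \<open>u\<close> of the velocity,
at the price of a factor.\<close>

lemma (in homogeneous_lagrangian) extremal_lift:
  assumes "extremal U k J x" and l: "\<And>t. t \<in> J \<Longrightarrow> \<rho> t > 0 \<and> \<zeta> t = (x t, u t) \<and> vel x t = \<rho> t *\<^sub>R u t" and t: "t \<in> J"
  shows "((\<lambda>s. \<D> k (\<zeta> s) (0, y)) has_vector_derivative \<rho> t * \<D> k (\<zeta> t) (y, 0)) (at t)"
proof -
  have J: "open J" and x: "\<And>t. t \<in> J \<Longrightarrow> x t \<in> U \<and> vel x t \<noteq> 0"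
    and EL: "((\<lambda>s. \<D> k (x s, vel x s) (0, y)) has_vector_derivative \<D> k (x t, vel x t) (y, 0)) (at t)"
    using assms(1) t by (auto simp: extremal_def)
  have u: "x s \<in> U" "u s \<noteq> 0" "\<rho> s > 0" if "s \<in> J" for s using x[OF that] l[OF that] by auto
  have "\<D> k (x t, vel x t) (y, 0) = \<rho> t * \<D> k (\<zeta> t) (y, 0)"
    using D_scale_base[OF u[OF t]] l[OF t] by simp
  with EL have "((\<lambda>s. \<D> k (x s, vel x s) (0, y)) has_vector_derivative \<rho> t * \<D> k (\<zeta> t) (y, 0)) (at t)" by simp
  then show ?thesis
  proof (rule has_vector_derivative_transform_within_open[OF _ J t])
    show "\<D> k (x s, vel x s) (0, y) = \<D> k (\<zeta> s) (0, y)" if "s \<in> J" for s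
      using D_scale_fibre[OF u[OF that]] l[OF that] by simp
  qed
qed

context finsler_domain
begin

definition speed :: "(real \<Rightarrow> 'e) \<Rightarrow> real \<Rightarrow> real" where "speed x t = F (x t, vel x t)"

text \<open>Solutions of the Hamiltonian equations have constant \<open>F\<close>, whereas an extremal may be parametrized
arbitrarily. So the velocity is normalized by \<open>F = 1\<close>, and the parametrization is kept in the factor
\<open>speed\<close>.\<close>

definition unit_lift :: "(real \<Rightarrow> 'e) \<Rightarrow> real \<Rightarrow> 'e \<times> 'e" where
  "unit_lift x t = (x t, inverse (speed x t) *\<^sub>R vel x t)"

text \<open>The derivative of the unit lift along a family of extremals, as a pair of a variation of the position and
a variation of the unit velocity. The last clause is the Euler-Lagrange equation of \<open>k\<close>
differentiated with respect to the parameter. It is required for all \<open>k\<close> at once, since the interval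
\<open>J\<close> must not depend on \<open>k\<close>.\<close>

definition jacobi_field :: "(real \<Rightarrow> 'e) \<Rightarrow> real set \<Rightarrow> (real \<Rightarrow> 'e \<times> 'e) \<Rightarrow> bool" where
  "jacobi_field x J V \<longleftrightarrow> (\<forall>t\<in>J. ((\<lambda>s. fst (V s)) has_vector_derivative speed x t *\<^sub>R snd (V t)) (at t) \<and>
     (\<forall>k y. shares_extremals U F k \<longrightarrow>
        ((\<lambda>s. \<D>2 k (unit_lift x s) (V s) (0, y)) has_vector_derivative speed x t * \<D>2 k (unit_lift x t) (V t) (y, 0)) (at t)))"

lemma extremal_speed:
  assumes "extremal U F I x"
  shows "Ck_on (Suc 0) I (speed x)" "Ck_on (Suc 0) I (unit_lift x)"
    "\<And>t. t \<in> I \<Longrightarrow> speed x t > 0"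
    "\<And>t. t \<in> I \<Longrightarrow> unit_lift x t \<in> U \<times> (- {0})"
    "\<And>t. t \<in> I \<Longrightarrow> vel x t = speed x t *\<^sub>R snd (unit_lift x t)"
    "\<And>t. t \<in> I \<Longrightarrow> F (unit_lift x t) = 1"
proof -
  have I: "open I" and C: "Ck_on (Suc (Suc 0)) I x" and x: "\<And>t. t \<in> I \<Longrightarrow> x t \<in> U \<and> vel x t \<noteq> 0"
    using assms by (auto simp: extremal_def)
  have Cv: "Ck_on (Suc 0) I (vel x)" by (rule Ck_on_real_SucD(2)[OF I C])
  have C1: "Ck_on (Suc 0) I x" by (rule Ck_on_SucD[OF C])
  show \<rho>: "speed x t > 0" if "t \<in> I" for t using x[OF that] pos by (simp add: speed_def)
  have "Ck_on (Suc 0) I (\<lambda>t. F (x t, vel x t))"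
    by (rule Ck_on_compose[OF Ck_on_Pair[OF C1 Cv I] Ck_on_SucD[OF C2] _ I]) (use x in auto)
  then show C\<rho>: "Ck_on (Suc 0) I (speed x)" unfolding speed_def[abs_def] .
  show "Ck_on (Suc 0) I (unit_lift x)" unfolding unit_lift_def[abs_def]
    by (intro Ck_on_Pair C1 Ck_on_scaleR Ck_on_inverse C\<rho> Cv I) (use \<rho> in fastforce)
  show "unit_lift x t \<in> U \<times> (- {0})" if "t \<in> I" for t
    using x[OF that] \<rho>[OF that] by (simp add: unit_lift_def)
  show "vel x t = speed x t *\<^sub>R snd (unit_lift x t)" if "t \<in> I" for t
    using \<rho>[OF that] by (simp add: unit_lift_def)
  show "F (unit_lift x t) = 1" if "t \<in> I" for t
    using x[OF that] \<rho>[OF that] hom[of "x t" "vel x t" "inverse (speed x t)"]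
    by (simp add: unit_lift_def) (simp add: speed_def)
qed

lemma shares_extremals_self: "shares_extremals U F F"
  unfolding shares_extremals_def by (simp add: homogeneous_lagrangian_axioms)

lemma extremal_unit_lift:
  assumes "extremal U F I x" "shares_extremals U F k" "t \<in> I"
  shows "((\<lambda>s. \<D> k (unit_lift x s) (0, y)) has_vector_derivative speed x t * \<D> k (unit_lift x t) (y, 0)) (at t)"
proof -
  interpret k: homogeneous_lagrangian U k using assms(2) by (simp add: shares_extremals_def)
  show ?thesis
  proof (rule k.extremal_lift[OF _ _ assms(3), where x=x and u="\<lambda>t. snd (unit_lift x t)"])
    show "extremal U k I x" using assms(1,2) by (simp add: shares_extremals_def)
    show "0 < speed x t \<and> unit_lift x t = (x t, snd (unit_lift x t)) \<and> vel x t = speed x t *\<^sub>R snd (unit_lift x t)"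
      if "t \<in> I" for t
      using extremal_speed(3,5)[OF assms(1) that] by (simp add: unit_lift_def)
  qed
qed

text \<open>The Legendre transform of the unit lift solves the Hamiltonian equations with the speed as factor
\<open>\<rho>\<close>. The neighbouring solutions provided by \<open>flow_linearisation\<close> are extremals of \<open>F\<close>, hence of every
\<open>k\<close> that shares the extremals of \<open>F\<close>, and the Euler-Lagrange equations of \<open>k\<close> can be differentiated along them.\<close>

lemma jacobi_fields_exist:
  assumes ext: "extremal U F I x" and t0: "t0 \<in> I"
  obtains \<delta> where "\<delta> > 0" "{t0-\<delta><..<t0+\<delta>} \<subseteq> I"
    "\<And>t1 v. t1 \<in> {t0-\<delta><..<t0+\<delta>} \<Longrightarrow> \<exists>V. V t1 = v \<and> jacobi_field x {t0-\<delta><..<t0+\<delta>} V"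
proof -
  let ?\<rho> = "speed x" and ?\<zeta> = "unit_lift x"
  have I: "open I" and Cx: "Ck_on (Suc (Suc 0)) I x" using ext by (auto simp: extremal_def)
  note sp = extremal_speed[OF ext]
  obtain S V0 \<Psi> where S: "open S" "S \<subseteq> U \<times> (- {0})" "?\<zeta> t0 \<in> S" "open V0"
    "\<And>x. x \<in> S \<Longrightarrow> legendre x \<in> V0 \<and> \<Psi> (legendre x) = x"
    "\<And>y. y \<in> V0 \<Longrightarrow> \<Psi> y \<in> S \<and> legendre (\<Psi> y) = y" "Ck_on (Suc 0) V0 \<Psi>"
    "\<And>x v. x \<in> S \<Longrightarrow> \<D> \<Psi> (legendre x) (\<D> legendre x v) = v"
    using local_inverse_legendre[OF sp(4)[OF t0]] by blast
  have \<Psi>: "\<Psi> y \<in> U \<times> (- {0}) \<and> legendre (\<Psi> y) = y" if "y \<in> V0" for y using S(2,6) that by blast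
  have c\<zeta>: "continuous_on I ?\<zeta>" by (rule Ck_on_continuous[OF sp(2)])
  define I' where "I' = I \<inter> ?\<zeta> -` S"
  have I': "open I'" "t0 \<in> I'" "I' \<subseteq> I"
    using continuous_open_preimage[OF c\<zeta> I S(1)] t0 S(3) by (auto simp: I'_def)
  define Z where "Z = (\<lambda>t. legendre (?\<zeta> t))"
  have \<zeta>S: "?\<zeta> t \<in> S" if "t \<in> I'" for t using that by (simp add: I'_def)
  have ZV: "Z t \<in> V0" "\<Psi> (Z t) = ?\<zeta> t" if "t \<in> I'" for t using S(5)[OF \<zeta>S[OF that]] by (simp_all add: Z_def)
  have dZ: "(Z has_vector_derivative ?\<rho> t *\<^sub>R ham_field \<Psi> (Z t)) (at t)" if t: "t \<in> I'" for t
  proof -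
    have tI: "t \<in> I" using t I' by blast
    have DLF: "\<D> L (?\<zeta> s) v = 2 * \<D> F (?\<zeta> s) v" if "s \<in> I" for s v
      using D_square[OF sp(4)[OF that]] sp(6)[OF that] by simp
    have "((\<lambda>s. \<D> L (?\<zeta> s) (0, b)) has_vector_derivative ?\<rho> t * \<D> L (?\<zeta> t) (b, 0)) (at t)" for b
    proof -
      have "((\<lambda>s. 2 * \<D> F (?\<zeta> s) (0, b)) has_vector_derivative 2 * (?\<rho> t * \<D> F (?\<zeta> t) (b, 0))) (at t)"
        by (rule has_vector_derivative_mult_right[OF extremal_unit_lift[OF ext shares_extremals_self tI]])
      then have "((\<lambda>s. \<D> L (?\<zeta> s) (0, b)) has_vector_derivative 2 * (?\<rho> t * \<D> F (?\<zeta> t) (b, 0))) (at t)"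
        by (rule has_vector_derivative_transform_within_open[OF _ I tI]) (simp add: DLF)
      then show ?thesis using DLF[OF tI] by (simp add: algebra_simps)
    qed
    then have "((\<lambda>s. \<Sum>b\<in>Basis. \<D> L (?\<zeta> s) (0, b) *\<^sub>R b) has_vector_derivative
        (\<Sum>b\<in>Basis. (?\<rho> t * \<D> L (?\<zeta> t) (b, 0)) *\<^sub>R b)) (at t)"
      by (intro has_vector_derivative_sum bounded_linear.has_vector_derivative[OF bounded_linear_scaleR_left])
    moreover have "(x has_vector_derivative ?\<rho> t *\<^sub>R snd (?\<zeta> t)) (at t)"
      using Ck_on_real_SucD(1)[OF I Cx tI] sp(5)[OF tI] by simp
    ultimately have "((\<lambda>s. (x s, \<Sum>b\<in>Basis. \<D> L (?\<zeta> s) (0, b) *\<^sub>R b)) has_vector_derivative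
        (?\<rho> t *\<^sub>R snd (?\<zeta> t), \<Sum>b\<in>Basis. (?\<rho> t * \<D> L (?\<zeta> t) (b, 0)) *\<^sub>R b)) (at t)"
      by (intro has_vector_derivative_Pair)
    moreover have "Z = (\<lambda>s. (x s, \<Sum>b\<in>Basis. \<D> L (?\<zeta> s) (0, b) *\<^sub>R b))"
      by (simp add: Z_def legendre_def unit_lift_def fun_eq_iff)
    moreover have "?\<rho> t *\<^sub>R ham_field \<Psi> (Z t) = (?\<rho> t *\<^sub>R snd (?\<zeta> t), \<Sum>b\<in>Basis. (?\<rho> t * \<D> L (?\<zeta> t) (b, 0)) *\<^sub>R b)"
      unfolding ham_field_def ZV(2)[OF t] by (simp add: scaleR_sum_right)
    ultimately show ?thesis by (simp only:)
  qed
  have Ch: "Ck_on (Suc 0) V0 (ham_field \<Psi>)" by (rule C1_ham_field[OF S(4,7)]) (use \<Psi> in blast)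
  have c\<rho>: "continuous_on I' ?\<rho>" by (rule continuous_on_subset[OF Ck_on_continuous[OF sp(1)] I'(3)])
  have flow: "\<exists>\<delta>>0. {t0-\<delta>..t0+\<delta>} \<subseteq> I' \<and>
    (\<forall>t1 \<zeta>. t1 \<in> {t0-\<delta>..t0+\<delta>} \<longrightarrow> (\<exists>W Zs r. W t1 = \<zeta> \<and> variation_field {t0-\<delta>..t0+\<delta>} Zs Z r W \<and>
       (\<forall>n. \<forall>t\<in>{t0-\<delta><..<t0+\<delta>}. Zs n t \<in> V0 \<and> (Zs n has_vector_derivative ?\<rho> t *\<^sub>R ham_field \<Psi> (Zs n t)) (at t))))"
    by (rule flow_linearisation[OF S(4) Ch I'(1,2) c\<rho> dZ ZV(1)]) blast+
  then obtain \<delta> where \<delta>: "\<delta> > 0" "{t0-\<delta>..t0+\<delta>} \<subseteq> I'"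
    "\<And>t1 \<zeta>. t1 \<in> {t0-\<delta>..t0+\<delta>} \<Longrightarrow> \<exists>W Zs r. W t1 = \<zeta> \<and> variation_field {t0-\<delta>..t0+\<delta>} Zs Z r W \<and>
       (\<forall>n. \<forall>t\<in>{t0-\<delta><..<t0+\<delta>}. Zs n t \<in> V0 \<and> (Zs n has_vector_derivative ?\<rho> t *\<^sub>R ham_field \<Psi> (Zs n t)) (at t))"
    by blast
  let ?T = "{t0-\<delta>..t0+\<delta>}" and ?J = "{t0-\<delta><..<t0+\<delta>}"
  have J: "open ?J" "is_interval ?J" "?J \<subseteq> ?T" by (auto intro: is_interval_oo)
  have TI: "?T \<subseteq> I" "?J \<subseteq> I" using \<delta>(2) I'(3) J(3) by blast+
  have \<rho>J: "Ck_on (Suc 0) ?J ?\<rho>" "\<And>t. t \<in> ?J \<Longrightarrow> ?\<rho> t > 0"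
    using Ck_on_subset[OF sp(1) TI(2)] sp(3) TI(2) by blast+
  have c\<rho>T: "continuous_on ?T ?\<rho>" by (rule continuous_on_subset[OF c\<rho> \<delta>(2)])
  have c\<zeta>T: "continuous_on ?T ?\<zeta>" by (rule continuous_on_subset[OF c\<zeta> TI(1)])
  have \<zeta>T: "?\<zeta> ` ?T \<subseteq> U \<times> (- {0})" using sp(4) TI(1) by blast
  have cZT: "continuous_on ?T Z"
    using dZ \<delta>(2) by (intro continuous_at_imp_continuous_on) (blast dest: has_vector_derivative_continuous)
  have ZT: "Z ` ?T \<subseteq> V0" using ZV(1) \<delta>(2) by blast
  show ?thesis
  proof (rule that[OF \<delta>(1) TI(2)])
    fix t1 v assume t1: "t1 \<in> ?J"
    then have t1T: "t1 \<in> ?T" and t1I: "t1 \<in> I'" using J(3) \<delta>(2) by blast+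
    obtain W Zs r where W: "W t1 = \<D> legendre (?\<zeta> t1) v" and vZ: "variation_field ?T Zs Z r W"
      and Zs: "\<And>n t. t \<in> ?J \<Longrightarrow> Zs n t \<in> V0 \<and> (Zs n has_vector_derivative ?\<rho> t *\<^sub>R ham_field \<Psi> (Zs n t)) (at t)"
      using \<delta>(3)[OF t1T] by metis
    define V where "V = (\<lambda>t. \<D> \<Psi> (Z t) (W t))"
    have "V t1 = v" using S(8)[OF \<zeta>S[OF t1I]] by (simp add: V_def W Z_def)
    moreover have v\<zeta>: "variation_field ?T (\<lambda>n t. \<Psi> (Zs n t)) ?\<zeta> r V"
      unfolding V_def
      by (rule variation_field_cong[OF variation_field_compose[OF S(4,7) compact_Icc cZT ZT vZ]])
         (use ZV(2) \<delta>(2) in blast)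
    have xs: "extremal U F ?J (\<lambda>t. fst (Zs n t))" for n
      by (rule ham_solution_extremal(1)[OF S(4,7) \<Psi> J(1,2) \<rho>J Zs])
    have vs: "vel (\<lambda>t. fst (Zs n t)) t = ?\<rho> t *\<^sub>R snd (\<Psi> (Zs n t))" if "t \<in> ?J" for n t
      by (rule ham_solution_extremal(2)[OF S(4,7) \<Psi> J(1,2) \<rho>J Zs that])
    have fs: "fst (\<Psi> (Zs n t)) = fst (Zs n t)" if "t \<in> ?J" for n t
      by (rule ham_solution_extremal(3)[OF S(4,7) \<Psi> J(1,2) \<rho>J Zs that])
    have "jacobi_field x ?J V"
      unfolding jacobi_field_def
    proof (intro ballI conjI allI impI)
      fix t assume t: "t \<in> ?J"
      have vx: "variation_field ?T (\<lambda>n t. fst (\<Psi> (Zs n t))) (\<lambda>t. fst (?\<zeta> t)) r (\<lambda>t. fst (V t))"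
        using variation_field_compose[OF open_TU Ck_on_linear[OF bounded_linear_fst, of "Suc 0"] compact_Icc c\<zeta>T \<zeta>T v\<zeta>]
        by (simp add: D_eqI[OF bounded_linear_imp_has_derivative[OF bounded_linear_fst]])
      have vu: "variation_field ?T (\<lambda>n t. snd (\<Psi> (Zs n t))) (\<lambda>t. snd (?\<zeta> t)) r (\<lambda>t. snd (V t))"
        using variation_field_compose[OF open_TU Ck_on_linear[OF bounded_linear_snd, of "Suc 0"] compact_Icc c\<zeta>T \<zeta>T v\<zeta>]
        by (simp add: D_eqI[OF bounded_linear_imp_has_derivative[OF bounded_linear_snd]])
      show "((\<lambda>s. fst (V s)) has_vector_derivative ?\<rho> t *\<^sub>R snd (V t)) (at t)"
      proof (rule variation_field_derivative[OF vx vu compact_Icc c\<rho>T J _ _ t])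
        fix s assume s: "s \<in> ?J"
        then have sI: "s \<in> I" using TI by blast
        show "((\<lambda>t. fst (?\<zeta> t)) has_vector_derivative ?\<rho> s *\<^sub>R snd (?\<zeta> s)) (at s)"
          unfolding sp(5)[OF sI, symmetric] using Ck_on_real_SucD(1)[OF I Cx sI] by (simp add: unit_lift_def)
        fix n
        have "((\<lambda>t. fst (Zs n t)) has_vector_derivative ?\<rho> s *\<^sub>R snd (\<Psi> (Zs n s))) (at s)"
          using bounded_linear.has_vector_derivative[OF bounded_linear_fst, of "Zs n"] Zs[OF s, of n] by (fastforce simp: ham_field_def)
        then show "((\<lambda>t. fst (\<Psi> (Zs n t))) has_vector_derivative ?\<rho> s *\<^sub>R snd (\<Psi> (Zs n s))) (at s)"
          by (rule has_vector_derivative_transform_within_open[OF _ J(1) s]) (rule fs[symmetric])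
      qed
      fix k y assume k: "shares_extremals U F k"
      then interpret k: homogeneous_lagrangian U k by (simp add: shares_extremals_def)
      show "((\<lambda>s. \<D>2 k (?\<zeta> s) (V s) (0, y)) has_vector_derivative ?\<rho> t * \<D>2 k (?\<zeta> t) (V t) (y, 0)) (at t)"
        unfolding real_scaleR_def[symmetric]
      proof (rule variation_field_derivative[OF
            variation_field_compose[OF open_TU k.C1[of "(0, y)"] compact_Icc c\<zeta>T \<zeta>T v\<zeta>]
            variation_field_compose[OF open_TU k.C1[of "(y, 0)"] compact_Icc c\<zeta>T \<zeta>T v\<zeta>] compact_Icc c\<rho>T J _ _ t])
        fix s assume s: "s \<in> ?J"
        then have sI: "s \<in> I" using TI by blast
        show "((\<lambda>t. \<D> k (?\<zeta> t) (0, y)) has_vector_derivative ?\<rho> s *\<^sub>R \<D> k (?\<zeta> s) (y, 0)) (at s)"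
          using extremal_unit_lift[OF ext k sI] by simp
        fix n
        have "extremal U k ?J (\<lambda>t. fst (Zs n t))" using xs k by (simp add: shares_extremals_def)
        then have "((\<lambda>s. \<D> k (\<Psi> (Zs n s)) (0, y)) has_vector_derivative ?\<rho> s * \<D> k (\<Psi> (Zs n s)) (y, 0)) (at s)"
        proof (rule k.extremal_lift[where u="\<lambda>t. snd (\<Psi> (Zs n t))", OF _ _ s])
          show "0 < ?\<rho> t \<and> \<Psi> (Zs n t) = (fst (Zs n t), snd (\<Psi> (Zs n t))) \<and>
              vel (\<lambda>t. fst (Zs n t)) t = ?\<rho> t *\<^sub>R snd (\<Psi> (Zs n t))" if "t \<in> ?J" for t
            using vs[OF that] fs[OF that] \<rho>J(2)[OF that] by (metis prod.collapse)
        qed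
        then show "((\<lambda>t. \<D> k (\<Psi> (Zs n t)) (0, y)) has_vector_derivative ?\<rho> s *\<^sub>R \<D> k (\<Psi> (Zs n s)) (y, 0)) (at s)"
          by simp
      qed
    qed
    ultimately show "\<exists>V. V t1 = v \<and> jacobi_field x ?J V" by blast
  qed
qed

text \<open>The 2-form \<open>d(k\<^sub>u dx)\<close> on two Jacobi fields. By the linearised equations its time derivative is the speed
times \<open>D\<^sup>2k(V1, V2) - D\<^sup>2k(V2, V1)\<close>, which is zero.\<close>

lemma symplectic_form_conserved:
  assumes ext: "extremal U F I x" and J: "open J" "is_interval J" "J \<subseteq> I" and k: "shares_extremals U F k"
    and V: "jacobi_field x J V1" "jacobi_field x J V2" and t: "t \<in> J" "t1 \<in> J"
  shows "\<D>2 k (unit_lift x t) (V1 t) (0, fst (V2 t)) - \<D>2 k (unit_lift x t) (V2 t) (0, fst (V1 t)) =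
    \<D>2 k (unit_lift x t1) (V1 t1) (0, fst (V2 t1)) - \<D>2 k (unit_lift x t1) (V2 t1) (0, fst (V1 t1))"
proof -
  let ?\<rho> = "speed x" and ?\<zeta> = "unit_lift x"
  interpret k: homogeneous_lagrangian U k using k by (simp add: shares_extremals_def)
  have \<zeta>: "?\<zeta> s \<in> U \<times> (- {0})" if "s \<in> J" for s using extremal_speed(4)[OF ext] J(3) that by blast
  have expand: "\<D>2 k (?\<zeta> s) V (0, w) = (\<Sum>b\<in>Basis. (w \<bullet> b) * \<D>2 k (?\<zeta> s) V (0, b))" if "s \<in> J" for s V w
  proof -
    have l: "linear (\<lambda>w. \<D>2 k (?\<zeta> s) V (0, w))" by (rule linear_fibre[OF k.linear_D2_right[OF \<zeta>[OF that]]])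
    show ?thesis using linear_functional_representation[OF l, of w] by (simp add: sum_inner_basis)
  qed
  have expand': "\<D>2 k (?\<zeta> s) V (w, 0) = (\<Sum>b\<in>Basis. (w \<bullet> b) * \<D>2 k (?\<zeta> s) V (b, 0))" if "s \<in> J" for s V w
  proof -
    have l: "linear (\<lambda>w. \<D>2 k (?\<zeta> s) V (w, 0))" by (rule linear_base[OF k.linear_D2_right[OF \<zeta>[OF that]]])
    show ?thesis using linear_functional_representation[OF l, of w] by (simp add: sum_inner_basis)
  qed
  have half: "((\<lambda>s. \<D>2 k (?\<zeta> s) (V s) (0, fst (V' s))) has_vector_derivative ?\<rho> s * \<D>2 k (?\<zeta> s) (V s) (V' s)) (at s)"
    if s: "s \<in> J" and V: "jacobi_field x J V" "jacobi_field x J V'" for s V V'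
  proof -
    have d1: "((\<lambda>s. \<D>2 k (?\<zeta> s) (V s) (0, b)) has_vector_derivative ?\<rho> s * \<D>2 k (?\<zeta> s) (V s) (b, 0)) (at s)" for b
      using V(1) s k unfolding jacobi_field_def by blast
    have "((\<lambda>s. fst (V' s)) has_vector_derivative ?\<rho> s *\<^sub>R snd (V' s)) (at s)"
      using V(2) s unfolding jacobi_field_def by blast
    then have d2: "((\<lambda>s. fst (V' s) \<bullet> b) has_vector_derivative (?\<rho> s *\<^sub>R snd (V' s)) \<bullet> b) (at s)" for b
      by (rule bounded_linear.has_vector_derivative[OF bounded_linear_inner_left])
    have "((\<lambda>s. \<Sum>b\<in>Basis. (fst (V' s) \<bullet> b) * \<D>2 k (?\<zeta> s) (V s) (0, b)) has_vector_derivative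
        (\<Sum>b\<in>Basis. (fst (V' s) \<bullet> b) * (?\<rho> s * \<D>2 k (?\<zeta> s) (V s) (b, 0)) + ((?\<rho> s *\<^sub>R snd (V' s)) \<bullet> b) * \<D>2 k (?\<zeta> s) (V s) (0, b))) (at s)"
      by (intro has_vector_derivative_sum has_vector_derivative_mult d1 d2)
    then have "((\<lambda>s. \<D>2 k (?\<zeta> s) (V s) (0, fst (V' s))) has_vector_derivative
        (\<Sum>b\<in>Basis. (fst (V' s) \<bullet> b) * (?\<rho> s * \<D>2 k (?\<zeta> s) (V s) (b, 0)) + ((?\<rho> s *\<^sub>R snd (V' s)) \<bullet> b) * \<D>2 k (?\<zeta> s) (V s) (0, b))) (at s)"
      by (rule has_vector_derivative_transform_within_open[OF _ J(1) s]) (rule expand[symmetric])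
    moreover have "(\<Sum>b\<in>Basis. (fst (V' s) \<bullet> b) * (?\<rho> s * \<D>2 k (?\<zeta> s) (V s) (b, 0)) + ((?\<rho> s *\<^sub>R snd (V' s)) \<bullet> b) * \<D>2 k (?\<zeta> s) (V s) (0, b))
        = ?\<rho> s * (\<D>2 k (?\<zeta> s) (V s) (fst (V' s), 0) + \<D>2 k (?\<zeta> s) (V s) (0, snd (V' s)))"
      unfolding expand[OF s, where w = "snd (V' s)"] expand'[OF s, where w = "fst (V' s)"]
      by (simp add: sum.distrib sum_distrib_left distrib_left mult.assoc mult.left_commute)
    moreover have "\<D>2 k (?\<zeta> s) (V s) (fst (V' s), 0) + \<D>2 k (?\<zeta> s) (V s) (0, snd (V' s)) = \<D>2 k (?\<zeta> s) (V s) (V' s)"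
      using k.D2_split_right[OF \<zeta>[OF s], where w = "V s" and x = "fst (V' s)" and y = "snd (V' s)"] by simp
    ultimately show ?thesis by (simp only:)
  qed
  define \<omega> where "\<omega> = (\<lambda>s. \<D>2 k (?\<zeta> s) (V1 s) (0, fst (V2 s)) - \<D>2 k (?\<zeta> s) (V2 s) (0, fst (V1 s)))"
  have "(\<omega> has_vector_derivative 0) (at s within J)" if s: "s \<in> J" for s
  proof -
    have "(\<omega> has_vector_derivative ?\<rho> s * \<D>2 k (?\<zeta> s) (V1 s) (V2 s) - ?\<rho> s * \<D>2 k (?\<zeta> s) (V2 s) (V1 s)) (at s)"
      unfolding \<omega>_def by (rule has_vector_derivative_diff[OF half[OF s V] half[OF s V(2,1)]])
    moreover have "?\<rho> s * \<D>2 k (?\<zeta> s) (V1 s) (V2 s) - ?\<rho> s * \<D>2 k (?\<zeta> s) (V2 s) (V1 s) = 0"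
      using k.D2_sym[OF \<zeta>[OF s], of "V1 s" "V2 s"] by simp
    ultimately have "(\<omega> has_vector_derivative 0) (at s)" by (simp only:)
    then show ?thesis by (rule has_vector_derivative_at_within)
  qed
  then obtain c where "\<And>s. s \<in> J \<Longrightarrow> \<omega> s = c"
    using has_vector_derivative_zero_constant[OF is_interval_convex[OF J(2)]] by metis
  then have "\<omega> t = \<omega> t1" using t by simp
  then show ?thesis by (simp add: \<omega>_def)
qed

text \<open>A vector \<open>w\<close> in the kernel at time \<open>t1\<close> is extended to the Jacobi field \<open>V1\<close> with value \<open>(0, w)\<close> there. The
2-form of \<open>k\<close> vanishes on \<open>V1\<close> and any other field at \<open>t1\<close>, hence at \<open>t\<close>. If the position component of
\<open>V1 t\<close> is not parallel to \<open>u\<close>, it lies in the kernel of the fibre Hessian at \<open>t\<close>. Otherwise subtract a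
multiple of the tangent vector of the lifted curve, which is in the kernel of the form as well; what
remains is vertical and in the kernel of the Hessian. It cannot be radial: then the 2-form of \<open>F\<close> would
vanish on \<open>V1\<close> and every field, at \<open>t\<close> and so at \<open>t1\<close>, against the convexity of \<open>F\<close>.\<close>

theorem degeneracy_transported:
  assumes ext: "extremal U F I x" and t0: "t0 \<in> I"
  obtains \<delta> where "\<delta> > 0" "{t0-\<delta><..<t0+\<delta>} \<subseteq> I"
    "\<And>k t t1. shares_extremals U F k \<Longrightarrow> t \<in> {t0-\<delta><..<t0+\<delta>} \<Longrightarrow> t1 \<in> {t0-\<delta><..<t0+\<delta>} \<Longrightarrow>
       degenerate k (x t1, vel x t1) \<Longrightarrow> degenerate k (x t, vel x t)"
proof -
  obtain \<delta> where \<delta>: "\<delta> > 0" "{t0-\<delta><..<t0+\<delta>} \<subseteq> I"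
    "\<And>t1 v. t1 \<in> {t0-\<delta><..<t0+\<delta>} \<Longrightarrow> \<exists>V. V t1 = v \<and> jacobi_field x {t0-\<delta><..<t0+\<delta>} V"
    using jacobi_fields_exist[OF ext t0] by metis
  let ?J = "{t0-\<delta><..<t0+\<delta>}" and ?\<rho> = "speed x" and ?\<zeta> = "unit_lift x"
  have J: "open ?J" "is_interval ?J" by (auto intro: is_interval_oo)
  have I: "open I" using ext by (simp add: extremal_def)
  note sp = extremal_speed[OF ext]
  show ?thesis
  proof (rule that[OF \<delta>(1,2)])
    fix k t t1 assume k: "shares_extremals U F k" and t: "t \<in> ?J" and t1: "t1 \<in> ?J" and deg: "degenerate k (x t1, vel x t1)"
    interpret k: homogeneous_lagrangian U k using k by (simp add: shares_extremals_def)
    have tI: "t \<in> I" "t1 \<in> I" using t t1 \<delta>(2) by blast+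
    have deg_iff: "degenerate k (x s, vel x s) \<longleftrightarrow> degenerate k (?\<zeta> s)" if "s \<in> I" for s
    proof -
      have e: "(x s, snd (?\<zeta> s)) = ?\<zeta> s" by (simp add: unit_lift_def)
      have "x s \<in> U" "snd (?\<zeta> s) \<noteq> 0" using sp(4)[OF that] by (simp_all add: mem_Times_iff unit_lift_def)
      from k.degenerate_scale[OF this sp(3)[OF that]] show ?thesis by (simp only: e sp(5)[OF that, symmetric])
    qed
    define u where "u = snd (?\<zeta> t)"
    have \<zeta>t: "?\<zeta> t = (x t, u)" by (simp add: u_def unit_lift_def)
    have xu: "x t \<in> U" "u \<noteq> 0" using sp(4)[OF tI(1)] by (auto simp: \<zeta>t)
    obtain w where w: "\<And>a. w \<noteq> a *\<^sub>R snd (?\<zeta> t1)" "\<And>y. \<D>2 k (?\<zeta> t1) (0, w) (0, y) = 0"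
      using deg deg_iff[OF tI(2)] by (auto simp: degenerate_def)
    \<comment> \<open>A vertical vector in the kernel of the fibre Hessian is in the kernel of the 2-form.\<close>
    obtain V1 where V1: "V1 t1 = (0, w)" "jacobi_field x ?J V1" using \<delta>(3)[OF t1] by blast
    have form: "\<D>2 k' (?\<zeta> t) (V1 t) (0, fst b) - \<D>2 k' (?\<zeta> t) b (0, fst (V1 t)) = \<D>2 k' (?\<zeta> t1) (0, w) (0, fst b1)"
      if "shares_extremals U F k'" "jacobi_field x ?J V2" "V2 t = b" "V2 t1 = b1" for k' V2 b b1
    proof -
      interpret k': homogeneous_lagrangian U k' using that(1) by (simp add: shares_extremals_def)
      have "\<D>2 k' (?\<zeta> t1) b1 (0, 0) = 0"
        using linear_0[OF k'.linear_D2_right[OF sp(4)[OF tI(2)]]] by (simp add: zero_prod_def)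
      then show ?thesis
        using symplectic_form_conserved[OF ext J \<delta>(2) that(1) V1(2) that(2) t t1] that V1(1) by simp
    qed
    have star: "\<D>2 k (?\<zeta> t) (V1 t) (0, fst b) = \<D>2 k (?\<zeta> t) b (0, fst (V1 t))" for b
    proof -
      obtain V2 where "V2 t = b" "jacobi_field x ?J V2" using \<delta>(3)[OF t] by blast
      from form[OF k this(2,1)] show ?thesis using w(2) by simp
    qed
    define a where "a = fst (V1 t)"
    define v where "v = snd (V1 t)"
    have V1t: "V1 t = (a, v)" by (simp add: a_def v_def)
    have z: "(x t, u) \<in> U \<times> (- {0})" using xu by simp
    have "degenerate k (?\<zeta> t)"
    proof (cases "\<exists>\<alpha>. a = \<alpha> *\<^sub>R u")
      case False
      have "\<D>2 k (?\<zeta> t) (0, a) (0, y) = 0" for y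
      proof -
        have "\<D>2 k (?\<zeta> t) (0, y) (0, a) = \<D>2 k (?\<zeta> t) (V1 t) (0, 0)" using star[of "(0, y)"] by (simp add: a_def)
        also have "\<dots> = 0" using linear_0[OF k.linear_D2_right[OF sp(4)[OF tI(1)]]] by (simp add: zero_prod_def)
        finally show ?thesis using k.D2_sym[OF sp(4)[OF tI(1)]] by simp
      qed
      with False show ?thesis unfolding degenerate_def by (auto simp: u_def)
    next
      case True
      then obtain \<alpha> where \<alpha>: "a = \<alpha> *\<^sub>R u" by blast
      obtain v' where d\<zeta>: "(?\<zeta> has_vector_derivative (?\<rho> t *\<^sub>R u, v')) (at t)"
      proof -
        have d: "(?\<zeta> has_vector_derivative vel ?\<zeta> t) (at t)" by (rule Ck_on_real_SucD(1)[OF I sp(2) tI(1)])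
        have "(x has_vector_derivative fst (vel ?\<zeta> t)) (at t)"
          using bounded_linear.has_vector_derivative[OF bounded_linear_fst d] by (simp add: unit_lift_def)
        then have "fst (vel ?\<zeta> t) = ?\<rho> t *\<^sub>R u"
          using sp(5)[OF tI(1)] by (simp add: u_def vector_derivative_at)
        with d have "(?\<zeta> has_vector_derivative (?\<rho> t *\<^sub>R u, snd (vel ?\<zeta> t))) (at t)" by (metis prod.collapse)
        then show ?thesis by (rule that)
      qed
      have EL: "\<D>2 k' (?\<zeta> t) (?\<rho> t *\<^sub>R u, v') (0, y) = ?\<rho> t * \<D> k' (?\<zeta> t) (y, 0)" if "shares_extremals U F k'" for k' y
      proof -
        interpret k': homogeneous_lagrangian U k' using that by (simp add: shares_extremals_def)
        show ?thesis
          by (rule vector_derivative_unique_at[OF C1_has_vector_derivative_compose[OF k'.C1 sp(4)[OF tI(1)] d\<zeta>]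
                extremal_unit_lift[OF ext that tI(1)]])
      qed
      have \<rho>: "?\<rho> t > 0" by (rule sp(3)[OF tI(1)])
      \<comment> \<open>The tangent vector of the lifted curve is \<open>(\<rho> u, v')\<close>; with this factor it has the same position component as \<open>V1 t\<close>.\<close>
      define \<beta> where "\<beta> = \<alpha> / ?\<rho> t"
      define w' where "w' = v - \<beta> *\<^sub>R v'"
      have split: "V1 t = \<beta> *\<^sub>R (?\<rho> t *\<^sub>R u, v') + (0, w')"
        using \<rho> by (simp add: V1t \<alpha> \<beta>_def w'_def)
      have tang: "\<D>2 k' (?\<zeta> t) (V1 t) (0, y) = \<alpha> * \<D> k' (?\<zeta> t) (y, 0) + \<D>2 k' (?\<zeta> t) (0, w') (0, y)"
        if "shares_extremals U F k'" for k' y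
      proof -
        interpret k': homogeneous_lagrangian U k' using that by (simp add: shares_extremals_def)
        show ?thesis
          unfolding split linear_add[OF k'.linear_D2_left[OF sp(4)[OF tI(1)]]] linear_scale[OF k'.linear_D2_left[OF sp(4)[OF tI(1)]]] EL[OF that]
          using \<rho> by (simp add: \<beta>_def)
      qed
      have rad: "\<D>2 k' (?\<zeta> t) (y, y') (0, a) = \<alpha> * \<D> k' (?\<zeta> t) (y, 0)" if "shares_extremals U F k'" for k' y y'
      proof -
        interpret k': homogeneous_lagrangian U k' using that by (simp add: shares_extremals_def)
        have "(0, a) = \<alpha> *\<^sub>R (0::'e, u)" by (simp add: \<alpha>)
        then have "\<D>2 k' (x t, u) (y, y') (0, a) = \<alpha> * \<D>2 k' (x t, u) (y, y') (0, u)"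
          by (simp only: linear_scale[OF k'.linear_D2_right[OF z]] real_scaleR_def)
        also have "\<D>2 k' (x t, u) (y, y') (0, u) = \<D> k' (x t, u) (y, 0)"
          using k'.D2_split_left[OF z, where x = y and y = y' and w = "(0, u)"] k'.D2_base_radial[OF xu] k'.D2_fibre_radial[OF xu] k'.D2_sym[OF z, of "(0, y')" "(0, u)"] by simp
        finally show ?thesis by (simp add: \<zeta>t)
      qed
      have kw: "\<D>2 k (?\<zeta> t) (0, w') (0, y) = 0" for y
        using star[of "(y, 0)"] tang[OF k, of y] rad[OF k, of y 0] by (simp add: a_def[symmetric])
      show ?thesis
      proof (cases "\<exists>\<gamma>. w' = \<gamma> *\<^sub>R u")
        case False
        with kw show ?thesis unfolding degenerate_def by (auto simp: u_def)
      next
        case True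
        then obtain \<gamma> where \<gamma>: "w' = \<gamma> *\<^sub>R u" by blast
        have Fw: "\<D>2 F (?\<zeta> t) (0, w') (0, y) = 0" for y
        proof -
          have "(0, w') = \<gamma> *\<^sub>R (0::'e, u)" by (simp add: \<gamma>)
          then have "\<D>2 F (x t, u) (0, w') (0, y) = \<gamma> * \<D>2 F (x t, u) (0, u) (0, y)"
            by (simp only: linear_scale[OF linear_D2_left[OF z]] real_scaleR_def)
          then show ?thesis using D2_fibre_radial[OF xu] by (simp add: \<zeta>t)
        qed
        obtain V2 where V2: "V2 t1 = (w, 0)" "jacobi_field x ?J V2" using \<delta>(3)[OF t1] by blast
        obtain y y' where yy: "V2 t = (y, y')" by fastforce
        have "\<D>2 F (?\<zeta> t1) (0, w) (0, w) = 0"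
          using form[OF shares_extremals_self V2(2) yy V2(1)] tang[OF shares_extremals_self, of y] Fw rad[OF shares_extremals_self, of y y']
          by (simp add: a_def[symmetric])
        moreover have "\<D>2 F (x t1, snd (?\<zeta> t1)) (0, w) (0, w) > 0"
          by (rule D2_fibre_pos) (use sp(4)[OF tI(2)] w(1) in \<open>auto simp: unit_lift_def\<close>)
        moreover have "?\<zeta> t1 = (x t1, snd (?\<zeta> t1))" by (simp add: unit_lift_def)
        ultimately show ?thesis by (metis less_irrefl)
      qed
    qed
    then show "degenerate k (x t, vel x t)" using deg_iff[OF tI(1)] by simp
  qed
qed

end

section \<open>Charts, tangent vectors and velocities\<close>

locale manifold =
  fixes A :: "('m::{t2_space,second_countable_topology}, 'e::euclidean_space) chart set"
  assumes atlas: "smooth_atlas A"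
begin

abbreviation trans :: "('m, 'e) chart \<Rightarrow> ('m, 'e) chart \<Rightarrow> 'e \<Rightarrow> 'e" where
  "trans c d \<equiv> snd d \<circ> chart_inv c"

definition overlap :: "('m, 'e) chart \<Rightarrow> ('m, 'e) chart \<Rightarrow> 'e set" where
  "overlap c d = {p \<in> chart_range c. chart_inv c p \<in> fst d}"

lemma chart_ex: "\<exists>c\<in>A. x \<in> fst c"
proof -
  have "x \<in> (\<Union>c\<in>A. fst c)" using atlas by (simp add: smooth_atlas_def)
  then show ?thesis by blast
qed

lemma
  assumes "c \<in> A"
  shows open_dom: "open (fst c)" and open_range: "open (chart_range c)"
    and chart_homeo: "homeomorphism (fst c) (chart_range c) (snd c) (chart_inv c)"
  using atlas assms by (auto simp: smooth_atlas_def)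

lemma chart_inv_in: "c \<in> A \<Longrightarrow> p \<in> chart_range c \<Longrightarrow> chart_inv c p \<in> fst c"
  using chart_homeo[of c] by (auto simp: homeomorphism_def)

lemma chart_chart_inv: "c \<in> A \<Longrightarrow> p \<in> chart_range c \<Longrightarrow> snd c (chart_inv c p) = p"
  using chart_homeo[of c] by (auto simp: homeomorphism_def)

lemma chart_inv_chart: "c \<in> A \<Longrightarrow> x \<in> fst c \<Longrightarrow> chart_inv c (snd c x) = x"
  using chart_homeo[of c] by (auto simp: homeomorphism_def)

lemma chart_in: "x \<in> fst c \<Longrightarrow> snd c x \<in> chart_range c"
  by (simp add: chart_range_def)

lemma continuous_chart_inv: "c \<in> A \<Longrightarrow> continuous_on (chart_range c) (chart_inv c)"
  using chart_homeo[of c] by (auto simp: homeomorphism_def)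

lemma overlap_eq: "c \<in> A \<Longrightarrow> snd c ` (fst c \<inter> fst d) = overlap c d"
proof safe
  assume c: "c \<in> A"
  show "snd c x \<in> overlap c d" if "x \<in> fst c" "x \<in> fst d" for x
    using that chart_inv_chart[OF c that(1)] chart_in[OF that(1)] by (simp add: overlap_def)
  show "p \<in> snd c ` (fst c \<inter> fst d)" if "p \<in> overlap c d" for p
  proof (rule image_eqI)
    have p: "p \<in> chart_range c" "chart_inv c p \<in> fst d" using that by (simp_all add: overlap_def)
    show "p = snd c (chart_inv c p)" by (rule chart_chart_inv[OF c p(1), symmetric])
    show "chart_inv c p \<in> fst c \<inter> fst d" using chart_inv_in[OF c p(1)] p(2) by blast
  qed
qed

lemma open_overlap: assumes "c \<in> A" "d \<in> A" shows "open (overlap c d)"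
proof -
  have "overlap c d = chart_range c \<inter> chart_inv c -` fst d" by (auto simp: overlap_def)
  then show ?thesis
    using continuous_open_preimage[OF continuous_chart_inv open_range open_dom] assms by simp
qed

lemma Ck_trans: "c \<in> A \<Longrightarrow> d \<in> A \<Longrightarrow> Ck_on k (overlap c d) (trans c d)"
  using atlas overlap_eq[of c d] unfolding smooth_atlas_def by metis

lemma D_trans_self: assumes "c \<in> A" "p \<in> chart_range c" shows "\<D> (trans c c) p u = u"
proof -
  have "\<D> (trans c c) p = \<D> (\<lambda>p. p) p"
    by (rule D_cong[OF open_range[OF assms(1)] assms(2)]) (simp add: chart_chart_inv assms(1))
  then show ?thesis by simp
qed

lemma linear_D_trans: "c \<in> A \<Longrightarrow> d \<in> A \<Longrightarrow> p \<in> overlap c d \<Longrightarrow> linear (\<D> (trans c d) p)"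
  using Ck_trans[of c d "Suc 0"] by (intro linear_D) auto

lemma tvec_of_self: "c \<in> A \<Longrightarrow> p \<in> chart_range c \<Longrightarrow> tvec_of A c p u c = u"
  by (simp add: tvec_of_def chart_inv_in D_trans_self)

lemma tvec_of_linear:
  assumes "c \<in> A" "p \<in> chart_range c"
  shows "tvec_of A c p (a *\<^sub>R u + b *\<^sub>R w) = (\<lambda>d. a *\<^sub>R tvec_of A c p u d + b *\<^sub>R tvec_of A c p w d)"
proof
  fix d
  show "tvec_of A c p (a *\<^sub>R u + b *\<^sub>R w) d = a *\<^sub>R tvec_of A c p u d + b *\<^sub>R tvec_of A c p w d"
  proof (cases "d \<in> A \<and> chart_inv c p \<in> fst d")
    case True
    then have l: "linear (\<D> (trans c d) p)" using assms by (intro linear_D_trans) (auto simp: overlap_def)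
    show ?thesis using True by (simp only: tvec_of_def simp_thms if_True linear_add[OF l] linear_scale[OF l])
  next
    case False
    then have "tvec_of A c p u d = 0" for u by (auto simp: tvec_of_def)
    then show ?thesis by simp
  qed
qed

lemma tvec_of_scale: "c \<in> A \<Longrightarrow> p \<in> chart_range c \<Longrightarrow> tvec_of A c p (a *\<^sub>R u) = (\<lambda>d. a *\<^sub>R tvec_of A c p u d)"
  using tvec_of_linear[of c p a u 0 0] by simp

lemma tvec_of_minus: "c \<in> A \<Longrightarrow> p \<in> chart_range c \<Longrightarrow> tvec_of A c p (- u) = (\<lambda>d. - tvec_of A c p u d)"
  using tvec_of_scale[of c p "-1" u] by simp

lemma tvec_of_zero: "c \<in> A \<Longrightarrow> p \<in> chart_range c \<Longrightarrow> tvec_of A c p 0 = (\<lambda>d. 0)"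
  using tvec_of_scale[of c p 0 0] by simp

lemma tvec_of_tangent:
  assumes "c \<in> A" "p \<in> chart_range c" shows "tvec_of A c p u \<in> tangent_space A (chart_inv c p)"
  unfolding tangent_space_def
proof (intro CollectI conjI ballI allI impI)
  fix d e assume de: "d \<in> A" "e \<in> A" "chart_inv c p \<in> fst d" "chart_inv c p \<in> fst e"
  let ?O = "overlap c d \<inter> overlap c e"
  have O: "open ?O" using open_overlap assms de by blast
  have p: "p \<in> ?O" using assms de by (simp add: overlap_def)
  have q: "trans c d p \<in> overlap d e"
    using p de by (auto simp: overlap_def chart_in chart_inv_chart)
  have "\<D> (trans c e) p = \<D> (\<lambda>p. trans d e (trans c d p)) p"
    by (rule D_cong[OF O p]) (use de in \<open>auto simp: overlap_def chart_inv_chart\<close>)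
  moreover have "\<D> (\<lambda>p. trans d e (trans c d p)) p u = \<D> (trans d e) (trans c d p) (\<D> (trans c d) p u)"
    using Ck_trans[of c d "Suc 0"] Ck_trans[of d e "Suc 0"] assms de p q
    by (intro D_compose[of "trans c d" p "trans d e" u]) (simp_all del: o_apply)
  ultimately show "tvec_of A c p u e = \<D> (trans d e) (snd d (chart_inv c p)) (tvec_of A c p u d)"
    using de by (simp add: tvec_of_def)
qed (auto simp: tvec_of_def)

lemma tangent_eq_tvec_of:
  assumes "c \<in> A" "x \<in> fst c" "v \<in> tangent_space A x" shows "v = tvec_of A c (snd c x) (v c)"
proof
  fix d
  show "v d = tvec_of A c (snd c x) (v c) d"
  proof (cases "d \<in> A \<and> x \<in> fst d")
    case True
    then have "v d = \<D> (trans c d) (snd c x) (v c)"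
      using assms unfolding tangent_space_def by blast
    then show ?thesis using True chart_inv_chart[OF assms(1,2)] by (simp add: tvec_of_def)
  next
    case False
    then have "v d = 0" using assms(3) unfolding tangent_space_def by blast
    moreover have "tvec_of A c (snd c x) (v c) d = 0"
      using False chart_inv_chart[OF assms(1,2)] by (auto simp: tvec_of_def)
    ultimately show ?thesis by simp
  qed
qed

lemma velocity_eq_tvec_of:
  assumes c: "c \<in> A" and T: "open T" "t \<in> T" "\<And>s. s \<in> T \<Longrightarrow> \<gamma> s \<in> fst c"
    and x: "((\<lambda>s. snd c (\<gamma> s)) has_vector_derivative v) (at t)"
  shows "velocity A \<gamma> t = tvec_of A c (snd c (\<gamma> t)) v"
proof
  fix d
  have inv: "chart_inv c (snd c (\<gamma> s)) = \<gamma> s" if "s \<in> T" for s using T(3)[OF that] c by (simp add: chart_inv_chart)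
  show "velocity A \<gamma> t d = tvec_of A c (snd c (\<gamma> t)) v d"
  proof (cases "d \<in> A \<and> \<gamma> t \<in> fst d")
    case True
    have O: "snd c (\<gamma> t) \<in> overlap c d"
      using True T by (simp add: overlap_def chart_in inv)
    have "((\<lambda>s. trans c d (snd c (\<gamma> s))) has_vector_derivative \<D> (trans c d) (snd c (\<gamma> t)) v) (at t)"
      by (rule C1_has_vector_derivative_compose[OF Ck_trans[of c d "Suc 0"] O x]) (use c True in auto)
    then have "((\<lambda>s. snd d (\<gamma> s)) has_vector_derivative \<D> (trans c d) (snd c (\<gamma> t)) v) (at t)"
      by (rule has_vector_derivative_transform_within_open[OF _ T(1,2)]) (simp add: inv)
    then have "vector_derivative (snd d \<circ> \<gamma>) (at t) = \<D> (trans c d) (snd c (\<gamma> t)) v"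
      by (simp add: o_def vector_derivative_at)
    then show ?thesis using True inv[OF T(2)] by (simp add: velocity_def tvec_of_def)
  next
    case False
    then show ?thesis using inv[OF T(2)] by (auto simp: velocity_def tvec_of_def)
  qed
qed

abbreviation lrep :: "('m \<Rightarrow> ('m, 'e) tvec \<Rightarrow> real) \<Rightarrow> ('m, 'e) chart \<Rightarrow> 'e \<times> 'e \<Rightarrow> real" where
  "lrep F c \<equiv> \<lambda>z. local_rep A F c (fst z) (snd z)"

end

text \<open>Relates derivatives on a single tangent space, in which Minkowski norms are defined, to derivatives on
the tangent bundle.\<close>

lemma D2_fibre:
  fixes g :: "'a::euclidean_space \<times> 'b::euclidean_space \<Rightarrow> real"
  assumes "Ck_on (Suc (Suc 0)) (U \<times> (- {0})) g" "open U" "p \<in> U" "u \<noteq> 0"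
  shows "\<D> (\<lambda>u. g (p, u)) u y = \<D> g (p, u) (0, y)"
    and "\<D>2 (\<lambda>u. g (p, u)) u w y = \<D>2 g (p, u) (0, w) (0, y)"
proof -
  have m: "((\<lambda>u::'b. (p, u)) has_derivative (\<lambda>h. (0, h))) (at u)" for u by (auto intro!: derivative_eq_intros)
  have 1: "\<D> (\<lambda>u. g (p, u)) u y = \<D> g (p, u) (0, y)" if "u \<noteq> 0" for u y
    using D_compose[of "\<lambda>u. (p, u)" u g y] assms(1,3) that by (simp add: D_eqI[OF m] differentiableI[OF m])
  then show "\<D> (\<lambda>u. g (p, u)) u y = \<D> g (p, u) (0, y)" using assms(4) by blast
  have "\<D>2 (\<lambda>u. g (p, u)) u w y = \<D> (\<lambda>u. \<D> g (p, u) (0, y)) u w"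
  proof (rule fun_cong[OF D_cong])
    show "open (- {0::'b})" by (simp add: open_Compl)
  qed (use assms(4) 1 in auto)
  also have "\<dots> = \<D>2 g (p, u) (0, w) (0, y)"
    using D_compose[of "\<lambda>u. (p, u)" u "\<lambda>z. \<D> g z (0, y)" w] assms(1,3,4) by (simp add: D_eqI[OF m] differentiableI[OF m])
  finally show "\<D>2 (\<lambda>u. g (p, u)) u w y = \<D>2 g (p, u) (0, w) (0, y)" .
qed

section \<open>The first variation of length\<close>

text \<open>The Euler-Lagrange expression \<open>k\<^sub>x - d/dt k\<^sub>u\<close> in the direction \<open>w\<close>, which is the density of the first
variation.\<close>

definition euler_expr :: "('e::euclidean_space \<times> 'e \<Rightarrow> real) \<Rightarrow> (real \<Rightarrow> 'e) \<Rightarrow> real \<Rightarrow> 'e \<Rightarrow> real" where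
  "euler_expr k x t w = \<D> k (x t, vel x t) (w, 0) - vector_derivative (\<lambda>s. \<D> k (x s, vel x s) (0, w)) (at t)"

lemma D2_symmetric_vector:
  fixes f :: "'a::euclidean_space \<Rightarrow> 'b::euclidean_space"
  assumes "Ck_on (Suc (Suc k)) S f" "open S" "z \<in> S"
  shows "\<D>2 f z v w = \<D>2 f z w v"
proof (rule euclidean_eqI)
  fix b :: 'b assume "b \<in> Basis"
  have C: "Ck_on (Suc (Suc k)) S (\<lambda>z. f z \<bullet> b)"
    by (rule Ck_on_compose_linear[OF bounded_linear_inner_left assms(1,2)])
  have 1: "\<D> (\<lambda>z. f z \<bullet> b) z v = \<D> f z v \<bullet> b" if "z \<in> S" for z v
    by (rule fun_cong[OF D_eqI[OF bounded_linear.has_derivative[OF bounded_linear_inner_left C1_has_derivative[OF assms(1) that]]]])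
  have C1: "Ck_on (Suc k) S (\<lambda>z. \<D> f z w)" for w using assms(1) by (metis Ck_on.simps(2))
  have 2: "\<D>2 (\<lambda>z. f z \<bullet> b) z v w = \<D>2 f z v w \<bullet> b" for v w
  proof -
    have "\<D>2 (\<lambda>z. f z \<bullet> b) z v w = \<D> (\<lambda>z. \<D> f z w \<bullet> b) z v"
      by (rule fun_cong[OF D_cong[OF assms(2,3)]]) (rule 1)
    also have "\<dots> = \<D>2 f z v w \<bullet> b"
      by (rule fun_cong[OF D_eqI[OF bounded_linear.has_derivative[OF bounded_linear_inner_left C1_has_derivative[OF C1 assms(3)]]]])
    finally show ?thesis .
  qed
  show "\<D>2 f z v w \<bullet> b = \<D>2 f z w v \<bullet> b"
    using D2_symmetric[OF C assms(2,3), of v w] unfolding 2 by simp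
qed

context homogeneous_lagrangian
begin

lemma fibre_derivative_along_curve:
  assumes "open J" "Ck_on (Suc (Suc 0)) J x" "\<And>t. t \<in> J \<Longrightarrow> x t \<in> U \<and> vel x t \<noteq> 0"
  shows "Ck_on (Suc 0) J (\<lambda>s. \<D> k (x s, vel x s) (0, w))"
  by (rule Ck_on_compose[OF Ck_on_Pair[OF Ck_on_SucD[OF assms(2)] Ck_on_real_SucD(2)[OF assms(1,2)] assms(1)] C1 _ assms(1)])
     (use assms(3) in auto)

lemma euler_expr_continuous:
  assumes "open J" "Ck_on (Suc (Suc 0)) J x" "\<And>t. t \<in> J \<Longrightarrow> x t \<in> U \<and> vel x t \<noteq> 0"
  shows "continuous_on J (\<lambda>t. euler_expr k x t w)"
proof -
  have "continuous_on J (\<lambda>t. \<D> k (x t, vel x t) (w, 0))"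
    using assms(3) Ck_on_continuous[OF assms(2)] Ck_on_continuous[OF Ck_on_real_SucD(2)[OF assms(1,2)]]
    by (intro C1_continuous_D[OF C2] continuous_intros) auto
  moreover have "continuous_on J (\<lambda>t. vector_derivative (\<lambda>s. \<D> k (x s, vel x s) (0, w)) (at t))"
    using Ck_on_continuous[OF Ck_on_real_SucD(2)[OF assms(1) fibre_derivative_along_curve[OF assms]]] .
  ultimately show ?thesis unfolding euler_expr_def by (intro continuous_intros)
qed

lemma euler_expr_linear:
  assumes "open J" "Ck_on (Suc (Suc 0)) J x" "\<And>t. t \<in> J \<Longrightarrow> x t \<in> U \<and> vel x t \<noteq> 0" "t \<in> J"
  shows "linear (euler_expr k x t)"
proof -
  have z: "(x s, vel x s) \<in> U \<times> (- {0})" if "s \<in> J" for s using assms(3)[OF that] by simp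
  have d: "((\<lambda>s. \<D> k (x s, vel x s) (0, w)) has_vector_derivative
      vector_derivative (\<lambda>s. \<D> k (x s, vel x s) (0, w)) (at t)) (at t)" for w
    by (rule Ck_on_real_SucD(1)[OF assms(1) fibre_derivative_along_curve[OF assms(1-3)] assms(4)])
  let ?q = "\<lambda>w. vector_derivative (\<lambda>s. \<D> k (x s, vel x s) (0, w)) (at t)"
  have "linear ?q"
  proof (rule linearI)
    fix v w
    have "((\<lambda>s. \<D> k (x s, vel x s) (0, v) + \<D> k (x s, vel x s) (0, w)) has_vector_derivative ?q v + ?q w) (at t)"
      by (rule has_vector_derivative_add[OF d d])
    then have "((\<lambda>s. \<D> k (x s, vel x s) (0, v + w)) has_vector_derivative ?q v + ?q w) (at t)"
      by (rule has_vector_derivative_transform_within_open[OF _ assms(1,4)])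
         (use linear_add[OF linear_fibre[OF linear_Dk[OF z]]] in simp)
    then show "?q (v + w) = ?q v + ?q w" by (rule vector_derivative_at)
  next
    fix r w
    have "((\<lambda>s. r * \<D> k (x s, vel x s) (0, w)) has_vector_derivative r * ?q w) (at t)"
      by (rule has_vector_derivative_mult_right[OF d])
    then have "((\<lambda>s. \<D> k (x s, vel x s) (0, r *\<^sub>R w)) has_vector_derivative r * ?q w) (at t)"
      by (rule has_vector_derivative_transform_within_open[OF _ assms(1,4)])
         (use linear_scale[OF linear_fibre[OF linear_Dk[OF z]]] in simp)
    then show "?q (r *\<^sub>R w) = r *\<^sub>R ?q w" by (simp add: vector_derivative_at)
  qed
  then show ?thesis unfolding euler_expr_def
    by (rule linear_compose_sub[OF linear_base[OF linear_Dk[OF z[OF assms(4)]]]])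
qed

lemma extremal_iff_euler_expr:
  "extremal U k I x \<longleftrightarrow> open I \<and> is_interval I \<and> Ck_on (Suc (Suc 0)) I x \<and> (\<forall>t\<in>I. x t \<in> U \<and> vel x t \<noteq> 0) \<and>
     (\<forall>t\<in>I. \<forall>w. euler_expr k x t w = 0)"
proof -
  have "((\<lambda>s. \<D> k (x s, vel x s) (0, w)) has_vector_derivative \<D> k (x t, vel x t) (w, 0)) (at t) \<longleftrightarrow> euler_expr k x t w = 0"
    if "open I" "Ck_on (Suc (Suc 0)) I x" "\<forall>t\<in>I. x t \<in> U \<and> vel x t \<noteq> 0" "t \<in> I" for t w
  proof -
    have d: "((\<lambda>s. \<D> k (x s, vel x s) (0, w)) has_vector_derivative
        vector_derivative (\<lambda>s. \<D> k (x s, vel x s) (0, w)) (at t)) (at t)"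
      by (rule Ck_on_real_SucD(1)[OF that(1) fibre_derivative_along_curve[OF that(1,2)] that(4)]) (use that(3) in blast)
    show ?thesis
    proof
      assume h: "((\<lambda>s. \<D> k (x s, vel x s) (0, w)) has_vector_derivative \<D> k (x t, vel x t) (w, 0)) (at t)"
      show "euler_expr k x t w = 0" unfolding euler_expr_def vector_derivative_at[OF h] by simp
    next
      assume "euler_expr k x t w = 0"
      then have "\<D> k (x t, vel x t) (w, 0) = vector_derivative (\<lambda>s. \<D> k (x s, vel x s) (0, w)) (at t)"
        unfolding euler_expr_def by simp
      then show "((\<lambda>s. \<D> k (x s, vel x s) (0, w)) has_vector_derivative \<D> k (x t, vel x t) (w, 0)) (at t)"
        using d by (simp only:)
    qed
  qed
  then show ?thesis unfolding extremal_def by blast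
qed

lemma integration_by_parts_along_curve:
  assumes J: "open J" "Ck_on (Suc (Suc 0)) J x" "\<And>t. t \<in> J \<Longrightarrow> x t \<in> U \<and> vel x t \<noteq> 0"
    and ab: "a < b" "{a..b} \<subseteq> J"
    and \<eta>: "\<And>t. t \<in> {a..b} \<Longrightarrow> (\<eta> has_vector_derivative \<eta>' t) (at t)" "\<eta> a = 0" "\<eta> b = 0"
  shows "integral {a..b} (\<lambda>t. \<D> k (x t, vel x t) (\<eta> t, \<eta>' t)) = integral {a..b} (\<lambda>t. euler_expr k x t (\<eta> t))"
proof -
  let ?q = "\<lambda>w t. \<D> k (x t, vel x t) (0, w)"
  have z: "(x t, vel x t) \<in> U \<times> (- {0})" if "t \<in> {a..b}" for t using J(3) ab that by auto
  have lf: "linear (\<lambda>w. ?q w t)" if "t \<in> {a..b}" for t by (rule linear_fibre[OF linear_Dk[OF z[OF that]]])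
  have dq: "(?q w has_vector_derivative vector_derivative (?q w) (at t)) (at t)" if "t \<in> {a..b}" for t w
    by (rule Ck_on_real_SucD(1)[OF J(1) fibre_derivative_along_curve[OF J]]) (use that ab in auto)
  have exp: "?q w t = (\<Sum>b\<in>Basis. (w \<bullet> b) * ?q b t)" if "t \<in> {a..b}" for w t
    using linear_functional_representation[OF lf[OF that], of w] by (simp add: sum_inner_basis)
  have eexp: "euler_expr k x t w = (\<Sum>b\<in>Basis. (w \<bullet> b) * euler_expr k x t b)" if "t \<in> {a..b}" for w t
    using linear_functional_representation[OF euler_expr_linear[OF J], of t w] that ab by (simp add: sum_inner_basis subsetD)
  have bexp: "\<D> k (x t, vel x t) (w, 0) = (\<Sum>b\<in>Basis. (w \<bullet> b) * \<D> k (x t, vel x t) (b, 0))" if "t \<in> {a..b}" for w t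
    using linear_functional_representation[OF linear_base[OF linear_Dk[OF z[OF that]]], of w] by (simp add: sum_inner_basis)
  define Q where "Q = (\<lambda>t. \<Sum>b\<in>Basis. (\<eta> t \<bullet> b) * ?q b t)"
  have dQ: "(Q has_vector_derivative \<D> k (x t, vel x t) (\<eta> t, \<eta>' t) - euler_expr k x t (\<eta> t)) (at t within {a..b})"
    if t: "t \<in> {a..b}" for t
  proof -
    have dQ: "(Q has_vector_derivative (\<Sum>b\<in>Basis. (\<eta> t \<bullet> b) * vector_derivative (?q b) (at t) + (\<eta>' t \<bullet> b) * ?q b t)) (at t)"
      unfolding Q_def
      by (intro has_vector_derivative_sum has_vector_derivative_mult dq[OF t]
          bounded_linear.has_vector_derivative[OF bounded_linear_inner_left \<eta>(1)[OF t]])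
    have "(\<Sum>b\<in>Basis. (\<eta> t \<bullet> b) * vector_derivative (?q b) (at t) + (\<eta>' t \<bullet> b) * ?q b t)
        = (\<D> k (x t, vel x t) (\<eta> t, 0) - euler_expr k x t (\<eta> t)) + \<D> k (x t, vel x t) (0, \<eta>' t)"
      unfolding bexp[OF t, where w = "\<eta> t"] eexp[OF t, where w = "\<eta> t"] exp[OF t, where w = "\<eta>' t"]
      by (simp add: euler_expr_def sum.distrib right_diff_distrib sum_subtractf)
    moreover have "\<D> k (x t, vel x t) (\<eta> t, \<eta>' t) = \<D> k (x t, vel x t) (\<eta> t, 0) + \<D> k (x t, vel x t) (0, \<eta>' t)"
      using linear_add[OF linear_Dk[OF z[OF t]], of "(\<eta> t, 0)" "(0, \<eta>' t)"] by simp
    ultimately have "(\<Sum>b\<in>Basis. (\<eta> t \<bullet> b) * vector_derivative (?q b) (at t) + (\<eta>' t \<bullet> b) * ?q b t)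
        = \<D> k (x t, vel x t) (\<eta> t, \<eta>' t) - euler_expr k x t (\<eta> t)" by simp
    with dQ have "(Q has_vector_derivative \<D> k (x t, vel x t) (\<eta> t, \<eta>' t) - euler_expr k x t (\<eta> t)) (at t)"
      by (simp only:)
    then show ?thesis by (rule has_vector_derivative_at_within)
  qed
  have "((\<lambda>t. \<D> k (x t, vel x t) (\<eta> t, \<eta>' t) - euler_expr k x t (\<eta> t)) has_integral Q b - Q a) {a..b}"
    by (rule fundamental_theorem_of_calculus[OF _ dQ]) (use ab in auto)
  moreover have "Q b - Q a = 0" by (simp add: Q_def \<eta>)
  ultimately have i: "((\<lambda>t. \<D> k (x t, vel x t) (\<eta> t, \<eta>' t) - euler_expr k x t (\<eta> t)) has_integral 0) {a..b}" by simp
  have "continuous_on {a..b} \<eta>"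
    by (intro continuous_at_imp_continuous_on ballI has_vector_derivative_continuous[OF \<eta>(1)])
  then have "continuous_on {a..b} (\<lambda>t. \<Sum>b\<in>Basis. (\<eta> t \<bullet> b) * euler_expr k x t b)"
    by (intro continuous_intros continuous_on_subset[OF euler_expr_continuous[OF J] ab(2)])
  then have "continuous_on {a..b} (\<lambda>t. euler_expr k x t (\<eta> t))"
    by (rule continuous_on_eq) (simp add: eexp[symmetric])
  then have e: "(\<lambda>t. euler_expr k x t (\<eta> t)) integrable_on {a..b}" by (rule integrable_continuous_real)
  from has_integral_add[OF i integrable_integral[OF e]] show ?thesis by (simp add: integral_unique)
qed

end

lemma vel_cong: "open J \<Longrightarrow> t \<in> J \<Longrightarrow> (\<And>s. s \<in> J \<Longrightarrow> x s = y s) \<Longrightarrow> vel x t = vel y t"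
  unfolding vector_derivative_def has_vector_derivative_def
  using has_derivative_transform_within_open by (metis (no_types, lifting))

lemma extremal_cong:
  assumes "extremal U k J x" "\<And>s. s \<in> J \<Longrightarrow> x s = y s" shows "extremal U k J y"
proof -
  have J: "open J" using assms(1) by (simp add: extremal_def)
  have v: "vel x t = vel y t" if "t \<in> J" for t by (rule vel_cong[OF J that assms(2)])
  have "((\<lambda>s. \<D> k (y s, vel y s) (0, w)) has_vector_derivative \<D> k (y t, vel y t) (w, 0)) (at t)" if t: "t \<in> J" for t w
  proof -
    have "((\<lambda>s. \<D> k (x s, vel x s) (0, w)) has_vector_derivative \<D> k (x t, vel x t) (w, 0)) (at t)"
      using assms(1) t by (simp add: extremal_def)
    then have "((\<lambda>s. \<D> k (y s, vel y s) (0, w)) has_vector_derivative \<D> k (x t, vel x t) (w, 0)) (at t)"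
      by (rule has_vector_derivative_transform_within_open[OF _ J t]) (simp add: v assms(2))
    then show ?thesis by (simp add: v[OF t] assms(2)[OF t])
  qed
  moreover have "Ck_on (Suc (Suc 0)) J y"
    using assms(1) Ck_on_cong[OF J assms(2)] by (auto simp: extremal_def simp del: Ck_on.simps)
  moreover have "y t \<in> U \<and> vel y t \<noteq> 0" if "t \<in> J" for t
    using assms(1) v[OF that] assms(2)[OF that] that by (auto simp: extremal_def)
  ultimately show ?thesis using assms(1) unfolding extremal_def by blast
qed

context manifold
begin

lemma Ck_map_chart: "Ck_map A 2 S g \<Longrightarrow> c \<in> A \<Longrightarrow> Ck_on (Suc (Suc 0)) (S \<inter> g -` fst c) (\<lambda>z. snd c (g z))"
  by (simp add: Ck_map_def numeral_2_eq_2 o_def del: Ck_on.simps)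

lemma Ck_map_chart_inv:
  fixes Y :: "'a::euclidean_space \<Rightarrow> 'e"
  assumes "c \<in> A" "open S" "Ck_on (Suc (Suc 0)) S Y" "\<And>z. z \<in> S \<Longrightarrow> Y z \<in> chart_range c"
  shows "Ck_map A 2 S (\<lambda>z. chart_inv c (Y z))"
  unfolding Ck_map_def numeral_2_eq_2
proof (intro conjI ballI)
  show cont: "continuous_on S (\<lambda>z. chart_inv c (Y z))"
    by (rule continuous_on_compose2[OF continuous_chart_inv[OF assms(1)] Ck_on_continuous[OF assms(3)]]) (use assms(4) in auto)
  fix d assume d: "d \<in> A"
  have "open (S \<inter> (\<lambda>z. chart_inv c (Y z)) -` fst d)"
    by (rule continuous_open_preimage[OF cont assms(2) open_dom[OF d]])
  then have "Ck_on (Suc (Suc 0)) (S \<inter> (\<lambda>z. chart_inv c (Y z)) -` fst d) (\<lambda>z. trans c d (Y z))"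
    by (intro Ck_on_compose[OF Ck_on_subset[OF assms(3)] Ck_trans[OF assms(1) d]])
       (use assms(4) in \<open>auto simp: overlap_def\<close>)
  then show "Ck_on (Suc (Suc 0)) (S \<inter> (\<lambda>z. chart_inv c (Y z)) -` fst d) (snd d \<circ> (\<lambda>z. chart_inv c (Y z)))"
    by (simp add: o_def del: Ck_on.simps)
qed

lemma Ck_map_local:
  fixes g :: "'a::euclidean_space \<Rightarrow> 'm"
  assumes "\<And>z. z \<in> S \<Longrightarrow> \<exists>T h. open T \<and> z \<in> T \<and> Ck_map A 2 T h \<and> (\<forall>w\<in>T. g w = h w)"
  shows "Ck_map A 2 S g"
  unfolding Ck_map_def numeral_2_eq_2
proof (intro conjI ballI)
  show "continuous_on S g"
  proof (rule continuous_at_imp_continuous_on, rule ballI)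
    fix z assume "z \<in> S"
    then obtain T h where T: "open T" "z \<in> T" "Ck_map A 2 T h" "\<forall>w\<in>T. g w = h w" using assms by blast
    then have "continuous_on T h" by (simp add: Ck_map_def)
    then have "continuous_on T g" by (rule continuous_on_eq) (use T(4) in simp)
    then show "isCont g z" using T(1,2) continuous_on_eq_continuous_at by blast
  qed
  fix d assume d: "d \<in> A"
  show "Ck_on (Suc (Suc 0)) (S \<inter> g -` fst d) (snd d \<circ> g)"
  proof (rule Ck_on_local)
    fix z assume z: "z \<in> S \<inter> g -` fst d"
    then obtain T h where T: "open T" "z \<in> T" "Ck_map A 2 T h" "\<forall>w\<in>T. g w = h w" using assms by blast
    let ?T = "T \<inter> h -` fst d"
    have "open ?T" using continuous_open_preimage[of T h "fst d"] T open_dom[OF d] by (simp add: Ck_map_def)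
    moreover have "z \<in> ?T" using z T by auto
    moreover have "Ck_on (Suc (Suc 0)) ?T (\<lambda>z. snd d (h z))" by (rule Ck_map_chart[OF T(3) d])
    then have "Ck_on (Suc (Suc 0)) ?T (snd d \<circ> g)"
      using Ck_on_cong[OF \<open>open ?T\<close>, of "snd d \<circ> g" "\<lambda>z. snd d (h z)"] T(4) by (simp del: Ck_on.simps)
    ultimately show "\<exists>T. open T \<and> z \<in> T \<and> Ck_on (Suc (Suc 0)) T (snd d \<circ> g)" by blast
  qed
qed

lemma Ck_map_compose:
  fixes h :: "'b::euclidean_space \<Rightarrow> 'a::euclidean_space"
  assumes "Ck_map A 2 S g" "open S" "Ck_on (Suc (Suc 0)) T h" "open T" "h ` T \<subseteq> S"
  shows "Ck_map A 2 T (\<lambda>z. g (h z))"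
  unfolding Ck_map_def numeral_2_eq_2
proof (intro conjI ballI)
  show c: "continuous_on T (\<lambda>z. g (h z))"
    using assms(1) by (intro continuous_on_compose2[OF _ Ck_on_continuous[OF assms(3)] assms(5)]) (simp add: Ck_map_def)
  fix d assume d: "d \<in> A"
  have "open (T \<inter> (\<lambda>z. g (h z)) -` fst d)" by (rule continuous_open_preimage[OF c assms(4) open_dom[OF d]])
  then have "Ck_on (Suc (Suc 0)) (T \<inter> (\<lambda>z. g (h z)) -` fst d) (\<lambda>z. snd d (g (h z)))"
    by (intro Ck_on_compose[OF Ck_on_subset[OF assms(3)] Ck_map_chart[OF assms(1) d]]) (use assms(5) in auto)
  then show "Ck_on (Suc (Suc 0)) (T \<inter> (\<lambda>z. g (h z)) -` fst d) (snd d \<circ> (\<lambda>z. g (h z)))"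
    by (simp add: o_def del: Ck_on.simps)
qed

text \<open>For small parameters the variation stays in the chart and has nowhere zero velocity, by compactness
of \<open>{a..b}\<close>. There the length is differentiated under the integral sign; the mixed second
derivatives of the variation commute, and integration by parts removes the derivative of the
variation vector.\<close>

lemma first_variation:
  assumes k: "homogeneous_lagrangian (chart_range c) (lrep F c)" and c: "c \<in> A"
    and I: "open I" and J: "open J" "J \<subseteq> I" "{a..b} \<subseteq> J" "a < b" "\<And>t. t \<in> J \<Longrightarrow> \<gamma> t \<in> fst c"
    and x: "Ck_on (Suc (Suc 0)) J (\<lambda>t. snd c (\<gamma> t))" "\<And>t. t \<in> J \<Longrightarrow> vel (\<lambda>t. snd c (\<gamma> t)) t \<noteq> 0"
    and var: "proper_variation A I \<gamma> a b e \<Gamma>"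
  shows "((\<lambda>s. finsler_length A F a b (\<lambda>t. \<Gamma> (s, t))) has_real_derivative
    integral {a..b} (\<lambda>t. euler_expr (lrep F c) (\<lambda>t. snd c (\<gamma> t)) t (vel (\<lambda>s. snd c (\<Gamma> (s, t))) 0))) (at 0)"
proof -
  let ?k = "lrep F c" and ?x = "\<lambda>t. snd c (\<gamma> t)" and ?y = "\<lambda>z. snd c (\<Gamma> z)"
  interpret k: homogeneous_lagrangian "chart_range c" ?k by (rule k)
  have e: "e > 0" and C\<Gamma>: "Ck_map A 2 ({-e<..<e} \<times> I) \<Gamma>" and \<Gamma>0: "\<And>t. t \<in> I \<Longrightarrow> \<Gamma> (0, t) = \<gamma> t"
    and \<Gamma>ab: "\<And>s. s \<in> {-e<..<e} \<Longrightarrow> \<Gamma> (s, a) = \<gamma> a \<and> \<Gamma> (s, b) = \<gamma> b"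
    using var by (auto simp: proper_variation_def)
  define O1 where "O1 = ({-e<..<e} \<times> I) \<inter> \<Gamma> -` fst c"
  have O1: "open O1" unfolding O1_def
    using C\<Gamma> open_dom[OF c] by (intro continuous_open_preimage open_Times I) (auto simp: Ck_map_def)
  have Cy: "Ck_on (Suc (Suc 0)) O1 ?y" unfolding O1_def by (rule Ck_map_chart[OF C\<Gamma> c])
  have C1y: "Ck_on (Suc 0) O1 (\<lambda>z. \<D> ?y z v)" for v using Cy by (metis Ck_on.simps(2))
  have O1D: "\<Gamma> z \<in> fst c" "?y z \<in> chart_range c" if "z \<in> O1" for z using that by (auto simp: O1_def chart_in)
  have in0: "(0, t) \<in> O1" if "t \<in> J" for t
    using that e J \<Gamma>0[of t] by (auto simp: O1_def)
  have ps: "((\<lambda>s. (s, t)) has_vector_derivative (1, 0)) (at s within T)" for s t :: real and T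
    by (auto intro!: derivative_eq_intros has_vector_derivative_Pair)
  have pt: "((\<lambda>t. (s, t)) has_vector_derivative (0, 1)) (at t within T)" for s t :: real and T
    by (auto intro!: derivative_eq_intros has_vector_derivative_Pair)
  have vx: "\<D> ?y (0, t) (0, 1) = vel ?x t" if t: "t \<in> J" for t
  proof -
    have "((\<lambda>t. ?y (0, t)) has_vector_derivative \<D> ?y (0, t) (0, 1)) (at t)"
      by (rule C1_has_vector_derivative_compose[OF Cy in0[OF t] pt])
    then have "(?x has_vector_derivative \<D> ?y (0, t) (0, 1)) (at t)"
      by (rule has_vector_derivative_transform_within_open[OF _ J(1) t]) (use \<Gamma>0 J(2) in auto)
    then show ?thesis by (simp add: vector_derivative_at)
  qed
  define O2 where "O2 = O1 \<inter> (\<lambda>z. \<D> ?y z (0, 1)) -` (- {0})"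
  have O2: "open O2" unfolding O2_def
    by (rule continuous_open_preimage[OF Ck_on_continuous[OF C1y] O1]) (simp add: open_Compl)
  have O21: "O2 \<subseteq> O1" by (auto simp: O2_def)
  have K: "{0} \<times> {a..b} \<subseteq> O2" using in0 vx x(2) J(3) by (auto simp: O2_def subset_iff)
  have "compact ({0::real} \<times> {a..b})" by (intro compact_Times) auto
  then obtain r where r: "r > 0" "(\<Union>z\<in>{0} \<times> {a..b}. cball z r) \<subseteq> O2"
    using compact_subset_open_imp_cball_epsilon_subset[OF _ O2 K] by metis
  have inO2: "(s, t) \<in> O2" if "s \<in> {-r..r}" "t \<in> {a..b}" for s t
  proof -
    have "(s, t) \<in> cball (0, t) r" using that by (auto simp: dist_Pair_Pair dist_real_def)
    then show ?thesis using r(2) that(2) by blast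
  qed
  define Y where "Y = (\<lambda>z. (?y z, \<D> ?y z (0, 1)))"
  have CY: "Ck_on (Suc 0) O2 Y" unfolding Y_def
    by (intro Ck_on_Pair O2 Ck_on_subset[OF C1y O21] Ck_on_subset[OF Ck_on_SucD[OF Cy] O21])
  have Yin: "Y z \<in> chart_range c \<times> (- {0})" if "z \<in> O2" for z
    using that O1D by (auto simp: Y_def O2_def)
  define G where "G = (\<lambda>z. ?k (Y z))"
  have CG: "Ck_on (Suc 0) O2 G" unfolding G_def
    by (rule Ck_on_compose[OF CY Ck_on_SucD[OF k.C2] _ O2]) (use Yin in blast)
  have len: "finsler_length A F a b (\<lambda>t. \<Gamma> (s, t)) = integral {a..b} (\<lambda>t. G (s, t))" if s: "s \<in> {-r..r}" for s
    unfolding finsler_length_def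
  proof (rule integral_cong)
    fix t assume t: "t \<in> {a..b}"
    let ?T = "(\<lambda>t. (s, t)) -` O2"
    have T: "open ?T" by (rule open_vimage[OF O2]) (auto intro!: continuous_intros)
    have "velocity A (\<lambda>t. \<Gamma> (s, t)) t = tvec_of A c (?y (s, t)) (\<D> ?y (s, t) (0, 1))"
    proof (rule velocity_eq_tvec_of[OF c T])
      show "t \<in> ?T" using inO2[OF s t] by simp
      show "\<Gamma> (s, t') \<in> fst c" if "t' \<in> ?T" for t' using that O21 O1D by blast
      show "((\<lambda>t. snd c (\<Gamma> (s, t))) has_vector_derivative \<D> ?y (s, t) (0, 1)) (at t)"
        by (rule C1_has_vector_derivative_compose[OF Cy _ pt]) (use inO2[OF s t] O21 in blast)
    qed
    moreover have "chart_inv c (?y (s, t)) = \<Gamma> (s, t)"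
      using inO2[OF s t] O21 O1D c by (intro chart_inv_chart) blast+
    ultimately show "F (\<Gamma> (s, t)) (velocity A (\<lambda>t. \<Gamma> (s, t)) t) = G (s, t)"
      by (simp add: G_def Y_def local_rep_def)
  qed
  have leib: "((\<lambda>s. integral (cbox a b) (\<lambda>t. G (s, t))) has_field_derivative
      integral (cbox a b) (\<lambda>t. \<D> G (0, t) (1, 0))) (at 0 within {-r..r})"
  proof (rule leibniz_rule_field_derivative[where fx = "\<lambda>s t. \<D> G (s, t) (1, 0)"])
    show "((\<lambda>s. G (s, t)) has_field_derivative \<D> G (s, t) (1, 0)) (at s within {-r..r})"
      if st: "s \<in> {-r..r}" "t \<in> cbox a b" for s t
    proof -
      have "(s, t) \<in> O2" using inO2 st by auto
      then have "((\<lambda>s. G (s, t)) has_vector_derivative \<D> G (s, t) (1, 0)) (at s)"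
        by (rule C1_has_vector_derivative_compose[OF CG _ ps])
      then show ?thesis unfolding has_real_derivative_iff_has_vector_derivative
        by (rule has_vector_derivative_at_within)
    qed
    show "(\<lambda>t. G (s, t)) integrable_on cbox a b" if "s \<in> {-r..r}" for s
      using inO2 that by (intro integrable_continuous continuous_on_compose2[OF Ck_on_continuous[OF CG]])
        (auto intro!: continuous_intros)
    show "continuous_on ({-r..r} \<times> cbox a b) (\<lambda>(s, t). \<D> G (s, t) (1, 0))"
      unfolding case_prod_beta
      by (rule C1_continuous_D[OF CG]) (use inO2 in \<open>auto intro!: continuous_intros\<close>)
  qed (use r in auto)
  have w0: "at 0 within {-r..r} = at (0::real)" by (rule at_within_interior) (use r in auto)
  have d0: "((\<lambda>s. finsler_length A F a b (\<lambda>t. \<Gamma> (s, t))) has_real_derivative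
      integral {a..b} (\<lambda>t. \<D> G (0, t) (1, 0))) (at 0)"
  proof -
    have l: "((\<lambda>s. integral {a..b} (\<lambda>t. G (s, t))) has_real_derivative integral {a..b} (\<lambda>t. \<D> G (0, t) (1, 0))) (at 0)"
      using leib unfolding w0 cbox_interval .
    have "0 \<in> {-r<..<r}" using r by simp
    from has_field_derivative_transform_within_open[OF l open_greaterThanLessThan this] len
    show ?thesis by simp
  qed
  define \<eta> where "\<eta> = (\<lambda>t. \<D> ?y (0, t) (1, 0))"
  define \<eta>' where "\<eta>' = (\<lambda>t. \<D>2 ?y (0, t) (0, 1) (1, 0))"
  have tJ: "t \<in> J" if "t \<in> {a..b}" for t using that J(3) by blast
  have \<eta>d: "(\<eta> has_vector_derivative \<eta>' t) (at t)" if "t \<in> {a..b}" for t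
    unfolding \<eta>_def \<eta>'_def by (rule C1_has_vector_derivative_compose[OF C1y in0[OF tJ[OF that]] pt])
  have \<eta>vel: "((\<lambda>s. ?y (s, t)) has_vector_derivative \<eta> t) (at 0)" if "t \<in> {a..b}" for t
    unfolding \<eta>_def by (rule C1_has_vector_derivative_compose[OF Cy in0[OF tJ[OF that]] ps])
  have \<eta>0: "\<eta> t = 0" if t: "t = a \<or> t = b" for t
  proof -
    have "((\<lambda>s. ?y (s, t)) has_vector_derivative 0) (at 0)"
      by (rule has_vector_derivative_transform_within_open[where S="{-e<..<e}" and f="\<lambda>s. snd c (\<gamma> t)"])
         (use e \<Gamma>ab t in auto)
    then show ?thesis using \<eta>vel[of t] t J(4) vector_derivative_unique_at by fastforce
  qed
  have "\<D> G (0, t) (1, 0) = \<D> ?k (?x t, vel ?x t) (\<eta> t, \<eta>' t)" if t: "t \<in> {a..b}" for t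
  proof -
    have z: "(0, t) \<in> O2" "(0, t) \<in> O1" using K t in0[OF tJ[OF t]] by auto
    have "\<D> G (0, t) (1, 0) = \<D> ?k (Y (0, t)) (\<D> Y (0, t) (1, 0))"
      unfolding G_def
    proof (rule D_compose)
      show "Y differentiable at (0, t)" using CY z(1) by (metis Ck_on.simps(2))
      show "?k differentiable at (Y (0, t))" using k.C2 Yin[OF z(1)] by (metis Ck_on.simps(2))
    qed
    also have "Y (0, t) = (?x t, vel ?x t)"
      using vx[OF tJ[OF t]] \<Gamma>0[of t] tJ[OF t] J(2) by (auto simp: Y_def)
    also have "\<D> Y (0, t) = (\<lambda>v. (\<D> ?y (0, t) v, \<D>2 ?y (0, t) v (0, 1)))"
      unfolding Y_def by (rule D_eqI[OF has_derivative_Pair[OF C1_has_derivative[OF Cy z(2)] C1_has_derivative[OF C1y z(2)]]])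
    also have "\<D>2 ?y (0, t) (1, 0) (0, 1) = \<eta>' t"
      unfolding \<eta>'_def by (rule D2_symmetric_vector[OF Cy O1 z(2)])
    finally show ?thesis by (simp add: \<eta>_def)
  qed
  then have "integral {a..b} (\<lambda>t. \<D> G (0, t) (1, 0)) = integral {a..b} (\<lambda>t. \<D> ?k (?x t, vel ?x t) (\<eta> t, \<eta>' t))"
    by (rule integral_cong)
  also have "\<dots> = integral {a..b} (\<lambda>t. euler_expr ?k ?x t (\<eta> t))"
  proof (rule k.integration_by_parts_along_curve[OF J(1) x(1) _ J(4,3) \<eta>d])
    show "?x t \<in> chart_range c \<and> vel ?x t \<noteq> 0" if "t \<in> J" for t
      using x(2)[OF that] chart_in[OF J(5)[OF that]] by blast
  qed (use \<eta>0 in simp_all)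
  also have "\<dots> = integral {a..b} (\<lambda>t. euler_expr ?k ?x t (vel (\<lambda>s. ?y (s, t)) 0))"
    by (rule integral_cong) (simp add: vector_derivative_at[OF \<eta>vel])
  finally show ?thesis using d0 by simp
qed

end

lemma max_power_C1:
  "((\<lambda>r. (max 0 r) ^ Suc (Suc n)) has_vector_derivative real (Suc (Suc n)) * (max 0 r) ^ Suc n) (at (r::real))"
proof -
  consider "r > 0" | "r < 0" | "r = 0" by linarith
  then show ?thesis
  proof cases
    case 1
    have "((\<lambda>r. r ^ Suc (Suc n)) has_vector_derivative real (Suc (Suc n)) * r ^ Suc n) (at r)"
      unfolding has_real_derivative_iff_has_vector_derivative[symmetric] by (rule DERIV_cong[OF DERIV_pow]) simp
    then have "((\<lambda>r. (max 0 r) ^ Suc (Suc n)) has_vector_derivative real (Suc (Suc n)) * r ^ Suc n) (at r)"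
      by (rule has_vector_derivative_transform_within_open[where S="{0<..}"]) (use 1 in auto)
    then show ?thesis using 1 by simp
  next
    case 2
    have "((\<lambda>r. (max 0 r) ^ Suc (Suc n)) has_vector_derivative 0) (at r)"
      by (rule has_vector_derivative_transform_within_open[where S="{..<0}" and f="\<lambda>_. 0"]) (use 2 in auto)
    then show ?thesis using 2 by simp
  next
    case 3
    have "((\<lambda>h::real. (max 0 h) ^ Suc (Suc n) / h) \<longlongrightarrow> 0) (at 0)"
    proof (rule Lim_null_comparison)
      show "\<forall>\<^sub>F h in at 0. norm ((max 0 h) ^ Suc (Suc n) / h) \<le> (max 0 h) ^ Suc n" for h :: real
        by (rule eventuallyI) (auto simp: max_def)
      have "isCont (\<lambda>h::real. (max 0 h) ^ Suc n) 0" by (intro continuous_intros)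
      then show "((\<lambda>h::real. (max 0 h) ^ Suc n) \<longlongrightarrow> 0) (at 0)" by (simp add: isCont_def)
    qed
    then have "((\<lambda>r::real. (max 0 r) ^ Suc (Suc n)) has_real_derivative 0) (at 0)"
      by (simp add: DERIV_def)
    then show ?thesis using 3 by (simp add: has_real_derivative_iff_has_vector_derivative)
  qed
qed

text \<open>The source of bump functions: their second derivatives must be continuous, hence the third power.\<close>

lemma Ck_on_max_cube: "Ck_on (Suc (Suc 0)) UNIV (\<lambda>r::real. (max 0 r) ^ 3)"
proof -
  have c: "Ck_on 0 UNIV (\<lambda>r::real. real (Suc (Suc 0)) * (max 0 r) ^ Suc 0)"
    by (auto intro!: continuous_intros)
  have C1: "Ck_on (Suc 0) UNIV (\<lambda>r::real. (max 0 r) ^ Suc (Suc 0))"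
    by (rule Ck_on_real_SucI[OF open_UNIV max_power_C1 c])
  have "Ck_on (Suc 0) UNIV (\<lambda>r::real. real (Suc (Suc (Suc 0))) * (max 0 r) ^ Suc (Suc 0))"
    by (rule Ck_on_mult[OF Ck_on_const C1 open_UNIV])
  then have "Ck_on (Suc (Suc 0)) UNIV (\<lambda>r::real. (max 0 r) ^ Suc (Suc (Suc 0)))"
    by (rule Ck_on_real_SucI[OF open_UNIV max_power_C1])
  then show ?thesis by (simp add: numeral_3_eq_3 del: Ck_on.simps)
qed

section \<open>Geodesics are the extremals in charts\<close>

context manifold
begin

lemma extremal_imp_geodesic:
  assumes k: "homogeneous_lagrangian (chart_range c) (lrep F c)" and c: "c \<in> A"
    and x: "extremal (chart_range c) (lrep F c) I x" and ne: "I \<noteq> {}"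
  shows "geodesic A F I (\<lambda>t. chart_inv c (x t))"
proof -
  interpret k: homogeneous_lagrangian "chart_range c" "lrep F c" by (rule k)
  have I: "open I" "is_interval I" and Cx: "Ck_on (Suc (Suc 0)) I x"
    and xU: "\<And>t. t \<in> I \<Longrightarrow> x t \<in> chart_range c" "\<And>t. t \<in> I \<Longrightarrow> vel x t \<noteq> 0"
    and EL: "\<And>t w. t \<in> I \<Longrightarrow> euler_expr (lrep F c) x t w = 0"
    using x unfolding k.extremal_iff_euler_expr by blast+
  let ?\<gamma> = "\<lambda>t. chart_inv c (x t)"
  have sx: "snd c (?\<gamma> t) = x t" if "t \<in> I" for t using chart_chart_inv[OF c xU(1)[OF that]] .
  have \<gamma>: "?\<gamma> t \<in> fst c" if "t \<in> I" for t using chart_inv_in[OF c xU(1)[OF that]] .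
  have vs: "vel (\<lambda>t. snd c (?\<gamma> t)) t = vel x t" if "t \<in> I" for t by (rule vel_cong[OF I(1) that sx])
  have Cs: "Ck_on (Suc (Suc 0)) I (\<lambda>t. snd c (?\<gamma> t))" 
    by (subst Ck_on_cong[OF I(1), where g = x]) (simp_all add: sx Cx del: Ck_on.simps)
  have dsx: "((\<lambda>t. snd c (?\<gamma> t)) has_vector_derivative vel x t) (at t)" if "t \<in> I" for t
    using Ck_on_real_SucD(1)[OF I(1) Cs that] vs[OF that] by simp
  have EL': "euler_expr (lrep F c) (\<lambda>t. snd c (?\<gamma> t)) t w = 0" if t: "t \<in> I" for t w
  proof -
    have "extremal (chart_range c) (lrep F c) I (\<lambda>t. snd c (?\<gamma> t))" by (rule extremal_cong[OF x]) (simp add: sx)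
    then show ?thesis using t unfolding k.extremal_iff_euler_expr by blast
  qed
  show ?thesis
    unfolding geodesic_def
  proof (intro conjI allI impI ballI)
    show "Ck_map A 2 I ?\<gamma>" by (rule Ck_map_chart_inv[OF c I(1) Cx xU(1)])
    fix t assume t: "t \<in> I"
    have "velocity A ?\<gamma> t = tvec_of A c (snd c (?\<gamma> t)) (vel x t)"
      by (rule velocity_eq_tvec_of[OF c I(1) t \<gamma> dsx[OF t]])
    then have "velocity A ?\<gamma> t c = vel x t" using tvec_of_self[OF c] xU(1)[OF t] sx[OF t] by simp
    then show "velocity A ?\<gamma> t \<noteq> (\<lambda>_. 0)" using xU(2)[OF t] by metis
  next
    fix a b e \<Gamma> assume h: "a < b" "{a..b} \<subseteq> I" "proper_variation A I ?\<gamma> a b e \<Gamma>"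
    have "((\<lambda>s. finsler_length A F a b (\<lambda>t. \<Gamma> (s, t))) has_real_derivative
        integral {a..b} (\<lambda>t. euler_expr (lrep F c) (\<lambda>t. snd c (?\<gamma> t)) t (vel (\<lambda>s. snd c (\<Gamma> (s, t))) 0))) (at 0)"
      by (rule first_variation[OF k c I(1) I(1) order.refl h(2,1) \<gamma> Cs _ h(3)]) (use vs xU(2) in auto)
    moreover have "integral {a..b} (\<lambda>t. euler_expr (lrep F c) (\<lambda>t. snd c (?\<gamma> t)) t (vel (\<lambda>s. snd c (\<Gamma> (s, t))) 0)) = integral {a..b} (\<lambda>t. 0)"
      by (rule integral_cong) (use EL' h(2) in blast)
    ultimately show "((\<lambda>s. finsler_length A F a b (\<lambda>t. \<Gamma> (s, t))) has_real_derivative 0) (at 0)" by simp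
  qed (use I ne in auto)
qed

lemma geodesic_chart_C2:
  assumes c: "c \<in> A" and g: "geodesic A F I \<gamma>" and J: "open J" "J \<subseteq> I" "\<And>t. t \<in> J \<Longrightarrow> \<gamma> t \<in> fst c"
  shows "Ck_on (Suc (Suc 0)) J (\<lambda>t. snd c (\<gamma> t))"
    and "\<And>t. t \<in> J \<Longrightarrow> velocity A \<gamma> t = tvec_of A c (snd c (\<gamma> t)) (vel (\<lambda>t. snd c (\<gamma> t)) t)"
    and "\<And>t. t \<in> J \<Longrightarrow> vel (\<lambda>t. snd c (\<gamma> t)) t \<noteq> 0"
proof -
  have "Ck_map A 2 I \<gamma>" using g by (simp add: geodesic_def)
  from Ck_map_chart[OF this c] show C: "Ck_on (Suc (Suc 0)) J (\<lambda>t. snd c (\<gamma> t))"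
    by (rule Ck_on_subset) (use J in auto)
  show v: "velocity A \<gamma> t = tvec_of A c (snd c (\<gamma> t)) (vel (\<lambda>t. snd c (\<gamma> t)) t)" if "t \<in> J" for t
    by (rule velocity_eq_tvec_of[OF c J(1) that J(3) Ck_on_real_SucD(1)[OF J(1) C that]])
  show "vel (\<lambda>t. snd c (\<gamma> t)) t \<noteq> 0" if t: "t \<in> J" for t
  proof
    assume "vel (\<lambda>t. snd c (\<gamma> t)) t = 0"
    then have "velocity A \<gamma> t = (\<lambda>d. 0)" using v[OF t] tvec_of_zero[OF c chart_in[OF J(3)[OF t]]] by simp
    moreover have "velocity A \<gamma> t \<noteq> (\<lambda>d. 0)" using g t J(2) by (auto simp: geodesic_def)
    ultimately show False by simp
  qed
qed

text \<open>The fundamental lemma of the calculus of variations. If the Euler-Lagrange expression in the direction \<open>w\<close>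
were not zero at \<open>t0\<close>, it would keep its sign nearby, and the variation by a bump function times \<open>w\<close> would
have a nonzero first variation. The variation does not move the curve away from \<open>t0\<close>, so it is
defined on all of \<open>I\<close>, although the geodesic may leave the chart.\<close>

lemma geodesic_imp_extremal:
  assumes k: "homogeneous_lagrangian (chart_range c) (lrep F c)" and c: "c \<in> A"
    and g: "geodesic A F I \<gamma>" and J: "open J" "is_interval J" "J \<subseteq> I" "\<And>t. t \<in> J \<Longrightarrow> \<gamma> t \<in> fst c"
  shows "extremal (chart_range c) (lrep F c) J (\<lambda>t. snd c (\<gamma> t))"
proof -
  interpret k: homogeneous_lagrangian "chart_range c" "lrep F c" by (rule k)
  let ?k = "lrep F c" and ?x = "\<lambda>t. snd c (\<gamma> t)"
  have Cx: "Ck_on (Suc (Suc 0)) J ?x" by (rule geodesic_chart_C2(1)[OF c g J(1,3,4)])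
  have v0: "vel ?x t \<noteq> 0" if "t \<in> J" for t by (rule geodesic_chart_C2(3)[OF c g J(1,3,4) that])
  have I: "open I" using g by (simp add: geodesic_def)
  have xU: "?x t \<in> chart_range c \<and> vel ?x t \<noteq> 0" if "t \<in> J" for t using v0[OF that] chart_in[OF J(4)[OF that]] by blast
  have "euler_expr ?k ?x t0 w = 0" if t0: "t0 \<in> J" for t0 w
  proof (rule ccontr)
    define E where "E = (\<lambda>t. euler_expr ?k ?x t w)"
    assume "euler_expr ?k ?x t0 w \<noteq> 0"
    then have E0: "E t0 \<noteq> 0" by (simp add: E_def)
    have cE: "continuous_on J E" unfolding E_def by (rule k.euler_expr_continuous[OF J(1) Cx xU])
    have "open (J \<inter> (\<lambda>t. E t * E t0) -` {0<..})"
      by (rule continuous_open_preimage) (auto intro!: continuous_intros cE J)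
    moreover have "t0 \<in> J \<inter> (\<lambda>t. E t * E t0) -` {0<..}" using t0 E0 by (simp add: zero_less_mult_iff) linarith
    ultimately obtain r where r: "r > 0" "cball t0 r \<subseteq> J \<inter> (\<lambda>t. E t * E t0) -` {0<..}"
      using open_contains_cball by metis
    define \<epsilon> where "\<epsilon> = r / 2"
    have \<epsilon>: "\<epsilon> > 0" using r by (simp add: \<epsilon>_def)
    let ?a = "t0 - \<epsilon>" and ?b = "t0 + \<epsilon>"
    define N where "N = {t0 - r<..<t0 + r}"
    have N: "open N" "N \<subseteq> J" "{?a..?b} \<subseteq> N" "t0 \<in> N"
      using r \<epsilon> by (auto simp: N_def \<epsilon>_def subset_iff dist_real_def)
    have Epos: "E t * E t0 > 0" if "t \<in> {?a..?b}" for t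
      using that r \<epsilon> by (auto simp: \<epsilon>_def subset_iff dist_real_def)
    define bump where "bump = (\<lambda>t. (max 0 (\<epsilon>\<^sup>2 - (t - t0)\<^sup>2)) ^ 3)"
    have "Ck_on (Suc (Suc 0)) UNIV (\<lambda>t. \<epsilon>\<^sup>2 - (t - t0)\<^sup>2)"
      by (intro Ck_on_diff Ck_on_power Ck_on_const Ck_on_linear[OF bounded_linear_ident] open_UNIV)
    from Ck_on_compose[OF this Ck_on_max_cube subset_UNIV open_UNIV]
    have Cb: "Ck_on (Suc (Suc 0)) UNIV bump" unfolding bump_def .
    have b0: "bump t = 0" if "\<epsilon> \<le> \<bar>t - t0\<bar>" for t
    proof -
      have "\<epsilon>\<^sup>2 \<le> (t - t0)\<^sup>2" using that \<epsilon> by (simp add: abs_le_square_iff[symmetric])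
      then show ?thesis by (simp add: bump_def)
    qed
    have bnn: "bump t \<ge> 0" for t by (simp add: bump_def)
    have bt0: "bump t0 > 0" using \<epsilon> by (simp add: bump_def)
    define B where "B = \<epsilon> ^ 6"
    have bB: "bump t \<le> B" for t
    proof -
      have "(max 0 (\<epsilon>\<^sup>2 - (t - t0)\<^sup>2)) ^ 3 \<le> (\<epsilon>\<^sup>2) ^ 3" by (rule power_mono) auto
      then show ?thesis by (simp add: bump_def B_def flip: power_mult)
    qed
    have K: "compact (?x ` {?a..?b})" "?x ` {?a..?b} \<subseteq> chart_range c"
      using N xU Ck_on_continuous[OF Cx] by (auto intro!: compact_continuous_image intro: continuous_on_subset)
    obtain \<rho> where \<rho>: "\<rho> > 0" "(\<Union>z\<in>?x ` {?a..?b}. cball z \<rho>) \<subseteq> chart_range c"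
      using compact_subset_open_imp_cball_epsilon_subset[OF K(1) open_range[OF c] K(2)] by metis
    \<comment> \<open>\<open>B\<close> bounds the bump function, so a variation by less than \<open>e\<close> moves the curve by at most \<open>\<rho>\<close>.\<close>
    define e where "e = \<rho> / (B * norm w + 1)"
    have B: "B > 0" using \<epsilon> by (simp add: B_def)
    have D: "B * norm w + 1 > 0" using B by (simp add: add_nonneg_pos)
    have e: "e > 0" using \<rho> D by (simp add: e_def)
    define Y where "Y = (\<lambda>z::real \<times> real. ?x (snd z) + (fst z * bump (snd z)) *\<^sub>R w)"
    have YU: "Y (s, t) \<in> chart_range c" if "s \<in> {-e<..<e}" "t \<in> N" for s t
    proof (cases "t \<in> {?a..?b}")
      case True
      have "norm ((s * bump t) *\<^sub>R w) = \<bar>s\<bar> * (bump t * norm w)" using bnn[of t] by (simp add: abs_mult)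
      also have "\<dots> \<le> e * (B * norm w)"
        using that(1) bB[of t] bnn[of t] by (intro mult_mono mult_right_mono) auto
      also have "\<dots> \<le> e * (B * norm w + 1)" using e by simp
      also have "\<dots> = \<rho>" using D by (simp add: e_def)
      finally have "norm ((s * bump t) *\<^sub>R w) \<le> \<rho>" .
      then have "Y (s, t) \<in> cball (?x t) \<rho>" by (simp add: Y_def dist_norm)
      then show ?thesis using \<rho>(2) True by blast
    next
      case False
      then have "\<epsilon> \<le> \<bar>t - t0\<bar>" by auto
      then show ?thesis using b0[of t] xU[of t] N(2) that(2) by (auto simp: Y_def)
    qed
    define \<Gamma> where "\<Gamma> = (\<lambda>z::real \<times> real. if snd z \<in> N then chart_inv c (Y z) else \<gamma> (snd z))"
    have inv: "chart_inv c (?x t) = \<gamma> t" if "t \<in> N" for t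
      using chart_inv_chart[OF c] J(4) N(2) that by blast
    have \<Gamma>out: "\<Gamma> (s, t) = \<gamma> t" if "\<epsilon> \<le> \<bar>t - t0\<bar>" for s t
      using b0[OF that] inv[of t] by (simp add: \<Gamma>_def Y_def)
    have CY: "Ck_on (Suc (Suc 0)) ({-e<..<e} \<times> N) Y"
    proof -
      have O: "open ({-e<..<e} \<times> N)" by (intro open_Times N) auto
      have "Ck_on (Suc (Suc 0)) ({-e<..<e} \<times> N) (\<lambda>z. ?x (snd z))"
        by (rule Ck_on_compose[OF Ck_on_linear[OF bounded_linear_snd] Ck_on_subset[OF Cx N(2)] _ O]) auto
      moreover have "Ck_on (Suc (Suc 0)) ({-e<..<e} \<times> N) (\<lambda>z. bump (snd z))"
        by (rule Ck_on_compose[OF Ck_on_linear[OF bounded_linear_snd] Cb _ O]) auto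
      ultimately show ?thesis unfolding Y_def
        by (intro Ck_on_add Ck_on_scaleR Ck_on_mult Ck_on_const Ck_on_linear[OF bounded_linear_fst] O)
    qed
    have C\<Gamma>: "Ck_map A 2 ({-e<..<e} \<times> I) \<Gamma>"
    proof (rule Ck_map_local)
      fix z assume z: "z \<in> {-e<..<e} \<times> I"
      show "\<exists>T h. open T \<and> z \<in> T \<and> Ck_map A 2 T h \<and> (\<forall>w\<in>T. \<Gamma> w = h w)"
      proof (cases "snd z \<in> N")
        case True
        let ?T = "{-e<..<e} \<times> N"
        have "open ?T" by (intro open_Times N) auto
        moreover have "z \<in> ?T" using z True by (auto simp: mem_Times_iff)
        moreover have "Ck_map A 2 ?T (\<lambda>z. chart_inv c (Y z))"
          by (rule Ck_map_chart_inv[OF c \<open>open ?T\<close> CY]) (use YU in auto)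
        moreover have "\<forall>w\<in>?T. \<Gamma> w = chart_inv c (Y w)" by (auto simp: \<Gamma>_def)
        ultimately show ?thesis by blast
      next
        case False
        let ?T = "{-e<..<e} \<times> (I - cball t0 \<epsilon>)"
        have "open ?T" by (intro open_Times open_Diff I) auto
        moreover have "z \<in> ?T" using z False N(3) by (auto simp: mem_Times_iff dist_real_def abs_le_iff subset_iff)
        moreover have "Ck_map A 2 ?T (\<lambda>z. \<gamma> (snd z))"
          by (rule Ck_map_compose[OF _ I Ck_on_linear[OF bounded_linear_snd] \<open>open ?T\<close>]) (use g in \<open>auto simp: geodesic_def\<close>)
        moreover have "\<forall>w\<in>?T. \<Gamma> w = \<gamma> (snd w)" using \<Gamma>out by (auto simp: dist_real_def abs_minus_commute)
        ultimately show ?thesis by blast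
      qed
    qed
    have pv: "proper_variation A I \<gamma> ?a ?b e \<Gamma>"
      unfolding proper_variation_def using e C\<Gamma> \<Gamma>out \<epsilon> inv by (auto simp: \<Gamma>_def Y_def)
    have ab: "?a < ?b" "{?a..?b} \<subseteq> J" "{?a..?b} \<subseteq> I" using \<epsilon> N J(3) by auto
    have "((\<lambda>s. finsler_length A F ?a ?b (\<lambda>t. \<Gamma> (s, t))) has_real_derivative
        integral {?a..?b} (\<lambda>t. euler_expr ?k ?x t (vel (\<lambda>s. snd c (\<Gamma> (s, t))) 0))) (at 0)"
      by (rule first_variation[OF k c I J(1,3) ab(2,1) J(4) Cx v0 pv])
    moreover have "((\<lambda>s. finsler_length A F ?a ?b (\<lambda>t. \<Gamma> (s, t))) has_real_derivative 0) (at 0)"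
      using g ab pv unfolding geodesic_def by blast
    ultimately have "integral {?a..?b} (\<lambda>t. euler_expr ?k ?x t (vel (\<lambda>s. snd c (\<Gamma> (s, t))) 0)) = 0"
      by (rule DERIV_unique)
    moreover have "integral {?a..?b} (\<lambda>t. euler_expr ?k ?x t (vel (\<lambda>s. snd c (\<Gamma> (s, t))) 0)) = integral {?a..?b} (\<lambda>t. bump t * E t)"
    proof (rule integral_cong)
      fix t assume t: "t \<in> {?a..?b}"
      then have tN: "t \<in> N" using N by blast
      have "((\<lambda>s. ?x t + (s * bump t) *\<^sub>R w) has_vector_derivative bump t *\<^sub>R w) (at 0)"
        by (auto intro!: derivative_eq_intros)
      then have "((\<lambda>s. snd c (\<Gamma> (s, t))) has_vector_derivative bump t *\<^sub>R w) (at 0)"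
        by (rule has_vector_derivative_transform_within_open[where S="{-e<..<e}"])
           (use e tN chart_chart_inv[OF c YU] in \<open>auto simp: \<Gamma>_def Y_def\<close>)
      then have "vel (\<lambda>s. snd c (\<Gamma> (s, t))) 0 = bump t *\<^sub>R w" by (rule vector_derivative_at)
      moreover have "linear (euler_expr ?k ?x t)" using k.euler_expr_linear[OF J(1) Cx xU] t ab by blast
      ultimately show "euler_expr ?k ?x t (vel (\<lambda>s. snd c (\<Gamma> (s, t))) 0) = bump t * E t"
        by (simp add: linear_scale E_def)
    qed
    ultimately have "integral {?a..?b} (\<lambda>t. bump t * E t) * E t0 = 0" by simp
    then have int0: "integral {?a..?b} (\<lambda>t. (bump t * E t) * E t0) = 0" by simp
    have "continuous_on {?a..?b} (\<lambda>t. (bump t * E t) * E t0)"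
      using Ck_on_continuous[OF Cb] cE ab(2) by (intro continuous_intros) (auto intro: continuous_on_subset)
    moreover have "(bump t * E t) * E t0 \<ge> 0" if "t \<in> {?a..?b}" for t
      using bnn[of t] Epos[OF that] by (simp add: mult.assoc)
    ultimately have "\<forall>t\<in>{?a..?b}. (bump t * E t) * E t0 = 0"
      using integral_eq_0_iff[OF _ ab(1)] int0 by blast
    then have "bump t0 * (E t0 * E t0) = 0" using \<epsilon> by (auto simp: mult.assoc)
    then show False using bt0 E0 by simp
  qed
  then show ?thesis unfolding k.extremal_iff_euler_expr using J Cx xU by blast
qed

end

section \<open>The even and the odd part of a Finsler metric\<close>

definition reverse :: "('e::real_normed_vector \<times> 'e \<Rightarrow> real) \<Rightarrow> 'e \<times> 'e \<Rightarrow> real" where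
  "reverse k z = k (fst z, - snd z)"

lemma bounded_linear_flip: "bounded_linear (\<lambda>z::'e::real_normed_vector \<times> 'e. (fst z, - snd z))"
  by (intro bounded_linear_Pair bounded_linear_fst bounded_linear_minus bounded_linear_snd)

context homogeneous_lagrangian
begin

lemma C2_reverse: "Ck_on (Suc (Suc 0)) (U \<times> (- {0})) (reverse k)"
  unfolding reverse_def[abs_def]
  by (rule Ck_on_compose[OF Ck_on_linear[OF bounded_linear_flip] C2 _ open_TU]) auto

lemma reverse_homogeneous: "homogeneous_lagrangian U (reverse k)"
proof
  show "reverse k (p, a *\<^sub>R u) = a * reverse k (p, u)" if "p \<in> U" "u \<noteq> 0" "a > 0" for p u a
    using hom[of p "- u" a] that by (simp add: reverse_def)
qed (rule open_U, rule C2_reverse)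

lemma D_reverse: assumes "p \<in> U" "u \<noteq> 0" shows "\<D> (reverse k) (p, u) (a, b) = \<D> k (p, - u) (a, - b)"
proof -
  let ?m = "\<lambda>z::'e \<times> 'e. (fst z, - snd z)"
  have m: "(?m has_derivative ?m) (at z)" for z
    by (rule bounded_linear_imp_has_derivative[OF bounded_linear_flip])
  have "k differentiable (at (?m (p, u)))" using C2 assms by (auto simp: mem_Times_iff)
  from D_compose[OF differentiableI[OF m] this, of "(a, b)"] show ?thesis
    by (simp add: reverse_def[abs_def] D_eqI[OF m])
qed

lemma D2_reverse: assumes "p \<in> U" "u \<noteq> 0" shows "\<D>2 (reverse k) (p, u) (0, w) (0, y) = \<D>2 k (p, - u) (0, w) (0, y)"
proof -
  let ?m = "\<lambda>z::'e \<times> 'e. (fst z, - snd z)"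
  have z: "(p, u) \<in> U \<times> (- {0})" "(p, - u) \<in> U \<times> (- {0})" using assms by auto
  have m: "(?m has_derivative ?m) (at z)" for z
    by (rule bounded_linear_imp_has_derivative[OF bounded_linear_flip])
  have dm: "(\<lambda>z. \<D> k z (0, - y)) differentiable (at (?m (p, u)))"
    using C1[of "(0, - y)"] z(2) by simp
  have "\<D>2 (reverse k) (p, u) (0, w) (0, y) = \<D> (\<lambda>z. \<D> k (?m z) (0, - y)) (p, u) (0, w)"
  proof (rule fun_cong[OF D_cong[OF open_TU z(1)]])
    show "\<D> (reverse k) z (0, y) = \<D> k (?m z) (0, - y)" if "z \<in> U \<times> (- {0})" for z
      using D_reverse[of "fst z" "snd z" 0 y] that by (simp add: mem_Times_iff)
  qed
  also have "\<dots> = \<D>2 k (p, - u) (0, - w) (0, - y)"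
    using D_compose[OF differentiableI[OF m] dm, of "(0, w)"] by (simp add: D_eqI[OF m])
  also have "\<dots> = \<D>2 k (p, - u) (0, w) (0, y)"
    using linear_neg[OF linear_D2_left[OF z(2), of "(0, - y)"], of "(0, w)"]
      linear_neg[OF linear_D2_right[OF z(2), of "(0, w)"], of "(0, y)"] by simp
  finally show ?thesis .
qed

end

lemma homogeneous_lincomb:
  fixes a b :: real
  assumes "homogeneous_lagrangian U k1" "homogeneous_lagrangian U k2"
  shows "homogeneous_lagrangian U (\<lambda>z. a * k1 z + b * k2 z)"
    and "\<And>z v. z \<in> U \<times> (- {0}) \<Longrightarrow> \<D> (\<lambda>z. a * k1 z + b * k2 z) z v = a * \<D> k1 z v + b * \<D> k2 z v"
    and "\<And>z v w. z \<in> U \<times> (- {0}) \<Longrightarrow> \<D>2 (\<lambda>z. a * k1 z + b * k2 z) z v w = a * \<D>2 k1 z v w + b * \<D>2 k2 z v w"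
proof -
  interpret k1: homogeneous_lagrangian U k1 by (rule assms(1))
  interpret k2: homogeneous_lagrangian U k2 by (rule assms(2))
  let ?k = "\<lambda>z. a * k1 z + b * k2 z"
  show "homogeneous_lagrangian U ?k"
  proof
    show "Ck_on (Suc (Suc 0)) (U \<times> (- {0})) ?k"
      by (intro Ck_on_add Ck_on_mult Ck_on_const k1.C2 k2.C2 k1.open_TU)
    show "?k (p, c *\<^sub>R u) = c * ?k (p, u)" if "p \<in> U" "u \<noteq> 0" "c > 0" for p u c
      using k1.hom[OF that] k2.hom[OF that] by (simp add: algebra_simps)
  qed (rule k1.open_U)
  show 1: "\<D> ?k z v = a * \<D> k1 z v + b * \<D> k2 z v" if "z \<in> U \<times> (- {0})" for z v
    by (rule fun_cong[OF D_eqI[OF has_derivative_add[OF has_derivative_mult_right[OF C1_has_derivative[OF k1.C2 that]]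
            has_derivative_mult_right[OF C1_has_derivative[OF k2.C2 that]]]]])
  show "\<D>2 ?k z v w = a * \<D>2 k1 z v w + b * \<D>2 k2 z v w" if z: "z \<in> U \<times> (- {0})" for z v w
  proof -
    have "\<D>2 ?k z v w = \<D> (\<lambda>z. a * \<D> k1 z w + b * \<D> k2 z w) z v"
      by (rule fun_cong[OF D_cong[OF k1.open_TU z]]) (rule 1)
    also have "\<dots> = a * \<D>2 k1 z v w + b * \<D>2 k2 z v w"
      by (rule fun_cong[OF D_eqI[OF has_derivative_add[OF has_derivative_mult_right[OF C1_has_derivative[OF k1.C1 z]]
            has_derivative_mult_right[OF C1_has_derivative[OF k2.C1 z]]]]])
    finally show ?thesis .
  qed
qed

lemma extremal_lincomb:
  fixes a b :: real
  assumes h: "homogeneous_lagrangian U k1" "homogeneous_lagrangian U k2" and e: "extremal U k1 I x" "extremal U k2 I x"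
  shows "extremal U (\<lambda>z. a * k1 z + b * k2 z) I x"
proof -
  let ?k = "\<lambda>z. a * k1 z + b * k2 z"
  have I: "open I" and z: "\<And>t. t \<in> I \<Longrightarrow> (x t, vel x t) \<in> U \<times> (- {0})" using e(1) by (auto simp: extremal_def)
  have "((\<lambda>s. \<D> ?k (x s, vel x s) (0, y)) has_vector_derivative \<D> ?k (x t, vel x t) (y, 0)) (at t)" if t: "t \<in> I" for t y
  proof -
    have "((\<lambda>s. \<D> k1 (x s, vel x s) (0, y)) has_vector_derivative \<D> k1 (x t, vel x t) (y, 0)) (at t)"
      "((\<lambda>s. \<D> k2 (x s, vel x s) (0, y)) has_vector_derivative \<D> k2 (x t, vel x t) (y, 0)) (at t)"
      using e t by (auto simp: extremal_def)
    then have "((\<lambda>s. a * \<D> k1 (x s, vel x s) (0, y) + b * \<D> k2 (x s, vel x s) (0, y)) has_vector_derivative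
        a * \<D> k1 (x t, vel x t) (y, 0) + b * \<D> k2 (x t, vel x t) (y, 0)) (at t)"
      by (intro has_vector_derivative_add has_vector_derivative_mult_right)
    then have "((\<lambda>s. \<D> ?k (x s, vel x s) (0, y)) has_vector_derivative
        a * \<D> k1 (x t, vel x t) (y, 0) + b * \<D> k2 (x t, vel x t) (y, 0)) (at t)"
      by (rule has_vector_derivative_transform_within_open[OF _ I t]) (rule homogeneous_lincomb(2)[OF h z, symmetric])
    then show ?thesis unfolding homogeneous_lincomb(2)[OF h z[OF t]] .
  qed
  then show ?thesis using e(1) unfolding extremal_def by blast
qed

lemma shares_extremals_lincomb:
  "shares_extremals U F k1 \<Longrightarrow> shares_extremals U F k2 \<Longrightarrow> shares_extremals U F (\<lambda>z. a * k1 z + b * k2 z)"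
  unfolding shares_extremals_def by (simp add: homogeneous_lincomb(1) extremal_lincomb)

text \<open>Otherwise the form would be positive at \<open>w + t y\<close> for a small multiple \<open>t\<close> of \<open>B w y\<close>.\<close>

lemma negative_semidefinite_kernel:
  fixes B :: "'a::real_vector \<Rightarrow> 'a \<Rightarrow> real"
  assumes "\<And>w. linear (B w)" "\<And>w. linear (\<lambda>v. B v w)" "\<And>v w. B v w = B w v" "\<And>w. B w w \<le> 0" "B w w = 0"
  shows "B w y = 0"
proof (rule ccontr)
  assume n: "B w y \<noteq> 0"
  \<comment> \<open>The denominator is positive; this \<open>t\<close> gives \<open>(B w y)\<^sup>2 (2 - B y y) / (1 - B y y)\<^sup>2\<close> as the value of the form.\<close>
  define t where "t = B w y / (1 - B y y)"
  have p: "1 - B y y > 0" using assms(4)[of y] by simp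
  have "B (w + t *\<^sub>R y) (w + t *\<^sub>R y) = 2 * t * B w y + t\<^sup>2 * B y y"
    using assms(3)[of y w] assms(5)
    by (simp add: linear_add[OF assms(1)] linear_add[OF assms(2)] linear_scale[OF assms(1)] linear_scale[OF assms(2)]
        power2_eq_square algebra_simps)
  also have "\<dots> = t * (2 * B w y + t * B y y)" by (simp add: power2_eq_square algebra_simps)
  also have "t * B y y = B w y * (B y y / (1 - B y y))" by (simp add: t_def)
  also have "t * (2 * B w y + B w y * (B y y / (1 - B y y))) = (B w y)\<^sup>2 * ((2 - B y y) / (1 - B y y)\<^sup>2)"
    using p by (simp add: t_def power2_eq_square field_simps)
  also have "\<dots> > 0" using n p by (intro mult_pos_pos divide_pos_pos) auto
  finally show False using assms(4)[of "w + t *\<^sub>R y"] by simp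
qed

lemma continuous_on_Sup_compact:
  fixes g :: "'a::metric_space \<Rightarrow> 'b::metric_space \<Rightarrow> real"
  assumes "compact C" "C \<noteq> {}" "continuous_on (S \<times> C) (\<lambda>z. g (fst z) (snd z))"
  shows "continuous_on S (\<lambda>x. Sup (g x ` C))"
proof -
  have att: "\<exists>w\<in>C. Sup (g x ` C) = g x w \<and> (\<forall>v\<in>C. g x v \<le> g x w)" if "x \<in> S" for x
  proof -
    have "continuous_on C (\<lambda>w. (x, w))" by (intro continuous_on_Pair continuous_on_const continuous_on_id)
    then have "continuous_on C (g x)"
      using continuous_on_compose2[OF assms(3), of C "\<lambda>w. (x, w)"] that by auto
    then obtain w where w: "w \<in> C" "\<forall>v\<in>C. g x v \<le> g x w" using continuous_attains_sup[OF assms(1,2)] by blast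
    then have "Sup (g x ` C) = g x w" by (intro cSup_eq_maximum) auto
    with w show ?thesis by blast
  qed
  show ?thesis
    unfolding continuous_on_iff
  proof (intro ballI allI impI)
    fix x and e :: real assume x: "x \<in> S" and e: "e > 0"
    obtain h where e2: "h > 0" "h < e" using dense[OF e] by blast
    obtain X where X: "x \<in> X" "open X"
      "\<forall>y\<in>X \<inter> S. \<forall>t\<in>C. dist (g (fst (y, t)) (snd (y, t))) (g (fst (x, t)) (snd (x, t))) \<le> h"
      by (rule continuous_on_prod_compactE[OF assms(3,1) x e2(1)])
    obtain d where d: "d > 0" "\<And>y. dist y x < d \<Longrightarrow> y \<in> X" using X(1,2) open_dist by metis
    show "\<exists>d>0. \<forall>x'\<in>S. dist x' x < d \<longrightarrow> dist (Sup (g x' ` C)) (Sup (g x ` C)) < e"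
    proof (intro exI[of _ d] conjI ballI impI d(1))
      fix y assume y: "y \<in> S" "dist y x < d"
      have c: "\<bar>g y t - g x t\<bar> \<le> h" if "t \<in> C" for t
        using X(3) d(2)[OF y(2)] y(1) that by (auto simp: dist_real_def)
      obtain w where w: "w \<in> C" "Sup (g x ` C) = g x w" "\<forall>v\<in>C. g x v \<le> g x w" using att[OF x] by blast
      obtain v where v: "v \<in> C" "Sup (g y ` C) = g y v" "\<forall>w\<in>C. g y w \<le> g y v" using att[OF y(1)] by blast
      have "g x w - h \<le> g y w" "g y w \<le> g y v" "g y v \<le> g x v + h" "g x v \<le> g x w"
        using c[OF w(1)] c[OF v(1)] w v by (auto simp: abs_le_iff algebra_simps)
      then have "\<bar>g y v - g x w\<bar> \<le> h" by (simp add: abs_le_iff)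
      then show "dist (Sup (g y ` C)) (Sup (g x ` C)) < e" using e2(2) w(2) v(2) by (simp add: dist_real_def)
    qed
  qed
qed

text \<open>Geodesic reversibility in a chart. Extremals carry a direction of time: traversed backwards, an
extremal of \<open>F\<close> is one of \<open>reverse F\<close>, so the assumption says that reversed extremals of \<open>F\<close> are extremals of
\<open>F\<close>.\<close>

locale reversible_geodesics = finsler_domain U F for U :: "'e::euclidean_space set" and F +
  assumes reverse_extremal: "\<And>I x. extremal U F I x \<Longrightarrow> extremal U (reverse F) I x"
begin

text \<open>The even and the odd part of \<open>F\<close>, written as linear combinations to match \<open>homogeneous_lincomb\<close>.\<close>

definition Fe :: "'e \<times> 'e \<Rightarrow> real" where "Fe = (\<lambda>z. 1/2 * F z + 1/2 * reverse F z)"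
definition Fo :: "'e \<times> 'e \<Rightarrow> real" where "Fo = (\<lambda>z. 1/2 * F z + (- 1/2) * reverse F z)"

lemma shares_reverse: "shares_extremals U F (reverse F)"
  using reverse_homogeneous reverse_extremal by (simp add: shares_extremals_def)

lemma shares_Fe: "shares_extremals U F Fe" and shares_Fo: "shares_extremals U F Fo"
  unfolding Fe_def Fo_def by (rule shares_extremals_lincomb[OF shares_extremals_self shares_reverse])+

lemma Fe_even: "Fe (p, - u) = Fe (p, u)" and Fo_odd: "Fo (p, - u) = - Fo (p, u)"
  by (simp_all add: Fe_def Fo_def reverse_def)

sublocale Fo: homogeneous_lagrangian U Fo using shares_Fo by (simp add: shares_extremals_def)

sublocale Fe: finsler_domain U Fe
proof (intro finsler_domain.intro finsler_domain_axioms.intro)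
  show GH: "homogeneous_lagrangian U Fe" using shares_Fe by (simp add: shares_extremals_def)
  interpret Fe: homogeneous_lagrangian U Fe by (rule GH)
  show pG: "Fe (p, u) > 0" if "p \<in> U" "u \<noteq> 0" for p u
    using pos[of p u] pos[of p "- u"] that by (simp add: Fe_def reverse_def)
  fix p u w :: 'e assume a: "p \<in> U" "u \<noteq> 0" "w \<noteq> 0"
  have z: "(p, u) \<in> U \<times> (- {0})" using a by simp
  have GC: "(Fe has_derivative \<D> Fe z) (at z)" "((\<lambda>z. \<D> Fe z v) has_derivative \<D> (\<lambda>z. \<D> Fe z v) z) (at z)"
    if "z \<in> U \<times> (- {0})" for z v
    using C1_has_derivative[OF Fe.C2 that] C1_has_derivative[OF Fe.C1 that] by auto
  have sq: "\<D> (\<lambda>z. (Fe z)\<^sup>2) z v = 2 * Fe z * \<D> Fe z v" if "z \<in> U \<times> (- {0})" for z v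
    using D_eqI[OF has_derivative_power[OF GC(1)[OF that], of 2]] by simp
  have "\<D>2 (\<lambda>z. (Fe z)\<^sup>2) (p, u) (0, w) (0, w) = \<D> (\<lambda>z. 2 * Fe z * \<D> Fe z (0, w)) (p, u) (0, w)"
    by (rule fun_cong[OF D_cong[OF open_TU z]]) (rule sq)
  also have "\<dots> = 2 * Fe (p, u) * \<D>2 Fe (p, u) (0, w) (0, w) + 2 * \<D> Fe (p, u) (0, w) * \<D> Fe (p, u) (0, w)"
    by (rule fun_cong[OF D_eqI[OF has_derivative_mult[OF has_derivative_mult_right[OF GC(1)[OF z]] GC(2)[OF z]]]])
  also have "\<dots> > 0"
  proof (cases "\<exists>c. w = c *\<^sub>R u")
    case True
    then obtain c where c: "w = c *\<^sub>R u" by blast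
    have e: "(0::'e, w) = c *\<^sub>R (0, u)" by (simp add: c)
    have "\<D> Fe (p, u) (0, w) = c * Fe (p, u)"
      unfolding e linear_scale[OF Fe.linear_Dk[OF z]] using Fe.euler[OF a(1,2)] by simp
    moreover have "\<D>2 Fe (p, u) (0, w) (0, w) = 0"
      using linear_scale[OF Fe.linear_D2_left[OF z, of "(0, w)"], of c "(0, u)"] Fe.D2_fibre_radial[OF a(1,2)] by (simp add: c)
    moreover have "c \<noteq> 0" using a(3) c by auto
    ultimately have "\<D> Fe (p, u) (0, w) \<noteq> 0" "\<D>2 Fe (p, u) (0, w) (0, w) = 0" using pG[OF a(1,2)] by auto
    then show ?thesis using zero_less_power2[of "\<D> Fe (p, u) (0, w)"] by (simp add: power2_eq_square)
  next
    case False
    have "\<D>2 F (p, u) (0, w) (0, w) > 0" using D2_fibre_pos[OF a(1,2)] False by blast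
    moreover have "\<D>2 F (p, - u) (0, w) (0, w) > 0"
    proof (rule D2_fibre_pos)
      show "w \<noteq> c *\<^sub>R (- u)" for c using False by (metis scaleR_minus_left scaleR_minus_right)
    qed (use a in auto)
    ultimately have "\<D>2 Fe (p, u) (0, w) (0, w) > 0"
      unfolding Fe_def homogeneous_lincomb(3)[OF homogeneous_lagrangian_axioms reverse_homogeneous z] D2_reverse[OF a(1,2)] by simp
    then have "2 * Fe (p, u) * \<D>2 Fe (p, u) (0, w) (0, w) > 0" using pG[OF a(1,2)] by simp
    then show ?thesis by (simp add: add_pos_nonneg)
  qed
  finally show "\<D>2 (\<lambda>z. (Fe z)\<^sup>2) (p, u) (0, w) (0, w) > 0" .
qed

lemma D2_Fo_odd: "p \<in> U \<Longrightarrow> u \<noteq> 0 \<Longrightarrow> \<D>2 Fo (p, - u) (0, w) (0, y) = - \<D>2 Fo (p, u) (0, w) (0, y)"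
  and D2_Fe_even: "p \<in> U \<Longrightarrow> u \<noteq> 0 \<Longrightarrow> \<D>2 Fe (p, - u) (0, w) (0, y) = \<D>2 Fe (p, u) (0, w) (0, y)"
  using Fo.D2_reverse[of p u y w] Fe.D2_reverse[of p u y w]
    homogeneous_lincomb(3)[OF Fo.homogeneous_lagrangian_axioms Fo.homogeneous_lagrangian_axioms, of "(p, u)" "-1" 0 "(0, y)" "(0, w)"]
  by (simp_all add: reverse_def[abs_def] Fo_odd Fe_even)

text \<open>The Hessian of \<open>Fe\<^sup>2\<close> replaces that of \<open>Fe\<close> since it is definite also in the direction of \<open>u\<close>. Under it \<open>u\<close> is
orthogonal to the kernel of the derivative of \<open>Fe\<close>, on which it is \<open>2 Fe\<close> times the Hessian of \<open>Fe\<close>.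
So the quotient is zero at \<open>u\<close>, and its other critical values are the eigenvalues of the
Hessian of \<open>Fo\<close> relative to that of \<open>Fe\<close>.\<close>

definition rayleigh :: "'e \<times> 'e \<Rightarrow> 'e \<Rightarrow> real" where
  "rayleigh z w = 2 * Fe z * \<D>2 Fo z (0, w) (0, w) / \<D>2 (\<lambda>z. (Fe z)\<^sup>2) z (0, w) (0, w)"

text \<open>The largest eigenvalue of the Hessian of \<open>Fo\<close> relative to that of \<open>Fe\<close> modulo \<open>u\<close>, or zero if all are
negative.\<close>

definition \<Lambda> :: "'e \<times> 'e \<Rightarrow> real" where "\<Lambda> z = Sup (rayleigh z ` (- {0}))"

lemma rayleigh_scale:
  assumes "z \<in> U \<times> (- {0})" "c \<noteq> 0" shows "rayleigh z (c *\<^sub>R w) = rayleigh z w"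
proof -
  have e: "(0::'e, c *\<^sub>R w) = c *\<^sub>R (0, w)" by simp
  have 1: "\<D>2 Fo z (0, c *\<^sub>R w) (0, c *\<^sub>R w) = (c * c) * \<D>2 Fo z (0, w) (0, w)"
    unfolding e linear_scale[OF Fo.linear_D2_left[OF assms(1)]] linear_scale[OF Fo.linear_D2_right[OF assms(1)]] by simp
  have 2: "\<D>2 Fe.L z (0, c *\<^sub>R w) (0, c *\<^sub>R w) = (c * c) * \<D>2 Fe.L z (0, w) (0, w)"
    unfolding e linear_scale[OF C2_linear1[OF Fe.C2_L assms(1)]] linear_scale[OF Fe.linear_D2L[OF assms(1)]] by simp
  show ?thesis unfolding rayleigh_def 1 2 using assms(2) by simp
qed

lemma rayleigh_sphere: assumes "z \<in> U \<times> (- {0})" shows "rayleigh z ` (- {0}) = rayleigh z ` sphere 0 1"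
proof
  show "rayleigh z ` sphere 0 1 \<subseteq> rayleigh z ` (- {0})" by (intro image_mono) auto
  show "rayleigh z ` (- {0}) \<subseteq> rayleigh z ` sphere 0 1"
  proof
    fix r assume "r \<in> rayleigh z ` (- {0})"
    then obtain w where w: "w \<noteq> 0" "r = rayleigh z w" by auto
    then have "r = rayleigh z (inverse (norm w) *\<^sub>R w)" using rayleigh_scale[OF assms] by simp
    moreover have "inverse (norm w) *\<^sub>R w \<in> sphere 0 1" using w by simp
    ultimately show "r \<in> rayleigh z ` sphere 0 1" by blast
  qed
qed

lemma rayleigh_continuous: "continuous_on ((U \<times> (- {0})) \<times> sphere 0 1) (\<lambda>y. rayleigh (fst y) (snd y))"
  unfolding rayleigh_def
proof (intro continuous_intros)
  let ?S = "(U \<times> (- {0::'e})) \<times> sphere (0::'e) 1"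
  show "continuous_on ?S (\<lambda>x. Fe (fst x))"
    by (rule continuous_on_compose2[OF Ck_on_continuous[OF Fe.C2]]) (auto intro!: continuous_intros)
  show "continuous_on ?S (\<lambda>x. \<D>2 Fo (fst x) (0, snd x) (0, snd x))"
    by (rule C2_continuous_D2[OF Fo.C2 open_TU]) (auto intro!: continuous_intros)
  show "continuous_on ?S (\<lambda>x. \<D>2 (\<lambda>z. (Fe z)\<^sup>2) (fst x) (0, snd x) (0, snd x))"
    by (rule C2_continuous_D2[OF Fe.C2_L open_TU]) (auto intro!: continuous_intros)
  have "\<D>2 (\<lambda>z. (Fe z)\<^sup>2) (fst x) (0, snd x) (0, snd x) \<noteq> 0" if x: "x \<in> ?S" for x
  proof -
    have "snd x \<noteq> 0" using x by auto
    then show ?thesis using Fe.posdef[of "fst (fst x)" "snd (fst x)" "snd x"] x by (auto simp: mem_Times_iff)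
  qed
  then show "\<forall>x\<in>?S. \<D>2 (\<lambda>z. (Fe z)\<^sup>2) (fst x) (0, snd x) (0, snd x) \<noteq> 0" by blast
qed

lemma \<Lambda>_continuous: "continuous_on (U \<times> (- {0})) \<Lambda>"
proof -
  have "sphere (0::'e) 1 \<noteq> {}" by simp
  from continuous_on_Sup_compact[OF compact_sphere this rayleigh_continuous]
  show ?thesis by (rule continuous_on_eq) (simp add: \<Lambda>_def rayleigh_sphere)
qed

lemma \<Lambda>_attained:
  assumes "z \<in> U \<times> (- {0})"
  obtains w where "w \<noteq> 0" "\<Lambda> z = rayleigh z w" "\<And>v. v \<noteq> 0 \<Longrightarrow> rayleigh z v \<le> \<Lambda> z"
proof -
  have "continuous_on (sphere 0 1) (\<lambda>w. (z, w))" by (intro continuous_on_Pair continuous_on_const continuous_on_id)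
  then have "continuous_on (sphere 0 1) (rayleigh z)"
    using continuous_on_compose2[OF rayleigh_continuous, of "sphere 0 1" "\<lambda>w. (z, w)"] assms
    by auto
  then obtain w where w: "w \<in> sphere 0 1" "\<forall>v\<in>sphere 0 1. rayleigh z v \<le> rayleigh z w"
    using continuous_attains_sup[OF compact_sphere, of 0 1 "rayleigh z"] by auto
  have "\<Lambda> z = rayleigh z w" unfolding \<Lambda>_def rayleigh_sphere[OF assms] using w by (intro cSup_eq_maximum) auto
  moreover have "rayleigh z v \<le> rayleigh z w" if "v \<noteq> 0" for v
  proof -
    have "rayleigh z v \<in> rayleigh z ` sphere 0 1" using rayleigh_sphere[OF assms] that by blast
    then show ?thesis using w(2) by auto
  qed
  moreover have "w \<noteq> 0" using w(1) by auto
  ultimately show ?thesis using that[of w] by simp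
qed

lemma rayleigh_radial: "p \<in> U \<Longrightarrow> u \<noteq> 0 \<Longrightarrow> rayleigh (p, u) u = 0"
  using Fo.D2_fibre_radial[of p u] by (simp add: rayleigh_def)

lemma \<Lambda>_nonneg: assumes "p \<in> U" "u \<noteq> 0" shows "\<Lambda> (p, u) \<ge> 0"
  using \<Lambda>_attained[of "(p, u)"] rayleigh_radial[OF assms] assms by (metis Compl_iff SigmaI singletonD)

text \<open>A maximal point \<open>w\<close> of the quotient lies in the kernel of a negative semidefinite form. Testing this
with \<open>u\<close> shows that the derivative of \<open>Fe\<close> vanishes on \<open>w\<close>; this excludes multiples of \<open>u\<close> and
removes the additional term in the Hessian of \<open>Fe\<^sup>2\<close>.\<close>

lemma \<Lambda>_degenerate:
  assumes pu: "p \<in> U" "u \<noteq> 0" and pos: "\<Lambda> (p, u) > 0"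
  obtains w where "\<And>a. w \<noteq> a *\<^sub>R u" "\<And>y. \<D>2 Fo (p, u) (0, w) (0, y) = \<Lambda> (p, u) * \<D>2 Fe (p, u) (0, w) (0, y)"
proof -
  let ?z = "(p, u)" and ?l = "\<Lambda> (p, u)"
  have z: "?z \<in> U \<times> (- {0})" using pu by simp
  have Gp: "Fe ?z > 0" by (rule Fe.pos[OF pu])
  obtain w where w: "w \<noteq> 0" "?l = rayleigh ?z w" "\<And>v. v \<noteq> 0 \<Longrightarrow> rayleigh ?z v \<le> ?l"
    using \<Lambda>_attained[OF z] by blast
  have den: "\<D>2 Fe.L ?z (0, v) (0, v) > 0" if "v \<noteq> 0" for v by (rule Fe.posdef[OF pu that])
  define B where "B = (\<lambda>v w. 2 * Fe ?z * \<D>2 Fo ?z (0, v) (0, w) - ?l * \<D>2 Fe.L ?z (0, v) (0, w))"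
  have lin1: "linear (\<lambda>v. \<D>2 Fo ?z (0, v) (0, w))" "linear (\<lambda>v. \<D>2 Fe.L ?z (0, v) (0, w))" for w
    using linear_fibre[OF Fo.linear_D2_left[OF z, of "(0, w)"]] linear_fibre[OF C2_linear1[OF Fe.C2_L z, of "(0, w)"]] by auto
  have lin2: "linear (\<lambda>w. \<D>2 Fo ?z (0, v) (0, w))" "linear (\<lambda>w. \<D>2 Fe.L ?z (0, v) (0, w))" for v
    using linear_fibre[OF Fo.linear_D2_right[OF z, of "(0, v)"]] linear_fibre[OF Fe.linear_D2L[OF z, of "(0, v)"]] by auto
  have lc: "linear (\<lambda>v. c * g v - d * h v)" if "linear g" "linear h" for c d :: real and g h :: "'e \<Rightarrow> real"
    using that by (auto simp: linear_iff algebra_simps)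
  have Bw: "B w y = 0" for y
  proof (rule negative_semidefinite_kernel[of B])
    show "linear (B v)" for v unfolding B_def by (rule lc[OF lin2])
    show "linear (\<lambda>v. B v y)" for y unfolding B_def by (rule lc[OF lin1])
    show "B v w = B w v" for v w
      unfolding B_def using Fo.D2_sym[OF z, of "(0, v)" "(0, w)"] D2_symmetric[OF Fe.C2_L open_TU z, of "(0, v)" "(0, w)"] by simp
    show "B v v \<le> 0" for v
    proof (cases "v = 0")
      case True
      then show ?thesis using linear_0[OF lin1(1)] linear_0[OF lin1(2)] by (simp add: B_def)
    next
      case False
      then show ?thesis using w(3)[OF False] den[OF False] by (simp add: rayleigh_def B_def field_simps)
    qed
    show "B w w = 0" using w(2) den[OF w(1)] by (simp add: rayleigh_def B_def field_simps)
  qed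
  have e: "2 * Fe ?z * \<D>2 Fo ?z (0, w) (0, y) = ?l * (2 * \<D> Fe ?z (0, w) * \<D> Fe ?z (0, y) + 2 * Fe ?z * \<D>2 Fe ?z (0, w) (0, y))" for y
    using Bw[of y] Fe.D2_square[OF z, of "(0, y)" "(0, w)"] by (simp add: B_def)
  have "\<D>2 Fo ?z (0, w) (0, u) = 0" "\<D>2 Fe ?z (0, w) (0, u) = 0"
    using Fo.D2_fibre_radial[OF pu] Fe.D2_fibre_radial[OF pu] Fo.D2_sym[OF z] Fe.D2_sym[OF z] by metis+
  then have "?l * (2 * \<D> Fe ?z (0, w) * Fe ?z) = 0" using e[of u] Fe.euler[OF pu] by simp
  then have Gw: "\<D> Fe ?z (0, w) = 0" using pos Gp by simp
  show ?thesis
  proof (rule that)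
    show "\<D>2 Fo ?z (0, w) (0, y) = ?l * \<D>2 Fe ?z (0, w) (0, y)" for y using e[of y] Gw Gp by simp
    show "w \<noteq> a *\<^sub>R u" for a
    proof
      assume a: "w = a *\<^sub>R u"
      have "\<D> Fe ?z (0, a *\<^sub>R u) = a * Fe ?z"
        using linear_scale[OF linear_fibre[OF Fe.linear_Dk[OF z]], of a u] Fe.euler[OF pu] by simp
      then have "a = 0" using Gw Gp a by simp
      then show False using w(1) a by simp
    qed
  qed
qed

text \<open>The converse: after subtraction of a multiple of \<open>u\<close> the kernel vector has Rayleigh quotient \<open>l\<close>.\<close>

lemma degenerate_le_\<Lambda>:
  assumes pu: "p \<in> U" "u \<noteq> 0" and d: "degenerate (\<lambda>z. 1 * Fo z + (- l) * Fe z) (p, u)"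
  shows "l \<le> \<Lambda> (p, u)"
proof -
  let ?z = "(p, u)"
  have z: "?z \<in> U \<times> (- {0})" using pu by simp
  have Gp: "Fe ?z > 0" by (rule Fe.pos[OF pu])
  obtain w where w: "\<And>a. w \<noteq> a *\<^sub>R u" "\<And>y. \<D>2 Fo ?z (0, w) (0, y) = l * \<D>2 Fe ?z (0, w) (0, y)"
    using d homogeneous_lincomb(3)[OF Fo.homogeneous_lagrangian_axioms Fe.homogeneous_lagrangian_axioms z, of 1 "- l"]
    by (auto simp: degenerate_def)
  define c where "c = \<D> Fe ?z (0, w) / Fe ?z"
  define v where "v = w - c *\<^sub>R u"
  have v: "v \<noteq> a *\<^sub>R u" for a
    using w(1)[of "a + c"] by (auto simp: v_def algebra_simps)
  then have v0: "v \<noteq> 0" by (metis scaleR_zero_left)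
  have "\<D> Fe ?z (0, v) = 0"
    using linear_diff[OF linear_fibre[OF Fe.linear_Dk[OF z]], of w "c *\<^sub>R u"] linear_scale[OF linear_fibre[OF Fe.linear_Dk[OF z]], of c u]
      Fe.euler[OF pu] Gp by (simp add: v_def c_def)
  moreover have "\<D>2 g ?z (0, v) (0, y) = \<D>2 g ?z (0, w) (0, y)" if "homogeneous_lagrangian U g" for g y
  proof -
    interpret g: homogeneous_lagrangian U g by (rule that)
    show ?thesis
      using linear_diff[OF linear_fibre[OF g.linear_D2_left[OF z, of "(0, y)"]], of w "c *\<^sub>R u"]
        linear_scale[OF linear_fibre[OF g.linear_D2_left[OF z, of "(0, y)"]], of c u] g.D2_fibre_radial[OF pu]
      by (simp add: v_def)
  qed
  ultimately have "\<D>2 Fo ?z (0, v) (0, v) = l * \<D>2 Fe ?z (0, v) (0, v)" "\<D>2 Fe.L ?z (0, v) (0, v) = 2 * Fe ?z * \<D>2 Fe ?z (0, v) (0, v)"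
    using w(2) Fo.homogeneous_lagrangian_axioms Fe.homogeneous_lagrangian_axioms Fe.D2_square[OF z] by simp_all
  moreover have "\<D>2 Fe ?z (0, v) (0, v) > 0" by (rule Fe.D2_fibre_pos[OF pu v])
  ultimately have "rayleigh ?z v = l" using Gp by (simp add: rayleigh_def)
  then show ?thesis using \<Lambda>_attained[OF z] v0 by metis
qed

text \<open>Along the extremal a positive value of \<open>\<Lambda>\<close> at one time is an eigenvalue at all nearby times, so \<open>\<Lambda>\<close>
is nowhere smaller than it is anywhere else on the interval.\<close>

lemma \<Lambda>_locally_constant:
  assumes "extremal U F I x" "t0 \<in> I"
  obtains \<delta> where "\<delta> > 0" "\<And>t. t \<in> {t0-\<delta><..<t0+\<delta>} \<Longrightarrow> t \<in> I \<and> \<Lambda> (x t, vel x t) = \<Lambda> (x t0, vel x t0)"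
proof -
  obtain \<delta> where \<delta>: "\<delta> > 0" "{t0-\<delta><..<t0+\<delta>} \<subseteq> I"
    "\<And>k t t1. shares_extremals U F k \<Longrightarrow> t \<in> {t0-\<delta><..<t0+\<delta>} \<Longrightarrow> t1 \<in> {t0-\<delta><..<t0+\<delta>} \<Longrightarrow>
       degenerate k (x t1, vel x t1) \<Longrightarrow> degenerate k (x t, vel x t)"
    using degeneracy_transported[OF assms] by blast
  have le: "\<Lambda> (x t1, vel x t1) \<le> \<Lambda> (x t, vel x t)" if t: "t \<in> {t0-\<delta><..<t0+\<delta>}" "t1 \<in> {t0-\<delta><..<t0+\<delta>}" for t t1
  proof -
    have x: "x t \<in> U" "vel x t \<noteq> 0" "x t1 \<in> U" "vel x t1 \<noteq> 0"
      using assms(1) t \<delta>(2) unfolding extremal_def by blast+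
    let ?l = "\<Lambda> (x t1, vel x t1)"
    show ?thesis
    proof (cases "?l > 0")
      case False
      then show ?thesis using \<Lambda>_nonneg[OF x(1,2)] by simp
    next
      case True
      obtain w where w: "\<And>a. w \<noteq> a *\<^sub>R vel x t1"
        "\<And>y. \<D>2 Fo (x t1, vel x t1) (0, w) (0, y) = ?l * \<D>2 Fe (x t1, vel x t1) (0, w) (0, y)"
        using \<Lambda>_degenerate[OF x(3,4) True] by blast
      have z: "(x t1, vel x t1) \<in> U \<times> (- {0})" using x by simp
      have "degenerate (\<lambda>z. 1 * Fo z + (- ?l) * Fe z) (x t1, vel x t1)"
        unfolding degenerate_def
        using w homogeneous_lincomb(3)[OF Fo.homogeneous_lagrangian_axioms Fe.homogeneous_lagrangian_axioms z, of 1 "- ?l"]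
        by auto
      then have "degenerate (\<lambda>z. 1 * Fo z + (- ?l) * Fe z) (x t, vel x t)"
        by (rule \<delta>(3)[OF shares_extremals_lincomb[OF shares_Fo shares_Fe] t])
      then show ?thesis by (rule degenerate_le_\<Lambda>[OF x(1,2)])
    qed
  qed
  have t0: "t0 \<in> {t0-\<delta><..<t0+\<delta>}" using \<delta>(1) by simp
  have "t \<in> I \<and> \<Lambda> (x t, vel x t) = \<Lambda> (x t0, vel x t0)" if "t \<in> {t0-\<delta><..<t0+\<delta>}" for t
    using le[OF that t0] le[OF t0 that] \<delta>(2) that by auto
  then show ?thesis using that \<delta>(1) by blast
qed

end

section \<open>Odd homogeneous functions have a degenerate Hessian\<close>

lemma exists_not_parallel:
  fixes u :: "'e::euclidean_space"
  assumes "DIM('e) \<ge> 2" obtains w where "\<And>a. w \<noteq> a *\<^sub>R u"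
proof -
  obtain T where T: "T \<subseteq> (Basis :: 'e set)" "card T = 2" using obtain_subset_with_card_n[OF assms] by metis
  then obtain b c where bc: "b \<in> Basis" "c \<in> Basis" "b \<noteq> (c::'e)" by (auto simp: card_2_iff)
  show ?thesis
  proof (cases "\<exists>a. b = a *\<^sub>R u")
    case False
    then show ?thesis using that by blast
  next
    case True
    then obtain a where a: "b = a *\<^sub>R u" by blast
    have "c \<noteq> d *\<^sub>R u" for d
    proof
      assume d: "c = d *\<^sub>R u"
      have "b \<bullet> c = 0" using bc by (simp add: inner_Basis)
      then have "a * d * (u \<bullet> u) = 0" by (auto simp: a d)
      then have "b = 0 \<or> c = 0" using a d by auto
      then show False using bc nonzero_Basis by blast
    qed
    then show ?thesis using that by blast
  qed
qed

context homogeneous_lagrangian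
begin

lemma odd_derivative_even:
  assumes "\<And>p u. k (p, - u) = - k (p, u)" "p \<in> U" "u \<noteq> 0"
  shows "\<D> k (p, - u) (0, y) = \<D> k (p, u) (0, y)"
proof -
  have z: "(p, u) \<in> U \<times> (- {0})" "(p, - u) \<in> U \<times> (- {0})" using assms by auto
  have "reverse k = (\<lambda>z. - k z)" using assms(1) by (auto simp: reverse_def fun_eq_iff)
  then have "\<D> (reverse k) (p, u) (0, - y) = - \<D> k (p, u) (0, - y)"
    using fun_cong[OF D_eqI[OF has_derivative_minus[OF C1_has_derivative[OF C2 z(1)]]], of "(0, - y)"] by simp
  moreover have "\<D> (reverse k) (p, u) (0, - y) = \<D> k (p, - u) (0, y)" using D_reverse[OF assms(2,3)] by simp
  moreover have "\<D> k (p, u) (0, - y) = - \<D> k (p, u) (0, y)"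
    using linear_neg[OF linear_fibre[OF linear_Dk[OF z(1)]], of y] .
  ultimately show ?thesis by simp
qed

text \<open>The sign \<open>s\<close> covers maxima and minima.\<close>

lemma critical_point_of_partial:
  assumes "p \<in> U" "u \<noteq> 0" "\<And>v. v \<noteq> 0 \<Longrightarrow> s * \<D> k (p, v) (0, \<xi>) \<le> s * \<D> k (p, u) (0, \<xi>)" "s \<noteq> 0"
  shows "\<D>2 k (p, u) (0, \<xi>) (0, y) = 0"
proof -
  have z: "(p, u) \<in> U \<times> (- {0})" using assms by simp
  let ?g = "\<lambda>r. s * \<D> k (p, u + r *\<^sub>R y) (0, \<xi>)"
  have l: "((\<lambda>r. (p, u + r *\<^sub>R y)) has_vector_derivative (0, y)) (at 0)"
    by (auto intro!: derivative_eq_intros has_vector_derivative_Pair)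
  have "((\<lambda>r. \<D> k (p, u + r *\<^sub>R y) (0, \<xi>)) has_vector_derivative \<D>2 k (p, u + 0 *\<^sub>R y) (0, y) (0, \<xi>)) (at 0)"
    by (rule C1_has_vector_derivative_compose[OF C1 _ l]) (use z in simp)
  then have d: "DERIV ?g 0 :> s * \<D>2 k (p, u) (0, y) (0, \<xi>)"
    unfolding has_real_derivative_iff_has_vector_derivative by (intro has_vector_derivative_mult_right) simp
  define \<delta> where "\<delta> = norm u / (norm y + 1)"
  have n: "norm y + 1 > 0" by (simp add: add_nonneg_pos)
  have \<delta>: "\<delta> > 0" using assms(2) n by (simp add: \<delta>_def)
  have "?g r \<le> ?g 0" if r: "\<bar>0 - r\<bar> < \<delta>" for r
  proof -
    have "u + r *\<^sub>R y \<noteq> 0"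
    proof
      assume "u + r *\<^sub>R y = 0"
      then have "u = - (r *\<^sub>R y)" by (simp add: add_eq_0_iff2)
      then have "norm u = \<bar>r\<bar> * norm y" by simp
      also have "\<dots> \<le> \<bar>r\<bar> * (norm y + 1)" by (intro mult_left_mono) auto
      also have "\<dots> < \<delta> * (norm y + 1)" using r n by (intro mult_strict_right_mono) auto
      also have "\<dots> = norm u" using n by (simp add: \<delta>_def)
      finally show False by simp
    qed
    then show ?thesis using assms(3) by simp
  qed
  then have "s * \<D>2 k (p, u) (0, y) (0, \<xi>) = 0" using DERIV_local_max[OF d \<delta>] by blast
  then show ?thesis using assms(4) D2_sym[OF z, of "(0, \<xi>)" "(0, y)"] by simp
qed

text \<open>The derivative in a fixed direction \<open>\<xi>\<close> is an even function, homogeneous of degree zero. If the Hessian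
were nondegenerate modulo \<open>u\<close> at every \<open>u\<close>, the maximum and the minimum could only be attained on the line of \<open>\<xi>\<close>, where
the function has a single value. So it would be constant, and the Hessian would annihilate \<open>\<xi>\<close> everywhere.\<close>

lemma odd_imp_degenerate:
  assumes dim: "DIM('e) \<ge> 2" and odd: "\<And>p u. k (p, - u) = - k (p, u)" and p: "p \<in> U"
  obtains u where "u \<noteq> 0" "degenerate k (p, u)"
proof (rule ccontr)
  note main = that
  assume neg: "\<not> thesis"
  have nd: "\<exists>a. \<xi> = a *\<^sub>R u" if "u \<noteq> 0" "\<And>y. \<D>2 k (p, u) (0, \<xi>) (0, y) = 0" for u \<xi>
  proof (rule ccontr)
    assume "\<nexists>a. \<xi> = a *\<^sub>R u"
    then have "degenerate k (p, u)" unfolding degenerate_def using that(2) by (intro exI[of _ \<xi>]) simp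
    then show False using neg main that(1) by blast
  qed
  obtain \<xi> :: 'e where \<xi>: "\<xi> \<noteq> 0" using nonempty_Basis nonzero_Basis by blast
  let ?q = "\<lambda>u. \<D> k (p, u) (0, \<xi>)"
  have cont: "continuous_on (sphere 0 1) ?q"
    by (rule C1_continuous_D[OF C2]) (use p in \<open>auto intro!: continuous_intros\<close>)
  have scale: "?q (a *\<^sub>R u) = ?q u" if "a \<noteq> 0" "u \<noteq> 0" for a u
  proof (cases "a > 0")
    case True then show ?thesis by (rule D_scale_fibre[OF p that(2)])
  next
    case False
    then have a: "- a > 0" using that by simp
    have "?q (a *\<^sub>R u) = ?q ((- a) *\<^sub>R u)"
      using odd_derivative_even[OF odd p, of "(- a) *\<^sub>R u" \<xi>] that by simp
    also have "\<dots> = ?q u" by (rule D_scale_fibre[OF p that(2) a])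
    finally show ?thesis .
  qed
  have crit: "?q u = ?q \<xi>" if h: "u \<noteq> 0" "\<And>v. v \<noteq> 0 \<Longrightarrow> s * ?q v \<le> s * ?q u" "s \<noteq> 0" for u s
  proof -
    obtain a where a: "\<xi> = a *\<^sub>R u" using nd[OF h(1) critical_point_of_partial[OF p h]] by blast
    then have "a \<noteq> 0" using \<xi> by auto
    then show ?thesis using scale[of a u] h(1) a by simp
  qed
  have sph: "sphere (0::'e) 1 \<noteq> {}" by simp
  have ext: "\<exists>u\<in>sphere 0 1. \<forall>v. v \<noteq> 0 \<longrightarrow> s * ?q v \<le> s * ?q u" for s
  proof -
    have "continuous_on (sphere 0 1) (\<lambda>u. s * ?q u)" by (intro continuous_intros cont)
    then obtain u where u: "u \<in> sphere 0 1" "\<forall>v\<in>sphere 0 1. s * ?q v \<le> s * ?q u"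
      using continuous_attains_sup[OF compact_sphere sph] by blast
    have "s * ?q v \<le> s * ?q u" if "v \<noteq> 0" for v
      using u(2)[rule_format, of "inverse (norm v) *\<^sub>R v"] scale[of "inverse (norm v)" v] that by simp
    with u(1) show ?thesis by blast
  qed
  obtain u1 where u1: "u1 \<in> sphere 0 1" "\<And>v. v \<noteq> 0 \<Longrightarrow> 1 * ?q v \<le> 1 * ?q u1" using ext[of 1] by blast
  obtain u2 where u2: "u2 \<in> sphere 0 1" "\<And>v. v \<noteq> 0 \<Longrightarrow> (-1) * ?q v \<le> (-1) * ?q u2" using ext[of "-1"] by blast
  have n: "u1 \<noteq> 0" "u2 \<noteq> 0" using u1(1) u2(1) by auto
  have c: "?q u1 = ?q \<xi>" "?q u2 = ?q \<xi>" using crit[OF n(1) u1(2)] crit[OF n(2) u2(2)] by auto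
  have const: "?q v = ?q \<xi>" if "v \<noteq> 0" for v using u1(2)[OF that] u2(2)[OF that] c by simp
  obtain u where u: "\<And>a. u \<noteq> a *\<^sub>R \<xi>" using exists_not_parallel[OF dim] by blast
  then have u0: "u \<noteq> 0" by (metis scaleR_zero_left)
  have "1 * ?q v \<le> 1 * ?q u" if "v \<noteq> 0" for v using const[OF that] const[OF u0] by simp
  from nd[OF u0 critical_point_of_partial[OF p u0 this]]
  obtain a where a: "\<xi> = a *\<^sub>R u" by auto
  then have "u = inverse a *\<^sub>R \<xi>" using \<xi> by auto
  then show False using u by blast
qed

text \<open>The fibre derivative is locally constant on the complement of the origin, which is connected, and
Euler's identity recovers \<open>k\<close> from it.\<close>

lemma zero_hessian_linear:
  assumes dim: "DIM('e) \<ge> 2" and p: "p \<in> U"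
    and 0: "\<And>u w y. u \<noteq> 0 \<Longrightarrow> \<D>2 k (p, u) (0, w) (0, y) = 0" and k0: "k (p, 0) = 0"
  shows "linear (\<lambda>u. k (p, u))" and "\<And>u y. u \<noteq> 0 \<Longrightarrow> \<D> k (p, u) (0, y) = k (p, y)"
proof -
  have const: "\<D> k (p, u) (0, y) = \<D> k (p, v) (0, y)" if "u \<noteq> 0" "v \<noteq> 0" for u v y
  proof (rule has_derivative_zero_unique_connected[where f = "\<lambda>u. \<D> k (p, u) (0, y)" and s = "- {0}"])
    show "open (- {0::'e})" by (simp add: open_Compl)
    show "connected (- {0::'e})" using dim by (rule connected_punctured_universe)
    show "((\<lambda>u. \<D> k (p, u) (0, y)) has_derivative (\<lambda>h. 0)) (at u)" if "u \<in> - {0}" for u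
    proof -
      have "((\<lambda>u::'e. (p, u)) has_derivative (\<lambda>h. (0, h))) (at u)" by (auto intro!: derivative_eq_intros)
      moreover have "((\<lambda>z. \<D> k z (0, y)) has_derivative (\<lambda>v. \<D>2 k (p, u) v (0, y))) (at (p, u))"
        by (rule C1_has_derivative[OF C1]) (use that p in simp)
      ultimately have "((\<lambda>u. \<D> k (p, u) (0, y)) has_derivative (\<lambda>h. \<D>2 k (p, u) (0, h) (0, y))) (at u)"
        by (rule has_derivative_compose)
      then show ?thesis using 0 that by simp
    qed
  qed (use that in auto)
  obtain e :: 'e where e: "e \<noteq> 0" using nonempty_Basis nonzero_Basis by blast
  have val: "k (p, u) = \<D> k (p, e) (0, u)" for u
  proof (cases "u = 0")
    case True
    have "linear (\<lambda>w. \<D> k (p, e) (0, w))" by (rule linear_fibre[OF linear_Dk]) (use p e in simp)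
    then show ?thesis using k0 True linear_0 by fastforce
  next
    case False
    then show ?thesis using euler[OF p False] const[OF False e, of u] by simp
  qed
  have "linear (\<lambda>w. \<D> k (p, e) (0, w))" by (rule linear_fibre[OF linear_Dk]) (use p e in simp)
  then show "linear (\<lambda>u. k (p, u))" by (simp add: val)
  show "\<D> k (p, u) (0, y) = k (p, y)" if "u \<noteq> 0" for u y using const[OF that e] val by simp
qed

end

text \<open>The bound on the dimension enters here: two \<open>B\<close>-orthogonal vectors exhaust the quotient of the
space by the kernel vector \<open>u\<close>.\<close>

lemma orthogonal_triple_spans:
  fixes B :: "'e::euclidean_space \<Rightarrow> 'e \<Rightarrow> real"
  assumes dim: "DIM('e) \<le> 3" and B: "\<And>w. linear (\<lambda>v. B v w)"
    and u: "u \<noteq> 0" "\<And>w. B u w = 0" and v: "B v1 v1 > 0" "B v2 v2 > 0" "B v1 v2 = 0"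
  obtains a b c where "\<xi> = a *\<^sub>R v2 + b *\<^sub>R v1 + c *\<^sub>R u"
proof -
  have v1: "v1 \<notin> span {u}"
  proof
    assume "v1 \<in> span {u}"
    then obtain c where "v1 = c *\<^sub>R u" by (auto simp: span_singleton)
    then have "B v1 v1 = 0" using linear_scale[OF B, of c u v1] u(2) by simp
    then show False using v(1) by simp
  qed
  have v2: "v2 \<notin> span {v1, u}"
  proof
    assume "v2 \<in> span {v1, u}"
    then obtain b c where "v2 = b *\<^sub>R v1 + c *\<^sub>R u"
      by (auto simp: span_breakdown_eq span_singleton diff_eq_eq) (metis add.commute)
    then have "B v2 v2 = b * B v1 v2 + c * B u v2"
      using linear_add[OF B, of "b *\<^sub>R v1" "c *\<^sub>R u" v2] linear_scale[OF B, of _ _ v2] by simp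
    then show False using v u(2) by simp
  qed
  have d: "v1 \<noteq> u" "v2 \<noteq> v1" "v2 \<noteq> u" using v1 v2 by (auto simp: span_base)
  have "independent {v2, v1, u}"
    using v1 v2 u(1) d by (simp add: independent_insert)
  moreover have "card {v2, v1, u} = 3" using d by simp
  ultimately have "UNIV \<subseteq> span {v2, v1, u}"
    using dim by (intro card_ge_dim_independent) (auto simp: dim_UNIV)
  then have "\<xi> \<in> span {v2, v1, u}" by blast
  then obtain a b c where "\<xi> - a *\<^sub>R v2 - b *\<^sub>R v1 = c *\<^sub>R u"
    by (auto simp: span_breakdown_eq span_singleton)
  then have "\<xi> = a *\<^sub>R v2 + b *\<^sub>R v1 + c *\<^sub>R u" by (simp add: algebra_simps)
  then show ?thesis by (rule that)
qed

context reversible_geodesics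
begin

text \<open>If \<open>c\<close> were positive, eigenvectors \<open>v1\<close> for \<open>c\<close> and \<open>v2\<close> for \<open>-c\<close> would exist at every \<open>u\<close>, the
second one because \<open>c\<close> is an eigenvalue at \<open>-u\<close>. Together with \<open>u\<close> they span the space, so that the
Hessian of \<open>Fo\<close> is nondegenerate modulo \<open>u\<close>, which is impossible for an odd function.\<close>

lemma \<Lambda>_constant_imp_zero:
  assumes dim: "DIM('e) = 2 \<or> DIM('e) = 3" and p: "p \<in> U" and c: "\<And>u. u \<noteq> 0 \<Longrightarrow> \<Lambda> (p, u) = c"
  shows "c = 0"
proof (rule ccontr)
  assume "c \<noteq> 0"
  obtain e :: 'e where e: "e \<noteq> 0" using nonempty_Basis nonzero_Basis by blast
  have cp: "c > 0" using \<Lambda>_nonneg[OF p e] c[OF e] \<open>c \<noteq> 0\<close> by simp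
  obtain u where u: "u \<noteq> 0" "degenerate Fo (p, u)"
    using Fo.odd_imp_degenerate[OF _ Fo_odd p] dim by (metis le_refl numeral_le_iff semiring_norm(68) eval_nat_numeral(3) le_SucI)
  have z: "(p, u) \<in> U \<times> (- {0})" using p u by simp
  obtain \<xi> where \<xi>: "\<And>a. \<xi> \<noteq> a *\<^sub>R u" "\<And>y. \<D>2 Fo (p, u) (0, \<xi>) (0, y) = 0"
    using u(2) by (auto simp: degenerate_def)
  obtain v1 where v1: "\<And>a. v1 \<noteq> a *\<^sub>R u" "\<And>y. \<D>2 Fo (p, u) (0, v1) (0, y) = c * \<D>2 Fe (p, u) (0, v1) (0, y)"
    using \<Lambda>_degenerate[OF p u(1)] cp c[OF u(1)] by metis
  have mu: "- u \<noteq> 0" using u by simp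
  obtain v2 where v2: "\<And>a. v2 \<noteq> a *\<^sub>R (- u)" "\<And>y. \<D>2 Fo (p, - u) (0, v2) (0, y) = c * \<D>2 Fe (p, - u) (0, v2) (0, y)"
    using \<Lambda>_degenerate[OF p mu] cp c[OF mu] by metis
  have v2f: "\<D>2 Fo (p, u) (0, v2) (0, y) = - c * \<D>2 Fe (p, u) (0, v2) (0, y)" for y
    using v2(2)[of y] D2_Fo_odd[OF p u(1)] D2_Fe_even[OF p u(1)] by simp
  have v2u: "v2 \<noteq> a *\<^sub>R u" for a using v2(1)[of "- a"] by simp
  define B where "B = (\<lambda>v w. \<D>2 Fe (p, u) (0, v) (0, w))"
  have symB: "B v w = B w v" for v w unfolding B_def by (rule Fe.D2_sym[OF z])
  have symf: "\<D>2 Fo (p, u) (0, v) (0, w) = \<D>2 Fo (p, u) (0, w) (0, v)" for v w by (rule Fo.D2_sym[OF z])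
  have linB: "linear (\<lambda>v. B v w)" for w unfolding B_def by (rule linear_fibre[OF Fe.linear_D2_left[OF z]])
  have linf: "linear (\<lambda>v. \<D>2 Fo (p, u) (0, v) (0, w))" for w by (rule linear_fibre[OF Fo.linear_D2_left[OF z]])
  have Bu: "B u w = 0" for w unfolding B_def by (rule Fe.D2_fibre_radial[OF p u(1)])
  have B1: "B v1 v1 > 0" unfolding B_def by (rule Fe.D2_fibre_pos[OF p u(1) v1(1)])
  have B2: "B v2 v2 > 0" unfolding B_def by (rule Fe.D2_fibre_pos[OF p u(1) v2u])
  have "c * B v1 v2 = - c * B v2 v1"
    using v1(2)[of v2] v2f[of v1] symf[of v1 v2] by (simp add: B_def)
  then have B12: "B v1 v2 = 0" using symB[of v1 v2] cp by simp
  obtain a b d where x: "\<xi> = a *\<^sub>R v2 + b *\<^sub>R v1 + d *\<^sub>R u"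
    using orthogonal_triple_spans[OF _ linB u(1) Bu B1 B2 B12, of \<xi>] dim by fastforce
  have exp: "\<D>2 Fo (p, u) (0, \<xi>) (0, y) = a * (- c * B v2 y) + b * (c * B v1 y)" for y
  proof -
    have "\<D>2 Fo (p, u) (0, \<xi>) (0, y) = a * \<D>2 Fo (p, u) (0, v2) (0, y) + b * \<D>2 Fo (p, u) (0, v1) (0, y) + d * \<D>2 Fo (p, u) (0, u) (0, y)"
      unfolding x linear_add[OF linf] linear_scale[OF linf] by simp
    then show ?thesis using v1(2) v2f Fo.D2_fibre_radial[OF p u(1)] by (simp add: B_def)
  qed
  have "b * (c * B v1 v1) = 0" using exp[of v1] \<xi>(2) B12 symB[of v1 v2] by auto
  then have b: "b = 0" using cp B1 by simp
  have "a * (c * B v2 v2) = 0" using exp[of v2] \<xi>(2) B12 by auto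
  then have "a = 0" using cp B2 by simp
  then have "\<xi> = d *\<^sub>R u" using x b by simp
  then show False using \<xi>(1) by blast
qed

text \<open>The Hessian is negative semidefinite at \<open>u\<close> and at \<open>-u\<close>, where it has the opposite sign.\<close>

lemma \<Lambda>_zero_imp_hessian_zero:
  assumes p: "p \<in> U" and c: "\<And>u. u \<noteq> 0 \<Longrightarrow> \<Lambda> (p, u) = 0" and u: "u \<noteq> 0"
  shows "\<D>2 Fo (p, u) (0, w) (0, y) = 0"
proof -
  have le: "\<D>2 Fo (p, v) (0, w) (0, w) \<le> 0" if v: "v \<noteq> 0" for v w
  proof (cases "w = 0")
    case True
    have "(p, v) \<in> U \<times> (- {0})" using p v by simp
    from linear_0[OF linear_fibre[OF Fo.linear_D2_left[OF this, of "(0, w)"]]] show ?thesis by (simp add: True)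
  next
    case False
    have z: "(p, v) \<in> U \<times> (- {0})" using p v by simp
    have "rayleigh (p, v) w \<le> 0" using \<Lambda>_attained[OF z] c[OF v] False by metis
    moreover have "\<D>2 Fe.L (p, v) (0, w) (0, w) > 0" by (rule Fe.posdef[OF p v False])
    ultimately show ?thesis using Fe.pos[OF p v]
      by (simp add: rayleigh_def divide_le_0_iff mult_le_0_iff)
  qed
  have z: "(p, u) \<in> U \<times> (- {0})" using p u by simp
  have "- u \<noteq> 0" using u by simp
  from le[OF this] le[OF u] have 0: "\<D>2 Fo (p, u) (0, w) (0, w) = 0" for w
    using D2_Fo_odd[OF p u] by (simp add: order_antisym)
  show ?thesis
    by (rule negative_semidefinite_kernel[of "\<lambda>v w. \<D>2 Fo (p, u) (0, v) (0, w)"])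
       (use 0 in \<open>auto intro: linear_fibre[OF Fo.linear_D2_right[OF z]] linear_fibre[OF Fo.linear_D2_left[OF z]] Fo.D2_sym[OF z]\<close>)
qed

end

section \<open>The invariant as an integral of motion\<close>

locale reversible_finsler_manifold = manifold A
  for A :: "('m::{t2_space,second_countable_topology}, 'e::euclidean_space) chart set" +
  fixes F :: "'m \<Rightarrow> ('m, 'e) tvec \<Rightarrow> real"
  assumes finsler: "finsler_metric A F" and greversible: "geodesically_reversible A F"
begin

lemma finsler_domain_lrep:
  assumes c: "c \<in> A" shows "finsler_domain (chart_range c) (lrep F c)"
proof -
  have C: "Ck_on (Suc (Suc 0)) (chart_range c \<times> (- {0})) (lrep F c)"
  proof -
    have "(\<lambda>(p, u). local_rep A F c p u) = lrep F c" by auto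
    then show ?thesis using finsler c unfolding finsler_metric_def numeral_2_eq_2 by metis
  qed
  have mink: "minkowski_norm (local_rep A F c p)" if "p \<in> chart_range c" for p
    using finsler c that by (simp add: finsler_metric_def)
  have H: "homogeneous_lagrangian (chart_range c) (lrep F c)"
  proof
    show "lrep F c (p, a *\<^sub>R u) = a * lrep F c (p, u)" if "p \<in> chart_range c" "u \<noteq> 0" "a > 0" for p u a
      using mink[OF that(1)] that(3) by (simp add: minkowski_norm_def asymmetric_norm_def)
  qed (rule open_range[OF c], rule C)
  interpret H: homogeneous_lagrangian "chart_range c" "lrep F c" by (rule H)
  show ?thesis
  proof (intro finsler_domain.intro finsler_domain_axioms.intro H)
    fix p u :: 'e assume pu: "p \<in> chart_range c" "u \<noteq> 0"
    have "0 \<le> local_rep A F c p u" "local_rep A F c p u \<noteq> 0"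
      using mink[OF pu(1)] pu(2) by (auto simp: minkowski_norm_def asymmetric_norm_def)
    then show "lrep F c (p, u) > 0" by simp
    fix w :: 'e assume w: "w \<noteq> 0"
    have "\<D>2 (\<lambda>u. (local_rep A F c p u)\<^sup>2) u w w > 0"
      using mink[OF pu(1)] pu(2) w by (simp add: minkowski_norm_def)
    then show "\<D>2 (\<lambda>z. (lrep F c z)\<^sup>2) (p, u) (0, w) (0, w) > 0"
      using D2_fibre(2)[OF Ck_on_power[OF C H.open_TU, of 2] open_range[OF c] pu, of w w] by simp
  qed
qed

text \<open>The reversed geodesic \<open>x \<circ> \<sigma>\<close> is an extremal with velocity a positive multiple of \<open>-x'\<close>. By homogeneity
its momentum at time \<open>s\<close> is \<open>m (\<sigma> s)\<close>, and the chain rule turns its Euler-Lagrange equation into the one for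
\<open>reverse F\<close> along \<open>x\<close>.\<close>

lemma reverse_extremal_lrep:
  assumes c: "c \<in> A" and x: "extremal (chart_range c) (lrep F c) I x"
  shows "extremal (chart_range c) (reverse (lrep F c)) I x"
proof (cases "I = {}")
  case True
  then show ?thesis by (simp add: extremal_def is_interval_empty)
next
  case False
  let ?U = "chart_range c" and ?k = "lrep F c"
  interpret k: finsler_domain ?U ?k by (rule finsler_domain_lrep[OF c])
  have I: "open I" "is_interval I" and Cx: "Ck_on (Suc (Suc 0)) I x"
    and xU: "\<And>t. t \<in> I \<Longrightarrow> x t \<in> ?U" "\<And>t. t \<in> I \<Longrightarrow> vel x t \<noteq> 0"
    using x by (auto simp: extremal_def)
  have g: "geodesic A F I (\<lambda>t. chart_inv c (x t))"
    by (rule extremal_imp_geodesic[OF k.homogeneous_lagrangian_axioms c x False])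
  obtain J \<sigma> where \<sigma>: "bij_betw \<sigma> J I" "Ck_on 2 J \<sigma>" "\<forall>t\<in>J. deriv \<sigma> t < 0"
    and gJ: "geodesic A F J ((\<lambda>t. chart_inv c (x t)) \<circ> \<sigma>)"
    using greversible g unfolding geodesically_reversible_def by blast
  have J: "open J" "is_interval J" using gJ by (auto simp: geodesic_def)
  have \<sigma>I: "\<sigma> s \<in> I" if "s \<in> J" for s using \<sigma>(1) that by (auto simp: bij_betw_def)
  have d\<sigma>: "(\<sigma> has_real_derivative deriv \<sigma> s) (at s)" if "s \<in> J" for s
  proof -
    have "\<sigma> differentiable (at s)" using \<sigma>(2) that by (simp add: numeral_2_eq_2)
    then show ?thesis by (simp add: DERIV_deriv_iff_real_differentiable)
  qed
  have y: "extremal ?U ?k J (\<lambda>s. x (\<sigma> s))"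
  proof (rule extremal_cong[OF geodesic_imp_extremal[OF k.homogeneous_lagrangian_axioms c gJ J order.refl]])
    show "((\<lambda>t. chart_inv c (x t)) \<circ> \<sigma>) s \<in> fst c" if "s \<in> J" for s
      using chart_inv_in[OF c xU(1)[OF \<sigma>I[OF that]]] by simp
    show "snd c (((\<lambda>t. chart_inv c (x t)) \<circ> \<sigma>) s) = x (\<sigma> s)" if "s \<in> J" for s
      using chart_chart_inv[OF c xU(1)[OF \<sigma>I[OF that]]] by simp
  qed
  have dx: "(x has_vector_derivative vel x t) (at t)" if "t \<in> I" for t by (rule Ck_on_real_SucD(1)[OF I(1) Cx that])
  have vy: "vel (\<lambda>s. x (\<sigma> s)) s = (- deriv \<sigma> s) *\<^sub>R (- vel x (\<sigma> s))" if "s \<in> J" for s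
    using vector_diff_chain_at[OF d\<sigma>[OF that, unfolded has_real_derivative_iff_has_vector_derivative] dx[OF \<sigma>I[OF that]]]
    by (simp add: o_def vector_derivative_at)
  define m where "m = (\<lambda>w t. \<D> ?k (x t, - vel x t) (0, w))"
  have Cm: "Ck_on (Suc 0) I (m w)" for w unfolding m_def
    by (rule Ck_on_compose[OF Ck_on_Pair[OF Ck_on_SucD[OF Cx] Ck_on_minus[OF Ck_on_real_SucD(2)[OF I(1) Cx] I(1)] I(1)] k.C1 _ I(1)])
       (use xU in auto)
  have dm: "(m w has_vector_derivative - \<D> ?k (x t, - vel x t) (w, 0)) (at t)" if t: "t \<in> I" for t w
  proof -
    obtain s where s: "s \<in> J" "\<sigma> s = t" using \<sigma>(1) t by (auto simp: bij_betw_def)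
    have neg: "- deriv \<sigma> s > 0" using \<sigma>(3) s by auto
    have m: "(m w has_vector_derivative vel (m w) t) (at t)" by (rule Ck_on_real_SucD(1)[OF I(1) Cm t])
    have "((\<lambda>r. m w (\<sigma> r)) has_vector_derivative deriv \<sigma> s *\<^sub>R vel (m w) t) (at s)"
      using vector_diff_chain_at[OF d\<sigma>[OF s(1), unfolded has_real_derivative_iff_has_vector_derivative], of "m w"] m
      by (simp add: s(2) o_def)
    moreover have "((\<lambda>r. m w (\<sigma> r)) has_vector_derivative (- deriv \<sigma> s) * \<D> ?k (x t, - vel x t) (w, 0)) (at s)"
    proof -
      have "((\<lambda>r. \<D> ?k (x (\<sigma> r), vel (\<lambda>s. x (\<sigma> s)) r) (0, w)) has_vector_derivative
          \<D> ?k (x (\<sigma> s), vel (\<lambda>s. x (\<sigma> s)) s) (w, 0)) (at s)"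
        using y s(1) by (simp add: extremal_def)
      moreover have "\<D> ?k (x (\<sigma> s), vel (\<lambda>s. x (\<sigma> s)) s) (w, 0) = (- deriv \<sigma> s) * \<D> ?k (x t, - vel x t) (w, 0)"
        unfolding vy[OF s(1)] s(2) by (rule k.D_scale_base) (use xU t neg in auto)
      ultimately have "((\<lambda>r. \<D> ?k (x (\<sigma> r), vel (\<lambda>s. x (\<sigma> s)) r) (0, w)) has_vector_derivative
          (- deriv \<sigma> s) * \<D> ?k (x t, - vel x t) (w, 0)) (at s)" by (simp only:)
      then show ?thesis
      proof (rule has_vector_derivative_transform_within_open[OF _ J(1) s(1)])
        fix r assume r: "r \<in> J"
        show "\<D> ?k (x (\<sigma> r), vel (\<lambda>s. x (\<sigma> s)) r) (0, w) = m w (\<sigma> r)"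
          unfolding vy[OF r] m_def by (rule k.D_scale_fibre) (use xU \<sigma>I[OF r] \<sigma>(3) r in auto)
      qed
    qed
    ultimately have "deriv \<sigma> s *\<^sub>R vel (m w) t = (- deriv \<sigma> s) * \<D> ?k (x t, - vel x t) (w, 0)"
      by (rule vector_derivative_unique_at)
    then have "deriv \<sigma> s * (vel (m w) t + \<D> ?k (x t, - vel x t) (w, 0)) = 0" by (simp add: algebra_simps)
    then have "vel (m w) t = - \<D> ?k (x t, - vel x t) (w, 0)" using neg by (simp add: add_eq_0_iff)
    then show ?thesis using m by simp
  qed
  have "((\<lambda>s. \<D> (reverse ?k) (x s, vel x s) (0, w)) has_vector_derivative \<D> (reverse ?k) (x t, vel x t) (w, 0)) (at t)"
    if t: "t \<in> I" for t w
  proof -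
    have e: "\<D> (reverse ?k) (x s, vel x s) (0, w) = m (- w) s" if "s \<in> I" for s
      using k.D_reverse[OF xU(1)[OF that] xU(2)[OF that], of 0 w] by (simp add: m_def)
    have e2: "m (- w) s = - m w s" if "s \<in> I" for s
    proof -
      have "(x s, - vel x s) \<in> ?U \<times> (- {0})" using xU that by simp
      from linear_neg[OF linear_fibre[OF k.linear_Dk[OF this]], of w] show ?thesis by (simp add: m_def)
    qed
    have "((\<lambda>s. - m w s) has_vector_derivative - (- \<D> ?k (x t, - vel x t) (w, 0))) (at t)"
      by (rule has_vector_derivative_minus[OF dm[OF t]])
    then have "((\<lambda>s. \<D> (reverse ?k) (x s, vel x s) (0, w)) has_vector_derivative \<D> ?k (x t, - vel x t) (w, 0)) (at t)"
      using has_vector_derivative_transform_within_open[OF _ I(1) t, of "\<lambda>s. - m w s" _ "\<lambda>s. \<D> (reverse ?k) (x s, vel x s) (0, w)"] e e2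
      by simp
    then show ?thesis using k.D_reverse[OF xU(1)[OF t] xU(2)[OF t], of w 0] by simp
  qed
  then show ?thesis using x unfolding extremal_def by blast
qed

lemma reversible_geodesics_lrep:
  assumes c: "c \<in> A" shows "reversible_geodesics (chart_range c) (lrep F c)"
  by (intro reversible_geodesics.intro reversible_geodesics_axioms.intro finsler_domain_lrep c reverse_extremal_lrep)

definition even_part :: "'m \<Rightarrow> ('m, 'e) tvec \<Rightarrow> real" where
  "even_part x v = 1/2 * F x v + 1/2 * F x (\<lambda>d. - v d)"

definition odd_part :: "'m \<Rightarrow> ('m, 'e) tvec \<Rightarrow> real" where
  "odd_part x v = 1/2 * F x v + (- 1/2) * F x (\<lambda>d. - v d)"

lemma parts_local:
  assumes "c \<in> A" "p \<in> chart_range c"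
  shows "local_rep A even_part c p u = reversible_geodesics.Fe (lrep F c) (p, u)"
    and "local_rep A odd_part c p u = reversible_geodesics.Fo (lrep F c) (p, u)"
proof -
  interpret R: reversible_geodesics "chart_range c" "lrep F c" by (rule reversible_geodesics_lrep[OF assms(1)])
  show "local_rep A even_part c p u = R.Fe (p, u)" "local_rep A odd_part c p u = R.Fo (p, u)"
    unfolding R.Fe_def R.Fo_def reverse_def fst_conv snd_conv
    unfolding local_rep_def even_part_def odd_part_def tvec_of_minus[OF assms, of u] by simp_all
qed

text \<open>The second derivative on a tangent space. It only uses the pointwise vector operations on tangent
vectors, so that no chart has to be chosen.\<close>

definition second_along :: "('m \<Rightarrow> ('m, 'e) tvec \<Rightarrow> real) \<Rightarrow> 'm \<Rightarrow> ('m, 'e) tvec \<Rightarrow> ('m, 'e) tvec \<Rightarrow> real" where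
  "second_along H x v w = vel (\<lambda>s. vel (\<lambda>r. H x (\<lambda>d. v d + r *\<^sub>R w d)) s) 0"

lemma second_along_local:
  assumes c: "c \<in> A" "p \<in> chart_range c" and u: "u \<noteq> 0" and k: "Ck_on (Suc (Suc 0)) (chart_range c \<times> (- {0})) k"
    and H: "\<And>u. local_rep A H c p u = k (p, u)"
  shows "second_along H (chart_inv c p) (tvec_of A c p u) (tvec_of A c p w) = \<D>2 k (p, u) (0, w) (0, w)"
proof -
  have e: "H (chart_inv c p) (\<lambda>d. tvec_of A c p u d + r *\<^sub>R tvec_of A c p w d) = k (p, u + r *\<^sub>R w)" for r
    using tvec_of_linear[OF c, of 1 u r w] H[of "u + r *\<^sub>R w"] by (simp add: local_rep_def)
  define N where "N = {s. u + s *\<^sub>R w \<noteq> 0}"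
  have "N = (\<lambda>s. u + s *\<^sub>R w) -` (- {0})" by (auto simp: N_def)
  then have N: "open N" "0 \<in> N" using u open_vimage[of "- {0}" "\<lambda>s::real. u + s *\<^sub>R w"]
    by (auto simp: open_Compl N_def intro!: continuous_intros)
  have l: "((\<lambda>r. (p, u + r *\<^sub>R w)) has_vector_derivative (0, w)) (at s)" for s :: real
    by (auto intro!: derivative_eq_intros has_vector_derivative_Pair)
  have C1: "Ck_on (Suc 0) (chart_range c \<times> (- {0})) (\<lambda>z. \<D> k z (0, w))" using k by (metis Ck_on.simps(2))
  have in_N: "(p, u + s *\<^sub>R w) \<in> chart_range c \<times> (- {0})" if "s \<in> N" for s using that c by (simp add: N_def)
  have 1: "vel (\<lambda>r. k (p, u + r *\<^sub>R w)) s = \<D> k (p, u + s *\<^sub>R w) (0, w)" if "s \<in> N" for s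
    by (rule vector_derivative_at[OF C1_has_vector_derivative_compose[OF k in_N[OF that] l]])
  have "vel (\<lambda>s. vel (\<lambda>r. k (p, u + r *\<^sub>R w)) s) 0 = vel (\<lambda>s. \<D> k (p, u + s *\<^sub>R w) (0, w)) 0"
    by (rule vel_cong[OF N 1])
  also have "\<dots> = \<D>2 k (p, u + 0 *\<^sub>R w) (0, w) (0, w)"
    by (rule vector_derivative_at[OF C1_has_vector_derivative_compose[OF C1 in_N[OF N(2)] l]])
  finally show ?thesis by (simp add: second_along_def e)
qed

text \<open>The function \<open>\<Lambda>\<close> without reference to a chart.\<close>

definition invariant :: "'m \<Rightarrow> ('m, 'e) tvec \<Rightarrow> real" where
  "invariant x v = Sup ((\<lambda>w. 2 * even_part x v * second_along odd_part x v w /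
     second_along (\<lambda>x v. (even_part x v)\<^sup>2) x v w) ` (tangent_space A x - {\<lambda>_. 0}))"

lemma invariant_local:
  assumes c: "c \<in> A" "p \<in> chart_range c" and u: "u \<noteq> 0"
  shows "invariant (chart_inv c p) (tvec_of A c p u) = reversible_geodesics.\<Lambda> (lrep F c) (p, u)"
proof -
  interpret R: reversible_geodesics "chart_range c" "lrep F c" by (rule reversible_geodesics_lrep[OF c(1)])
  let ?x = "chart_inv c p"
  have x: "?x \<in> fst c" "snd c ?x = p" using c chart_inv_in chart_chart_inv by auto
  have im: "tangent_space A ?x - {\<lambda>_. 0} = tvec_of A c p ` (- {0})"
  proof (intro equalityI subsetI)
    fix v assume v: "v \<in> tangent_space A ?x - {\<lambda>_. 0}"
    then have e: "v = tvec_of A c p (v c)" using tangent_eq_tvec_of[OF c(1) x(1), of v] x(2) by simp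
    have "v c \<noteq> 0"
    proof
      assume "v c = 0"
      then have "v = (\<lambda>_. 0)" using e tvec_of_zero[OF c] by simp
      then show False using v by simp
    qed
    then show "v \<in> tvec_of A c p ` (- {0})" using e by blast
  next
    fix v assume "v \<in> tvec_of A c p ` (- {0})"
    then obtain w where w: "w \<noteq> 0" "v = tvec_of A c p w" by auto
    have "v c = w" using tvec_of_self[OF c] w(2) by simp
    then have "v \<noteq> (\<lambda>_. 0)" using w(1) by auto
    then show "v \<in> tangent_space A ?x - {\<lambda>_. 0}" using tvec_of_tangent[OF c, of w] w(2) by simp
  qed
  have "2 * even_part ?x (tvec_of A c p u) * second_along odd_part ?x (tvec_of A c p u) (tvec_of A c p w) /
     second_along (\<lambda>x v. (even_part x v)\<^sup>2) ?x (tvec_of A c p u) (tvec_of A c p w) = R.rayleigh (p, u) w" for w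
  proof -
    have "even_part ?x (tvec_of A c p u) = R.Fe (p, u)" using parts_local(1)[OF c, of u] by (simp add: local_rep_def)
    moreover have "second_along odd_part ?x (tvec_of A c p u) (tvec_of A c p w) = \<D>2 R.Fo (p, u) (0, w) (0, w)"
      by (rule second_along_local[OF c u R.Fo.C2 parts_local(2)[OF c]])
    moreover have "second_along (\<lambda>x v. (even_part x v)\<^sup>2) ?x (tvec_of A c p u) (tvec_of A c p w) = \<D>2 R.Fe.L (p, u) (0, w) (0, w)"
      by (rule second_along_local[OF c u R.Fe.C2_L]) (use parts_local(1)[OF c] in \<open>simp add: local_rep_def\<close>)
    ultimately show ?thesis by (simp add: R.rayleigh_def)
  qed
  then show ?thesis unfolding invariant_def im R.\<Lambda>_def by (simp add: image_image)
qed

lemma \<Lambda>_scale: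
  assumes "c \<in> A" "p \<in> chart_range c" "u \<noteq> 0" "a > 0"
  shows "reversible_geodesics.\<Lambda> (lrep F c) (p, a *\<^sub>R u) = reversible_geodesics.\<Lambda> (lrep F c) (p, u)"
proof -
  interpret R: reversible_geodesics "chart_range c" "lrep F c" by (rule reversible_geodesics_lrep[OF assms(1)])
  have z: "(p, u) \<in> chart_range c \<times> (- {0})" "(p, a *\<^sub>R u) \<in> chart_range c \<times> (- {0})" using assms by auto
  have Fe: "R.Fe (p, a *\<^sub>R u) = a * R.Fe (p, u)" by (rule R.Fe.hom[OF assms(2-4)])
  have "R.rayleigh (p, a *\<^sub>R u) w = R.rayleigh (p, u) w" for w
  proof -
    have "\<D>2 R.Fe.L (p, a *\<^sub>R u) (0, w) (0, w) = \<D>2 R.Fe.L (p, u) (0, w) (0, w)"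
      using R.Fe.D2_square[OF z(1), of "(0, w)" "(0, w)"] R.Fe.D2_square[OF z(2), of "(0, w)" "(0, w)"]
        R.Fe.D_scale_fibre[OF assms(2-4), of w] R.Fe.D2_scale[OF assms(2-4), of w w] Fe assms(4)
      by simp
    then show ?thesis using Fe R.Fo.D2_scale[OF assms(2-4), of w w] assms(4) by (simp add: R.rayleigh_def)
  qed
  then have "R.rayleigh (p, a *\<^sub>R u) = R.rayleigh (p, u)" by (rule ext)
  then show ?thesis by (simp add: R.\<Lambda>_def)
qed

text \<open>A representative of the direction is chosen; by \<open>\<Lambda>_scale\<close> the value does not depend on it.\<close>

definition direction_invariant :: "'m \<times> ('m, 'e) tvec set \<Rightarrow> real" where
  "direction_invariant = (\<lambda>(x, D). invariant x (SOME v. v \<in> D))"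

lemma direction_invariant_local:
  assumes c: "c \<in> A" "p \<in> chart_range c" and u: "u \<noteq> 0"
  shows "direction_invariant (chart_inv c p, direction (tvec_of A c p u)) = reversible_geodesics.\<Lambda> (lrep F c) (p, u)"
proof -
  let ?v = "tvec_of A c p u"
  have "?v \<in> direction ?v" by (auto simp: direction_def intro!: exI[of _ 1])
  then have "(SOME v. v \<in> direction ?v) \<in> direction ?v" by (rule someI[of "\<lambda>v. v \<in> direction ?v"])
  then obtain a where a: "a > 0" "(SOME v. v \<in> direction ?v) = (\<lambda>d. a *\<^sub>R ?v d)" by (auto simp: direction_def)
  have "(\<lambda>d. a *\<^sub>R ?v d) = tvec_of A c p (a *\<^sub>R u)" using tvec_of_scale[OF c] by simp
  then show ?thesis
    unfolding direction_invariant_def using a invariant_local[OF c, of "a *\<^sub>R u"] \<Lambda>_scale[OF c u a(1)] u by simp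
qed

lemma direction_invariant_continuous: "continuous_on_STM A direction_invariant"
  unfolding continuous_on_STM_def
proof
  fix c assume c: "c \<in> A"
  interpret R: reversible_geodesics "chart_range c" "lrep F c" by (rule reversible_geodesics_lrep[OF c])
  show "continuous_on (chart_range c \<times> (- {0})) (\<lambda>(p, u). local_rep A (\<lambda>x v. direction_invariant (x, direction v)) c p u)"
  proof (rule continuous_on_eq[OF R.\<Lambda>_continuous])
    fix z assume z: "z \<in> chart_range c \<times> (- {0::'e})"
    then obtain p u where pu: "z = (p, u)" "p \<in> chart_range c" "u \<noteq> 0" by auto
    show "R.\<Lambda> z = (case z of (p, u) \<Rightarrow> local_rep A (\<lambda>x v. direction_invariant (x, direction v)) c p u)"
      unfolding pu(1) prod.case local_rep_def[of A "\<lambda>x v. direction_invariant (x, direction v)"]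
      by (rule direction_invariant_local[OF c pu(2,3), symmetric])
  qed
qed

text \<open>A geodesic may cross several charts, so the constancy along extremals in a chart is used locally and then
extended by connectedness of the interval.\<close>

lemma direction_invariant_integral: "integral_of_motion A F direction_invariant"
  unfolding integral_of_motion_def
proof (intro allI impI)
  fix I \<gamma> assume g: "geodesic A F I \<gamma>"
  let ?h = "\<lambda>t. direction_invariant (\<gamma> t, direction (velocity A \<gamma> t))"
  have I: "open I" "is_interval I" and c\<gamma>: "continuous_on I \<gamma>" using g by (auto simp: geodesic_def Ck_map_def)
  have loc: "eventually (\<lambda>t. ?h t0 = ?h t) (at t0 within I)" if t0: "t0 \<in> I" for t0
  proof -
    obtain c where c: "c \<in> A" "\<gamma> t0 \<in> fst c" using chart_ex by blast
    interpret R: reversible_geodesics "chart_range c" "lrep F c" by (rule reversible_geodesics_lrep[OF c(1)])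
    have "open (I \<inter> \<gamma> -` fst c)" by (rule continuous_open_preimage[OF c\<gamma> I(1) open_dom[OF c(1)]])
    then obtain r where r: "r > 0" "ball t0 r \<subseteq> I \<inter> \<gamma> -` fst c" using t0 c(2) open_contains_ball by (metis IntI vimageI2)
    let ?J = "ball t0 r" and ?x = "\<lambda>t. snd c (\<gamma> t)"
    have J: "open ?J" "is_interval ?J" "?J \<subseteq> I" "\<And>t. t \<in> ?J \<Longrightarrow> \<gamma> t \<in> fst c"
      using r(2) by (auto simp: is_interval_ball_real)
    have x: "extremal (chart_range c) (lrep F c) ?J ?x"
      by (rule geodesic_imp_extremal[OF R.homogeneous_lagrangian_axioms c(1) g J])
    have val: "?h t = R.\<Lambda> (?x t, vel ?x t)" if "t \<in> ?J" for t
    proof -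
      have v: "velocity A \<gamma> t = tvec_of A c (?x t) (vel ?x t)" "vel ?x t \<noteq> 0"
        using geodesic_chart_C2(2,3)[OF c(1) g J(1,3,4)] that by blast+
      have "chart_inv c (?x t) = \<gamma> t" by (rule chart_inv_chart[OF c(1) J(4)[OF that]])
      then show ?thesis
        using direction_invariant_local[OF c(1) chart_in[OF J(4)[OF that]] v(2)] v(1) by simp
    qed
    have t0J: "t0 \<in> ?J" using r(1) by simp
    obtain \<delta> where \<delta>: "\<delta> > 0"
      "\<And>t. t \<in> {t0-\<delta><..<t0+\<delta>} \<Longrightarrow> t \<in> ?J \<and> R.\<Lambda> (?x t, vel ?x t) = R.\<Lambda> (?x t0, vel ?x t0)"
      using R.\<Lambda>_locally_constant[OF x t0J] by blast
    have "?h t0 = ?h t" if "dist t t0 < \<delta>" for t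
    proof -
      have "t \<in> {t0-\<delta><..<t0+\<delta>}" using that by (auto simp: dist_real_def)
      from \<delta>(2)[OF this] have t: "t \<in> ?J" and e: "R.\<Lambda> (?x t, vel ?x t) = R.\<Lambda> (?x t0, vel ?x t0)" by blast+
      show ?thesis unfolding val[OF t0J] val[OF t] by (rule e[symmetric])
    qed
    then show ?thesis unfolding eventually_at using \<delta>(1) by blast
  qed
  have "connected I" using I(2) by (simp add: is_interval_connected_1)
  then have "?h s = ?h t" if "s \<in> I" "t \<in> I" for s t
    using connected_local_const[OF _ that, of ?h] loc by blast
  then show "?h constant_on I" unfolding constant_on_def by metis
qed

section \<open>The decomposition\<close>

lemma even_part_reversible: "reversible A even_part"
  by (simp add: reversible_def even_part_def)

lemma even_part_finsler: "finsler_metric A even_part"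
  unfolding finsler_metric_def
proof (intro ballI conjI)
  fix c assume c: "c \<in> A"
  interpret R: reversible_geodesics "chart_range c" "lrep F c" by (rule reversible_geodesics_lrep[OF c])
  have loc: "local_rep A even_part c p = (\<lambda>u. R.Fe (p, u))" if "p \<in> chart_range c" for p
    using parts_local(1)[OF c that] by (intro ext)
  have cF: "continuous_on (chart_range c \<times> UNIV) (lrep F c)"
    using finsler c by (simp add: finsler_metric_def case_prod_beta)
  have "continuous_on (chart_range c \<times> UNIV) (\<lambda>z. lrep F c (fst z, - snd z))"
    by (rule continuous_on_compose2[OF cF]) (auto intro!: continuous_intros)
  then have "continuous_on (chart_range c \<times> UNIV) R.Fe"
    unfolding R.Fe_def reverse_def by (intro continuous_on_add continuous_on_mult continuous_on_const cF)
  then show "continuous_on (chart_range c \<times> UNIV) (\<lambda>(p, u). local_rep A even_part c p u)"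
    by (rule continuous_on_eq) (auto simp: loc)
  show "Ck_on 2 (chart_range c \<times> (- {0})) (\<lambda>(p, u). local_rep A even_part c p u)"
    unfolding numeral_2_eq_2
    using R.Fe.C2 Ck_on_cong[OF R.open_TU, of "\<lambda>(p, u). local_rep A even_part c p u" R.Fe] by (auto simp: loc simp del: Ck_on.simps)
  fix p assume p: "p \<in> chart_range c"
  have n: "asymmetric_norm (local_rep A F c p)"
    using finsler c p by (simp add: finsler_metric_def minkowski_norm_def)
  have Fe: "R.Fe (p, u) = 1/2 * local_rep A F c p u + 1/2 * local_rep A F c p (- u)" for u
    by (simp add: R.Fe_def reverse_def)
  have n0: "0 \<le> local_rep A F c p u" "local_rep A F c p (u + w) \<le> local_rep A F c p u + local_rep A F c p w"
    "local_rep A F c p u = 0 \<longleftrightarrow> u = 0" for u w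
    using n by (auto simp: asymmetric_norm_def)
  have n1: "local_rep A F c p (k *\<^sub>R u) = k * local_rep A F c p u" if "k > 0" for k u
    using n that by (simp add: asymmetric_norm_def)
  show "minkowski_norm (local_rep A even_part c p)"
    unfolding minkowski_norm_def loc[OF p]
  proof (intro conjI allI impI)
    show "asymmetric_norm (\<lambda>u. R.Fe (p, u))"
      unfolding asymmetric_norm_def Fe
    proof (intro conjI allI impI)
      fix u w :: 'e and k :: real
      show "0 \<le> 1/2 * local_rep A F c p u + 1/2 * local_rep A F c p (- u)" using n0(1) by simp
      show "1/2 * local_rep A F c p (k *\<^sub>R u) + 1/2 * local_rep A F c p (- (k *\<^sub>R u))
          = k * (1/2 * local_rep A F c p u + 1/2 * local_rep A F c p (- u))" if "k > 0"
        using n1[OF that, of u] n1[OF that, of "- u"] by (simp add: algebra_simps)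
      show "1/2 * local_rep A F c p (u + w) + 1/2 * local_rep A F c p (- (u + w))
          \<le> 1/2 * local_rep A F c p u + 1/2 * local_rep A F c p (- u) + (1/2 * local_rep A F c p w + 1/2 * local_rep A F c p (- w))"
        using add_mono[OF n0(2)[of u w] n0(2)[of "- u" "- w"]] by simp
      show "(1/2 * local_rep A F c p u + 1/2 * local_rep A F c p (- u) = 0) = (u = 0)"
        using n0(1)[of u] n0(1)[of "- u"] n0(3)[of u] n0(3)[of "- u"] by (auto simp: add_nonneg_eq_0_iff)
    qed
    have Cp: "Ck_on k (- {0}) (\<lambda>u::'e. (p, u))" for k
    proof (rule Ck_on_Pair[OF Ck_on_const Ck_on_linear])
      show "open (- {0::'e})" by (simp add: open_Compl)
    qed (rule bounded_linear_ident)
    show "Ck_on 2 (- {0}) (\<lambda>u. (R.Fe (p, u))\<^sup>2)"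
      unfolding numeral_2_eq_2
      by (rule Ck_on_compose[OF Cp R.Fe.C2_L[unfolded numeral_2_eq_2]]) (use p in \<open>auto simp: open_Compl\<close>)
    show "0 < \<D>2 (\<lambda>u. (R.Fe (p, u))\<^sup>2) u w w" if "u \<noteq> 0" "w \<noteq> 0" for u w
      unfolding D2_fibre(2)[OF R.Fe.C2_L open_range[OF c] p that(1)] by (rule R.Fe.posdef[OF p that])
  qed
qed

text \<open>Since \<open>Fo\<close> is linear in the velocity, \<open>Fo(x, w)\<close> is its momentum in the direction \<open>w\<close> whatever the velocity
is. Along the extremal with initial velocity \<open>u\<close> the chain rule and the Euler-Lagrange equation
give two expressions for the derivative of this momentum, and their equality is the symmetry that
closedness asks for.\<close>

lemma odd_part_closed:
  assumes dim: "DIM('e) \<ge> 2"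
    and 0: "\<And>c p u w y. c \<in> A \<Longrightarrow> p \<in> chart_range c \<Longrightarrow> u \<noteq> 0 \<Longrightarrow>
      \<D>2 (reversible_geodesics.Fo (lrep F c)) (p, u) (0, w) (0, y) = 0"
  shows "closed_one_form A odd_part"
  unfolding closed_one_form_def
proof (intro ballI conjI allI)
  fix c assume c: "c \<in> A"
  interpret R: reversible_geodesics "chart_range c" "lrep F c" by (rule reversible_geodesics_lrep[OF c])
  have loc: "local_rep A odd_part c p = (\<lambda>u. R.Fo (p, u))" if "p \<in> chart_range c" for p
    using parts_local(2)[OF c that] by (intro ext)
  have f0: "R.Fo (p, 0) = 0" for p by (simp add: R.Fo_def reverse_def)
  have lin: "linear (\<lambda>u. R.Fo (p, u))" if "p \<in> chart_range c" for p
    by (rule R.Fo.zero_hessian_linear(1)[OF dim that 0[OF c that] f0])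
  have fib: "\<D> R.Fo (p, u) (0, y) = R.Fo (p, y)" if "p \<in> chart_range c" "u \<noteq> 0" for p u y
    by (rule R.Fo.zero_hessian_linear(2)[OF dim that(1) 0[OF c that(1)] f0 that(2)])
  show "linear (local_rep A odd_part c p)" if "p \<in> chart_range c" for p using lin[OF that] loc[OF that] by simp
  have O: "open (chart_range c)" by (rule open_range[OF c])
  have m: "((\<lambda>p. (p, u)) has_derivative (\<lambda>h. (h, 0))) (at p)" for p u :: 'e by (auto intro!: derivative_eq_intros)
  show "Ck_on 1 (chart_range c) (\<lambda>p. local_rep A odd_part c p u)" for u
  proof (cases "u = 0")
    case True
    then show ?thesis using Ck_on_cong[OF O, of "\<lambda>p. local_rep A odd_part c p u" "\<lambda>_. 0"] f0 by (simp add: loc Ck_on_const del: Ck_on.simps)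
  next
    case False
    have "Ck_on (Suc 0) (chart_range c) (\<lambda>p. R.Fo (p, u))"
      by (rule Ck_on_compose[OF Ck_on_Pair[OF Ck_on_linear[OF bounded_linear_ident] Ck_on_const O] Ck_on_SucD[OF R.Fo.C2] _ O])
         (use False in auto)
    then show ?thesis
      using Ck_on_cong[OF O, of "\<lambda>p. local_rep A odd_part c p u" "\<lambda>p. R.Fo (p, u)"] by (simp add: loc del: Ck_on.simps)
  qed
  fix p u w assume p: "p \<in> chart_range c"
  have base: "\<D> (\<lambda>q. local_rep A odd_part c q u) p w = (if u = 0 then 0 else \<D> R.Fo (p, u) (w, 0))" for u w
  proof -
    have "\<D> (\<lambda>q. local_rep A odd_part c q u) p w = \<D> (\<lambda>q. R.Fo (q, u)) p w"
      by (rule fun_cong[OF D_cong[OF O p]]) (simp add: loc)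
    also have "\<D> (\<lambda>q. R.Fo (q, u)) p w = (if u = 0 then 0 else \<D> R.Fo (p, u) (w, 0))"
    proof (cases "u = 0")
      case True
      then show ?thesis by (simp add: f0)
    next
      case False
      have "R.Fo differentiable (at (p, u))" using R.Fo.C2 p False by auto
      from D_compose[OF differentiableI[OF m] this, of w] False show ?thesis by (simp add: D_eqI[OF m])
    qed
    finally show ?thesis .
  qed
  have key: "\<D> R.Fo (p, w) (u, 0) = \<D> R.Fo (p, u) (w, 0)" if u: "u \<noteq> 0" and w: "w \<noteq> 0" for u w
  proof -
    obtain \<delta> x where x: "\<delta> > 0" "extremal (chart_range c) (lrep F c) {-\<delta><..<\<delta>} x" "x 0 = p" "vel x 0 = u"
      using R.extremal_exists[OF p u] by blast
    let ?J = "{-\<delta><..<\<delta>}"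
    have xJ: "x t \<in> chart_range c" "vel x t \<noteq> 0" if "t \<in> ?J" for t using x(2) that by (auto simp: extremal_def)
    have J0: "0 \<in> ?J" "open ?J" using x(1) by auto
    have "extremal (chart_range c) R.Fo ?J x" using R.shares_Fo x(2) by (simp add: shares_extremals_def)
    then have "((\<lambda>s. \<D> R.Fo (x s, vel x s) (0, w)) has_vector_derivative \<D> R.Fo (x 0, vel x 0) (w, 0)) (at 0)"
      using J0 unfolding extremal_def by blast
    then have "((\<lambda>s. R.Fo (x s, w)) has_vector_derivative \<D> R.Fo (p, u) (w, 0)) (at 0)"
      using has_vector_derivative_transform_within_open[OF _ J0(2,1), of "\<lambda>s. \<D> R.Fo (x s, vel x s) (0, w)" _ "\<lambda>s. R.Fo (x s, w)"]
        fib xJ x(3,4) by simp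
    moreover have "((\<lambda>s. R.Fo (x s, w)) has_vector_derivative \<D> R.Fo (p, w) (u, 0)) (at 0)"
      unfolding x(3)[symmetric]
    proof (rule C1_has_vector_derivative_compose[OF R.Fo.C2])
      show "(x 0, w) \<in> chart_range c \<times> (- {0})" using x(3) p w by simp
      have "(x has_vector_derivative vel x 0) (at 0)"
        by (rule Ck_on_real_SucD(1)[OF J0(2) _ J0(1), where k = "Suc 0"]) (use x(2) in \<open>simp add: extremal_def del: Ck_on.simps\<close>)
      then show "((\<lambda>s. (x s, w)) has_vector_derivative (u, 0)) (at 0)"
        using x(4) by (auto intro!: derivative_eq_intros has_vector_derivative_Pair)
    qed
    ultimately show ?thesis by (rule vector_derivative_unique_at[symmetric])
  qed
  have z0: "\<D> R.Fo (p, v) (0, 0) = 0" if "v \<noteq> 0" for v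
    using linear_0[OF R.Fo.linear_Dk, of "(p, v)"] p that by (simp add: zero_prod_def)
  show "\<D> (\<lambda>q. local_rep A odd_part c q u) p w = \<D> (\<lambda>q. local_rep A odd_part c q w) p u"
    unfolding base using key[of w u] z0 by auto
qed

end

theorem theoremV:
  fixes A :: "('m::{t2_space,second_countable_topology}, 'e::euclidean_space) chart set"
    and F :: "'m \<Rightarrow> ('m, 'e) tvec \<Rightarrow> real"
  assumes "DIM('e) = 2 \<or> DIM('e) = 3"
    and "smooth_atlas A"
    and "finsler_metric A F"
    and "geodesically_reversible A F"
    and "\<And>h. continuous_on_STM A h \<Longrightarrow> integral_of_motion A F h \<Longrightarrow> h constant_on STM A"
  shows "\<exists>G \<beta>. finsler_metric A G \<and> reversible A G \<and> closed_one_form A \<beta> \<and>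
    (\<forall>x. \<forall>v\<in>tangent_space A x. F x v = G x v + \<beta> x v)"
proof -
  interpret M: reversible_finsler_manifold A F by unfold_locales (fact assms)+
  have "M.direction_invariant constant_on STM A"
    by (rule assms(5)[OF M.direction_invariant_continuous M.direction_invariant_integral])
  then obtain C where C: "\<And>s. s \<in> STM A \<Longrightarrow> M.direction_invariant s = C" unfolding constant_on_def by blast
  have "\<D>2 (reversible_geodesics.Fo (M.lrep F c)) (p, u) (0, w) (0, y) = 0"
    if c: "c \<in> A" and p: "p \<in> chart_range c" and u: "u \<noteq> 0" for c p u w y
  proof -
    interpret R: reversible_geodesics "chart_range c" "M.lrep F c" by (rule M.reversible_geodesics_lrep[OF c])
    have const: "R.\<Lambda> (p, u) = C" if "u \<noteq> 0" for u
    proof -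
      have "tvec_of A c p u \<noteq> (\<lambda>_. 0)" using M.tvec_of_self[OF c p, of u] that by metis
      then have "(chart_inv c p, direction (tvec_of A c p u)) \<in> STM A"
        using M.tvec_of_tangent[OF c p] unfolding STM_def by blast
      then show ?thesis using C M.direction_invariant_local[OF c p that] by metis
    qed
    then have "C = 0" by (rule R.\<Lambda>_constant_imp_zero[OF assms(1) p])
    then show ?thesis using R.\<Lambda>_zero_imp_hessian_zero[OF p _ u] const by blast
  qed
  then have "closed_one_form A M.odd_part"
    using assms(1) by (intro M.odd_part_closed) auto
  moreover have "F x v = M.even_part x v + M.odd_part x v" for x v
    by (simp add: M.even_part_def M.odd_part_def)
  ultimately show ?thesis using M.even_part_finsler M.even_part_reversible by blast
qed

end
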